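(* Let $K$ be a field and let $L(E)=L_K(E)$ denote the Leavitt path algebra of a row-finite graph $E$. Then the following conditions are equivalent: (i) Every nonzero right ideal of every quotient of $L(E)$ contains an infinite idempotent. (ii) Every nonzero left ideal of every quotient of $L(E)$ contains an infinite idempotent. (iii) $L(E)$ is properly purely infinite. (iv) $L(E)$ is purely infinite. (v) Every vertex $v\in E^0$ is properly infinite as an idempotent in $L(E)$. (vi) Every cycle in every maximal tail $M$ in $E$ has exits in $M$, and every vertex in $M$ connects to a cycle in $M$. (vii) $E$ satisfies Condition (K), and every vertex in each maximal tail $M$ in $E$ connects to a cycle in $M$.
   Context: Graphs. A (directed) graph $E=(E^0,E^1,r,s)$ consists of two countable sets $E^0$ (vertices) and $E^1$ (edges) with maps $r,s:E^1\to E^0$ (range and source). $E$ is row-finite if $s^{-1}(v)$ is finite for every $v\in E^0$. A sink is a vertex emitting no edges. A path $\mu=e_1\cdots e_n$ is a sequence of edges with $r(e_i)=s(e_{i+1})$; $s(\mu)=s(e_1)$, $r(\mu)=r(e_n)$, and $\mu^0$ is the set of its vertices. Vertices are also regarded as (trivial) paths of length $0$. A cycle is a path $\mu=e_1\cdots e_n$ of positive length with $s(\mu)=r(\mu)$ and $s(e_i)\neq s(e_j)$ for all $i\neq j$. An edge $e$ is an exit for a path $\mu=e_1\cdots e_n$ if there is $i$ with $s(e)=s(e_i)$ and $e\neq e_i$. For $M\subseteq E^0$, a path in $M$ is a path $\alpha$ with $\alpha^0\subseteq M$; such a path has an exit in $M$ if it has an exit $e$ with $r(e)\in M$. A closed simple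 path based at $v$ is a path $\mu=e_1\cdots e_t$ ($t\ge 1$) with $s(\mu)=r(\mu)=v$ and $s(e_i)\neq v$ for $2\le i\le t$. $E$ satisfies Condition (K) if for each vertex $v$ on a closed simple path there exist at least two distinct closed simple paths based at $v$. Write $v\ge w$ if there is a path in $E$ from $v$ to $w$; $v$ connects to a cycle if $v\ge w$ for some vertex $w$ on the cycle. $H\subseteq E^0$ is hereditary if $v\ge w$ and $v\in H$ imply $w\in H$, and saturated if $s^{-1}(v)\neq\emptyset$ and $r(s^{-1}(v))\subseteq H$ imply $v\in H$. A nonempty subset $M\subseteq E^0$ is a maximal tail if (1) $E^0\setminus M$ is hereditary and saturated, and (2) for every $v,w\in M$ there is $y\in M$ with $v\ge y$ and $w\ge y$. Leavitt path algebra. $L_K(E)$ is the (not necessarily unital) $K$-algebra generated by $E^0\cup E^1\cup\{e^*\mid e\in E^1\}$ with relations: (1) $vw=\delta_{v,w}v$ for $v,w\in E^0$; (2) $s(e)e=er(e)=e$ for $e\in E^1$; (3) $r(e)e^*=e^*s(e)=e^*$ for $e\in E^1$; (4) $e^*f=\delta_{e,f}r(e)$ for $e,f\in E^1$; (5) $v=\sum_{e\in s^{-1}(v)}ee^*$ for every $v\in E^0$ that is not a sink. Ring notions. Rings are associative and not necessarily unital. Idempotents $e,f$ in a ring $R$ are equivalent, $e\sim f$, if $e=xy$ and $f=yx$ for some $x,y\in R$; $e\le f$ means $ef=fe=e$. An idempotent $e$ is infinite if $e\sim f$ for some idempotent $f\le e$, $f\neq e$. An element $a\in R$ is properly infinite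 if $a\neq 0$ and there exist $\alpha_1,\alpha_2,\beta_1,\beta_2\in R$ with $\alpha_i a\beta_j=\delta_{ij}a$ for all $i,j\in\{1,2\}$ (for idempotents this is the usual notion). $R$ is properly purely infinite if every nonzero element of it is properly infinite. $R$ is purely infinite if (i) no quotient of $R$ is a division ring, and (ii) whenever $a\in R$ and $b\in RaR$ (the set of finite sums $\sum_i r_ias_i$ with $r_i,s_i\in R$), there exist $x,y\in R$ with $b=xay$. *)

theory Defs
  imports
    "HOL-Algebra.QuotRing"
    "HOL-Library.Poly_Mapping"
    "HOL-Library.Countable_Set"
    "Graph_Theory.Arc_Walk"
begin

section \<open>Rings without unit\<close>

text \<open>
  A ring that need not be unital is represented by a \<^typ>\<open>'a ring\<close> record whose \<open>one\<close> field is
  meaningless. None of the definitions below refers to that field, nor do the \<open>carrier\<close>,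
  \<open>add\<close>, \<open>zero\<close> and \<open>mult\<close> fields of the library's quotient \<^term>\<open>R Quot I\<close>.
  The library's \<open>ideal\<close> locale presupposes a unital ring, so it cannot be used here.
\<close>

definition right_ideal :: "'a set \<Rightarrow> ('a, 'm) ring_scheme \<Rightarrow> bool" where
  "right_ideal J R \<longleftrightarrow> additive_subgroup J R \<and> (\<forall>a\<in>J. \<forall>r\<in>carrier R. a \<otimes>\<^bsub>R\<^esub> r \<in> J)"

definition left_ideal :: "'a set \<Rightarrow> ('a, 'm) ring_scheme \<Rightarrow> bool" where
  "left_ideal J R \<longleftrightarrow> additive_subgroup J R \<and> (\<forall>a\<in>J. \<forall>r\<in>carrier R. r \<otimes>\<^bsub>R\<^esub> a \<in> J)"

definition two_sided_ideal :: "'a set \<Rightarrow> ('a, 'm) ring_scheme \<Rightarrow> bool" where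
  "two_sided_ideal I R \<longleftrightarrow> left_ideal I R \<and> right_ideal I R"

definition idempotent_elem :: "('a, 'm) ring_scheme \<Rightarrow> 'a \<Rightarrow> bool" where
  "idempotent_elem R e \<longleftrightarrow> e \<in> carrier R \<and> e \<otimes>\<^bsub>R\<^esub> e = e"

definition idem_equiv :: "('a, 'm) ring_scheme \<Rightarrow> 'a \<Rightarrow> 'a \<Rightarrow> bool" where
  "idem_equiv R e f \<longleftrightarrow> (\<exists>x\<in>carrier R. \<exists>y\<in>carrier R. e = x \<otimes>\<^bsub>R\<^esub> y \<and> f = y \<otimes>\<^bsub>R\<^esub> x)"

definition idem_le :: "('a, 'm) ring_scheme \<Rightarrow> 'a \<Rightarrow> 'a \<Rightarrow> bool" where
  "idem_le R e f \<longleftrightarrow> e \<otimes>\<^bsub>R\<^esub> f = e \<and> f \<otimes>\<^bsub>R\<^esub> e = e"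

definition infinite_idempotent :: "('a, 'm) ring_scheme \<Rightarrow> 'a \<Rightarrow> bool" where
  "infinite_idempotent R e \<longleftrightarrow> idempotent_elem R e \<and>
     (\<exists>f. idempotent_elem R f \<and> idem_le R f e \<and> f \<noteq> e \<and> idem_equiv R e f)"

definition properly_infinite :: "('a, 'm) ring_scheme \<Rightarrow> 'a \<Rightarrow> bool" where
  "properly_infinite R a \<longleftrightarrow> a \<in> carrier R \<and> a \<noteq> \<zero>\<^bsub>R\<^esub> \<and>
     (\<exists>\<alpha>1\<in>carrier R. \<exists>\<alpha>2\<in>carrier R. \<exists>\<beta>1\<in>carrier R. \<exists>\<beta>2\<in>carrier R.
        \<alpha>1 \<otimes>\<^bsub>R\<^esub> a \<otimes>\<^bsub>R\<^esub> \<beta>1 = a \<and> \<alpha>1 \<otimes>\<^bsub>R\<^esub> a \<otimes>\<^bsub>R\<^esub> \<beta>2 = \<zero>\<^bsub>R\<^esub> \<and>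
        \<alpha>2 \<otimes>\<^bsub>R\<^esub> a \<otimes>\<^bsub>R\<^esub> \<beta>1 = \<zero>\<^bsub>R\<^esub> \<and> \<alpha>2 \<otimes>\<^bsub>R\<^esub> a \<otimes>\<^bsub>R\<^esub> \<beta>2 = a)"

definition properly_purely_infinite :: "('a, 'm) ring_scheme \<Rightarrow> bool" where
  "properly_purely_infinite R \<longleftrightarrow> (\<forall>a\<in>carrier R. a \<noteq> \<zero>\<^bsub>R\<^esub> \<longrightarrow> properly_infinite R a)"

definition is_division_ring :: "('a, 'm) ring_scheme \<Rightarrow> bool" where
  "is_division_ring R \<longleftrightarrow>
     (\<exists>u\<in>carrier R. u \<noteq> \<zero>\<^bsub>R\<^esub> \<and> (\<forall>x\<in>carrier R. u \<otimes>\<^bsub>R\<^esub> x = x \<and> x \<otimes>\<^bsub>R\<^esub> u = x) \<and>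
        (\<forall>x\<in>carrier R. x \<noteq> \<zero>\<^bsub>R\<^esub> \<longrightarrow> (\<exists>y\<in>carrier R. x \<otimes>\<^bsub>R\<^esub> y = u \<and> y \<otimes>\<^bsub>R\<^esub> x = u)))"

text \<open>The set \<open>RaR\<close> of finite sums of elements \<open>r a s\<close>.\<close>

definition sandwich_sums :: "('a, 'm) ring_scheme \<Rightarrow> 'a \<Rightarrow> 'a set" where
  "sandwich_sums R a =
     {(\<Oplus>\<^bsub>R\<^esub>i\<in>{..<n}. r i \<otimes>\<^bsub>R\<^esub> a \<otimes>\<^bsub>R\<^esub> s i) | (n::nat) r s.
        r \<in> {..<n} \<rightarrow> carrier R \<and> s \<in> {..<n} \<rightarrow> carrier R}"

definition purely_infinite :: "('a, 'm) ring_scheme \<Rightarrow> bool" where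
  "purely_infinite R \<longleftrightarrow>
     (\<forall>I. two_sided_ideal I R \<longrightarrow> \<not> is_division_ring (R Quot I)) \<and>
     (\<forall>a\<in>carrier R. \<forall>b\<in>sandwich_sums R a.
        \<exists>x\<in>carrier R. \<exists>y\<in>carrier R. b = x \<otimes>\<^bsub>R\<^esub> a \<otimes>\<^bsub>R\<^esub> y)"


section \<open>Graphs\<close>

text \<open>
  The source and range maps are \<^const>\<open>tail\<close> and \<^const>\<open>head\<close>, and \<open>s\<^sup>-\<^sup>1(v)\<close> is
  \<^term>\<open>out_arcs G v\<close>. The predicate \<^term>\<open>pre_digraph.awalk G v p w\<close> says that the edge list
  \<open>p\<close> is a path from \<open>v\<close> to \<open>w\<close> (trivial if \<open>p = []\<close>), and
  \<^term>\<open>pre_digraph.awalk_verts G v p\<close> lists its vertices.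
  The library's \<^const>\<open>pre_digraph.cycle\<close> demands that \<open>r(e\<^sub>1), \<dots>, r(e\<^sub>n)\<close> are distinct; for a
  closed path these are \<open>s(e\<^sub>2), \<dots>, s(e\<^sub>n), s(e\<^sub>1)\<close>.
\<close>

definition row_finite :: "('v, 'e) pre_digraph \<Rightarrow> bool" where
  "row_finite G \<longleftrightarrow> (\<forall>v\<in>verts G. finite (out_arcs G v))"

definition connects :: "('v, 'e) pre_digraph \<Rightarrow> 'v \<Rightarrow> 'v \<Rightarrow> bool" where
  "connects G v w \<longleftrightarrow> (\<exists>p. pre_digraph.awalk G v p w)"

definition path_verts :: "('v, 'e) pre_digraph \<Rightarrow> 'e list \<Rightarrow> 'v set" where
  "path_verts G p = tail G ` set p \<union> head G ` set p"
  \<comment> \<open>used for paths of positive length only\<close>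

definition exit_of :: "('v, 'e) pre_digraph \<Rightarrow> 'e list \<Rightarrow> 'e \<Rightarrow> bool" where
  "exit_of G p e \<longleftrightarrow> e \<in> arcs G \<and> (\<exists>i<length p. tail G e = tail G (p ! i) \<and> e \<noteq> p ! i)"

definition cycle_in :: "('v, 'e) pre_digraph \<Rightarrow> 'v set \<Rightarrow> 'e list \<Rightarrow> bool" where
  "cycle_in G M p \<longleftrightarrow> pre_digraph.cycle G p \<and> path_verts G p \<subseteq> M"

definition has_exit_in :: "('v, 'e) pre_digraph \<Rightarrow> 'v set \<Rightarrow> 'e list \<Rightarrow> bool" where
  "has_exit_in G M p \<longleftrightarrow> (\<exists>e. exit_of G p e \<and> head G e \<in> M)"

definition connects_to_cycle :: "('v, 'e) pre_digraph \<Rightarrow> 'v \<Rightarrow> 'e list \<Rightarrow> bool" where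
  "connects_to_cycle G v p \<longleftrightarrow> (\<exists>w\<in>path_verts G p. connects G v w)"

definition closed_simple_path :: "('v, 'e) pre_digraph \<Rightarrow> 'v \<Rightarrow> 'e list \<Rightarrow> bool" where
  "closed_simple_path G v p \<longleftrightarrow>
     p \<noteq> [] \<and> pre_digraph.awalk G v p v \<and> (\<forall>e\<in>set (tl p). tail G e \<noteq> v)"

definition condition_K :: "('v, 'e) pre_digraph \<Rightarrow> bool" where
  "condition_K G \<longleftrightarrow>
     (\<forall>v. (\<exists>u p. closed_simple_path G u p \<and> v \<in> path_verts G p) \<longrightarrow>
        (\<exists>p q. p \<noteq> q \<and> closed_simple_path G v p \<and> closed_simple_path G v q))"

definition hereditary :: "('v, 'e) pre_digraph \<Rightarrow> 'v set \<Rightarrow> bool" where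
  "hereditary G H \<longleftrightarrow> H \<subseteq> verts G \<and> (\<forall>v w. connects G v w \<and> v \<in> H \<longrightarrow> w \<in> H)"

definition saturated :: "('v, 'e) pre_digraph \<Rightarrow> 'v set \<Rightarrow> bool" where
  "saturated G H \<longleftrightarrow>
     (\<forall>v\<in>verts G. out_arcs G v \<noteq> {} \<and> head G ` out_arcs G v \<subseteq> H \<longrightarrow> v \<in> H)"

definition maximal_tail :: "('v, 'e) pre_digraph \<Rightarrow> 'v set \<Rightarrow> bool" where
  "maximal_tail G M \<longleftrightarrow> M \<noteq> {} \<and> M \<subseteq> verts G \<and>
     hereditary G (verts G - M) \<and> saturated G (verts G - M) \<and>
     (\<forall>v\<in>M. \<forall>w\<in>M. \<exists>y\<in>M. connects G v y \<and> connects G w y)"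


section \<open>Leavitt path algebras\<close>

text \<open>
  The free monoid, written additively because \<^typ>\<open>'m \<Rightarrow>\<^sub>0 'k\<close> carries the monoid algebra
  multiplication for an additive monoid \<open>'m\<close>.
\<close>

datatype 'a free_mon = FM (letters: "'a list")

instantiation free_mon :: (type) monoid_add
begin

definition zero_free_mon :: "'a free_mon" where
  "zero_free_mon = FM []"

definition plus_free_mon :: "'a free_mon \<Rightarrow> 'a free_mon \<Rightarrow> 'a free_mon" where
  "plus_free_mon u v = FM (letters u @ letters v)"

instance
  by standard (simp_all add: zero_free_mon_def plus_free_mon_def)

end

datatype ('v, 'e) leavitt_gen = Vert 'v | Edge 'e | Ghost 'e

type_synonym ('v, 'e, 'k) leavitt_free = "('v, 'e) leavitt_gen free_mon \<Rightarrow>\<^sub>0 'k"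

definition leavitt_gens :: "('v, 'e) pre_digraph \<Rightarrow> ('v, 'e) leavitt_gen set" where
  "leavitt_gens G = Vert ` verts G \<union> Edge ` arcs G \<union> Ghost ` arcs G"

text \<open>
  The free non-unital algebra on \<^term>\<open>leavitt_gens G\<close>: the linear combinations of nonempty words.
\<close>

definition leavitt_free_alg :: "('v, 'e) pre_digraph \<Rightarrow> ('v, 'e, 'k::field) leavitt_free ring" where
  "leavitt_free_alg G =
     \<lparr>carrier = {p. \<forall>w\<in>Poly_Mapping.keys p. letters w \<noteq> [] \<and> set (letters w) \<subseteq> leavitt_gens G},
      mult = (*), one = 0, zero = 0, add = (+)\<rparr>"

definition fgen :: "('v, 'e) leavitt_gen \<Rightarrow> ('v, 'e, 'k::field) leavitt_free" where
  "fgen x = Poly_Mapping.single (FM [x]) 1"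

inductive_set leavitt_rels :: "('v, 'e) pre_digraph \<Rightarrow> ('v, 'e, 'k::field) leavitt_free set"
  for G :: "('v, 'e) pre_digraph" where
  vert_vert: "\<lbrakk>v \<in> verts G; w \<in> verts G\<rbrakk> \<Longrightarrow>
    fgen (Vert v) * fgen (Vert w) - (if v = w then fgen (Vert v) else 0) \<in> leavitt_rels G"
| source_edge: "e \<in> arcs G \<Longrightarrow>
    fgen (Vert (tail G e)) * fgen (Edge e) - fgen (Edge e) \<in> leavitt_rels G"
| edge_range: "e \<in> arcs G \<Longrightarrow>
    fgen (Edge e) * fgen (Vert (head G e)) - fgen (Edge e) \<in> leavitt_rels G"
| range_ghost: "e \<in> arcs G \<Longrightarrow>
    fgen (Vert (head G e)) * fgen (Ghost e) - fgen (Ghost e) \<in> leavitt_rels G"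
| ghost_source: "e \<in> arcs G \<Longrightarrow>
    fgen (Ghost e) * fgen (Vert (tail G e)) - fgen (Ghost e) \<in> leavitt_rels G"
| ghost_edge: "\<lbrakk>e \<in> arcs G; f \<in> arcs G\<rbrakk> \<Longrightarrow>
    fgen (Ghost e) * fgen (Edge f) - (if e = f then fgen (Vert (head G e)) else 0) \<in> leavitt_rels G"
| vert_sum: "\<lbrakk>v \<in> verts G; out_arcs G v \<noteq> {}\<rbrakk> \<Longrightarrow>
    fgen (Vert v) - (\<Sum>e\<in>out_arcs G v. fgen (Edge e) * fgen (Ghost e)) \<in> leavitt_rels G"

text \<open>
  The algebra ideal generated by the relations. Closure under scalars has to be required
  separately, as the free algebra is not unital; \<^term>\<open>Poly_Mapping.single 0 c\<close> is the scalar
  \<open>c\<close>, i.e. \<open>c\<close> times the empty word.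
\<close>

inductive_set leavitt_ideal :: "('v, 'e) pre_digraph \<Rightarrow> ('v, 'e, 'k::field) leavitt_free set"
  for G :: "('v, 'e) pre_digraph" where
  rel: "a \<in> leavitt_rels G \<Longrightarrow> a \<in> leavitt_ideal G"
| zero: "0 \<in> leavitt_ideal G"
| add: "\<lbrakk>a \<in> leavitt_ideal G; b \<in> leavitt_ideal G\<rbrakk> \<Longrightarrow> a + b \<in> leavitt_ideal G"
| scale: "a \<in> leavitt_ideal G \<Longrightarrow> Poly_Mapping.single 0 c * a \<in> leavitt_ideal G"
| mult_left: "\<lbrakk>a \<in> leavitt_ideal G; x \<in> carrier (leavitt_free_alg G)\<rbrakk> \<Longrightarrow> x * a \<in> leavitt_ideal G"
| mult_right: "\<lbrakk>a \<in> leavitt_ideal G; x \<in> carrier (leavitt_free_alg G)\<rbrakk> \<Longrightarrow> a * x \<in> leavitt_ideal G"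

text \<open>The argument of type \<^typ>\<open>'k itself\<close> names the coefficient field.\<close>

definition leavitt_path_algebra ::
  "'k::field itself \<Rightarrow> ('v, 'e) pre_digraph \<Rightarrow> ('v, 'e, 'k) leavitt_free set ring" where
  "leavitt_path_algebra K G = leavitt_free_alg G Quot leavitt_ideal G"

definition leavitt_vertex ::
  "'k::field itself \<Rightarrow> ('v, 'e) pre_digraph \<Rightarrow> 'v \<Rightarrow> ('v, 'e, 'k) leavitt_free set" where
  "leavitt_vertex K G v = leavitt_ideal G +>\<^bsub>leavitt_free_alg G\<^esub> fgen (Vert v)"

end

theory Submission
  imports Defs "HOL-Library.Sublist" "HOL-Library.Function_Algebras"
begin

text \<open>
  Write \<open>b \<lesssim> a\<close> (the predicate \<open>below\<close>) when \<open>b = x a y\<close> for some \<open>x\<close>, \<open>y\<close> in the ring. The seven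
  conditions are linked by the implications
  \<open>(iii) \<Longrightarrow> (iv) \<Longrightarrow> (v) \<Longrightarrow> (vi) \<Longrightarrow> (vii) \<Longrightarrow> (iii)\<close>, \<open>(vii) \<Longrightarrow> (i) \<Longrightarrow> (vi)\<close> and
  \<open>(vii) \<Longrightarrow> (ii) \<Longrightarrow> (vi)\<close>, where (ii) is (i) for the opposite ring.

  \<^emph>\<open>From elements to ideals.\<close> If \<open>a\<close> is properly infinite then \<open>{b. b \<lesssim> a}\<close> is closed under
  addition, so every finite sum of elements \<open>r a s\<close> is a single product \<open>x a y\<close>; this gives
  \<open>(iii) \<Longrightarrow> (iv)\<close>. Conversely one proves that \<open>a\<close> is properly infinite by finding a properly
  infinite idempotent \<open>p\<close> with \<open>p \<lesssim> a \<lesssim> p\<close>. Such a \<open>p\<close> is assembled from orthogonal idempotents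
  below \<open>a\<close>: by \<open>below_of_decomposition\<close>, a properly infinite idempotent \<open>p \<lesssim> a\<close> splits off from
  \<open>a\<close>, and its proper infiniteness then absorbs anything in the ideal that it generates. As a
  result, \<open>a\<close> is properly infinite as soon as it lies in the ideal generated by properly infinite
  vertices below \<open>a\<close> (\<open>properly_infinite_of_mem_idempotents_ideal\<close>).

  \<^emph>\<open>Sufficiency of (vii).\<close> A vertex on a cycle is properly infinite, because Condition (K) gives
  two incomparable closed paths through it. For an arbitrary vertex \<open>v\<close>, let \<open>I\<close> be the ideal
  generated by the vertices on cycles that \<open>v\<close> reaches. The vertices in \<open>I\<close> form a hereditary
  saturated set; if \<open>v \<notin> I\<close>, some maximal tail contains \<open>v\<close> and avoids that set, so \<open>v\<close> cannot
  connect to a cycle inside that tail. Hence \<open>v \<in> I\<close>, and \<open>v\<close> is properly infinite. For an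
  arbitrary element \<open>a\<close>, the theorem \<open>reduction_to_vertex\<close> says that under Condition (K) an element outside an
  ideal \<open>I\<close> has a vertex \<open>w \<notin> I\<close> below it. Applied to the ideal generated by the vertices below
  \<open>a\<close>, it shows that \<open>a\<close> lies in this ideal, which is (iii); applied to an ideal \<open>I\<close> and a lift of
  a nonzero element of the quotient by \<open>I\<close>, it gives an infinite idempotent in each of the one-sided
  ideals that contain that element, which is (i) and (ii).

  \<^emph>\<open>From (iv) to (v).\<close> If an edge \<open>e\<close> enters \<open>y\<close> from another vertex, then \<open>y + e e\<^sup>*\<close> is a sum of
  two orthogonal copies of \<open>y\<close> in the ideal generated by \<open>y\<close>, so (iv) puts it below \<open>y\<close>. Two loops
  at \<open>y\<close> make it properly infinite at once. If every edge that enters \<open>y\<close> is a loop and there is at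
  most one of them, then either the heads of the edges that leave \<open>y\<close> are covered by the first case,
  or \<open>{y}\<close> is the complement of a hereditary saturated set and yields a quotient isomorphic to \<open>K\<close>.

  \<^emph>\<open>Necessity of the graph conditions.\<close> Each of (i), (ii) and (v) provides an infinite idempotent in
  the corner at any vertex that survives in a quotient. If (vi) fails at a maximal tail \<open>M\<close>, there is a
  vertex \<open>v \<in> M\<close> whose paths inside \<open>M\<close> either never branch or never return. Letting the algebra act
  on functions on \<open>M \<times> \<nat>\<close>, finitely many elements of the corner at \<open>v\<close> then act as linear
  combinations of finitely many operators, whose products are again among them or zero; an infinite
  idempotent would produce infinitely many independent vectors in a finite-dimensional space
  (\<open>no_infinite_idempotent_in_corner\<close>).

  Finally, \<open>(vi) \<Longleftrightarrow> (vii)\<close> is pure graph theory: the vertices from which a vertex on a cycle can be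
  reached form a maximal tail, and an exit inside this tail leads back to the cycle, which gives a second
  closed simple path; conversely, a cycle without exits admits only one closed simple path at a vertex.
\<close>

section \<open>Rings without unit\<close>

locale nonunital_ring = abelian_group R for R :: "('a, 'm) ring_scheme" (structure) +
  assumes m_closed [intro, simp]: "\<lbrakk>x \<in> carrier R; y \<in> carrier R\<rbrakk> \<Longrightarrow> x \<otimes> y \<in> carrier R"
    and m_assoc: "\<lbrakk>x \<in> carrier R; y \<in> carrier R; z \<in> carrier R\<rbrakk> \<Longrightarrow> (x \<otimes> y) \<otimes> z = x \<otimes> (y \<otimes> z)"
    and l_distr: "\<lbrakk>x \<in> carrier R; y \<in> carrier R; z \<in> carrier R\<rbrakk> \<Longrightarrow> (x \<oplus> y) \<otimes> z = x \<otimes> z \<oplus> y \<otimes> z"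
    and r_distr: "\<lbrakk>x \<in> carrier R; y \<in> carrier R; z \<in> carrier R\<rbrakk> \<Longrightarrow> z \<otimes> (x \<oplus> y) = z \<otimes> x \<oplus> z \<otimes> y"
begin

lemma l_null [simp]: "x \<in> carrier R \<Longrightarrow> \<zero> \<otimes> x = \<zero>"
  using l_distr[of \<zero> \<zero> x] by (metis add.l_cancel_one' add.m_closed l_zero m_closed zero_closed)

lemma r_null [simp]: "x \<in> carrier R \<Longrightarrow> x \<otimes> \<zero> = \<zero>"
  using r_distr[of \<zero> \<zero> x] by (metis add.l_cancel_one' add.m_closed l_zero m_closed zero_closed)

lemma l_minus: "\<lbrakk>x \<in> carrier R; y \<in> carrier R\<rbrakk> \<Longrightarrow> (\<ominus> x) \<otimes> y = \<ominus> (x \<otimes> y)"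
  by (rule minus_equality[symmetric]) (simp_all flip: l_distr add: l_neg)

lemma r_minus: "\<lbrakk>x \<in> carrier R; y \<in> carrier R\<rbrakk> \<Longrightarrow> x \<otimes> (\<ominus> y) = \<ominus> (x \<otimes> y)"
  by (rule minus_equality[symmetric]) (simp_all flip: r_distr add: l_neg)

lemma l_distr_minus:
  "\<lbrakk>x \<in> carrier R; y \<in> carrier R; z \<in> carrier R\<rbrakk> \<Longrightarrow> (x \<ominus> y) \<otimes> z = x \<otimes> z \<ominus> y \<otimes> z"
  by (simp add: minus_eq l_distr l_minus)

lemma r_distr_minus:
  "\<lbrakk>x \<in> carrier R; y \<in> carrier R; z \<in> carrier R\<rbrakk> \<Longrightarrow> z \<otimes> (x \<ominus> y) = z \<otimes> x \<ominus> z \<otimes> y"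
  by (simp add: minus_eq r_distr r_minus)

lemma minus_self [simp]: "x \<in> carrier R \<Longrightarrow> x \<ominus> x = \<zero>"
  by (simp add: minus_eq r_neg)

lemma minus_zero [simp]: "x \<in> carrier R \<Longrightarrow> x \<ominus> \<zero> = x"
  using minus_equality[of \<zero> \<zero>] by (simp add: minus_eq)

lemma finsum_mult_right:
  assumes "f \<in> A \<rightarrow> carrier R" "a \<in> carrier R"
  shows "(\<Oplus>i\<in>A. f i) \<otimes> a = (\<Oplus>i\<in>A. f i \<otimes> a)"
  using assms
  by (induction A rule: infinite_finite_induct) (simp_all add: l_distr Pi_def)

lemma finsum_mult_left:
  assumes "f \<in> A \<rightarrow> carrier R" "a \<in> carrier R"
  shows "a \<otimes> (\<Oplus>i\<in>A. f i) = (\<Oplus>i\<in>A. a \<otimes> f i)"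
  using assms
  by (induction A rule: infinite_finite_induct) (simp_all add: r_distr Pi_def)

lemma two_sided_idealI:
  assumes "I \<subseteq> carrier R" "\<zero> \<in> I" "\<And>x y. \<lbrakk>x \<in> I; y \<in> I\<rbrakk> \<Longrightarrow> x \<oplus> y \<in> I"
    and "\<And>x. x \<in> I \<Longrightarrow> \<ominus> x \<in> I"
    and "\<And>x r. \<lbrakk>x \<in> I; r \<in> carrier R\<rbrakk> \<Longrightarrow> r \<otimes> x \<in> I"
    and "\<And>x r. \<lbrakk>x \<in> I; r \<in> carrier R\<rbrakk> \<Longrightarrow> x \<otimes> r \<in> I"
  shows "two_sided_ideal I R"
proof -
  have "additive_subgroup I R"
    by (rule additive_subgroupI, rule add.subgroupI) (use assms in \<open>auto simp: a_inv_def\<close>)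
  then show ?thesis
    using assms by (simp add: two_sided_ideal_def left_ideal_def right_ideal_def)
qed

end

subsection \<open>The opposite ring\<close>

definition opposite_ring :: "('a, 'm) ring_scheme \<Rightarrow> ('a, 'm) ring_scheme" where
  "opposite_ring R = R\<lparr>mult := \<lambda>x y. y \<otimes>\<^bsub>R\<^esub> x\<rparr>"

lemma opposite_ring_simps [simp]:
  "carrier (opposite_ring R) = carrier R" "zero (opposite_ring R) = zero R"
  "add (opposite_ring R) = add R" "mult (opposite_ring R) x y = y \<otimes>\<^bsub>R\<^esub> x"
  by (simp_all add: opposite_ring_def)

lemma add_monoid_opposite_ring: "add_monoid (opposite_ring R) = add_monoid R"
  by (simp add: opposite_ring_def)

lemma (in nonunital_ring) nonunital_ring_opposite: "nonunital_ring (opposite_ring R)"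
proof -
  have "abelian_group (opposite_ring R)"
    using abelian_group_axioms
    by (simp add: abelian_group_def abelian_group_axioms_def abelian_monoid_def
        add_monoid_opposite_ring)
  then show ?thesis
    by (simp add: nonunital_ring_def nonunital_ring_axioms_def m_assoc l_distr r_distr)
qed

lemma left_ideal_iff_right_ideal_opposite: "left_ideal J R \<longleftrightarrow> right_ideal J (opposite_ring R)"
  by (simp add: left_ideal_def right_ideal_def additive_subgroup_def add_monoid_opposite_ring)

lemma infinite_idempotent_opposite:
  "infinite_idempotent (opposite_ring R) e \<longleftrightarrow> infinite_idempotent R e"
  unfolding infinite_idempotent_def idempotent_elem_def idem_le_def idem_equiv_def
    opposite_ring_simps
  by blast

subsection \<open>Quotients by two-sided ideals\<close>

locale nonunital_ring_ideal = nonunital_ring R for R :: "('a, 'm) ring_scheme" (structure) +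
  fixes I
  assumes two_sided: "two_sided_ideal I R"
begin

sublocale abelian_subgroup I R
  using two_sided abelian_group_axioms
  by (auto simp: two_sided_ideal_def left_ideal_def intro: abelian_subgroupI3)

lemma ideal_mult_left: "\<lbrakk>a \<in> I; r \<in> carrier R\<rbrakk> \<Longrightarrow> r \<otimes> a \<in> I"
  using two_sided by (auto simp: two_sided_ideal_def left_ideal_def)

lemma ideal_mult_right: "\<lbrakk>a \<in> I; r \<in> carrier R\<rbrakk> \<Longrightarrow> a \<otimes> r \<in> I"
  using two_sided by (auto simp: two_sided_ideal_def right_ideal_def)

lemma coset_eq_iff:
  assumes "x \<in> carrier R" "y \<in> carrier R"
  shows "I +> x = I +> y \<longleftrightarrow> x \<ominus> y \<in> I"
  using assms a_rcos_module[of y x] a_repr_independence'[of x y]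
  by (metis a_rcos_self minus_eq)

text \<open>
  The usual argument for well-definedness, from \<open>x' y' - x y = (x' - x) y' + x (y' - y)\<close>.
\<close>

lemma mult_coset:
  assumes x: "x \<in> carrier R" and y: "y \<in> carrier R"
  shows "rcoset_mult R I (I +> x) (I +> y) = I +> (x \<otimes> y)"
proof -
  have eq: "I +> (x' \<otimes> y') = I +> (x \<otimes> y)" if "x' \<in> I +> x" "y' \<in> I +> y" for x' y'
  proof -
    have c: "x' \<in> carrier R" "y' \<in> carrier R"
      using that x y a_elemrcos_carrier by blast+
    have d: "x' \<ominus> x \<in> I" "y' \<ominus> y \<in> I"
      using that c x y by (auto simp: a_rcos_module minus_eq)
    have "(x' \<ominus> x) \<otimes> y' \<oplus> x \<otimes> (y' \<ominus> y) \<in> I"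
      by (intro a_closed ideal_mult_right ideal_mult_left d c x y)
    moreover have "(x' \<ominus> x) \<otimes> y' \<oplus> x \<otimes> (y' \<ominus> y) = x' \<otimes> y' \<ominus> x \<otimes> y"
      using x y c by (simp add: minus_eq l_distr r_distr l_minus r_minus a_assoc r_neg1 r_neg2)
    ultimately show ?thesis
      using c x y by (simp add: coset_eq_iff)
  qed
  have "(\<Union>a\<in>I +> x. \<Union>b\<in>I +> y. I +> (a \<otimes> b)) = (\<Union>a\<in>I +> x. \<Union>b\<in>I +> y. I +> (x \<otimes> y))"
    by (rule SUP_cong[OF refl], rule SUP_cong[OF refl]) (rule eq)
  also have "\<dots> = I +> (x \<otimes> y)"
    using a_rcos_self[OF x] a_rcos_self[OF y] by auto
  finally show ?thesis
    unfolding rcoset_mult_def .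
qed

abbreviation "q \<equiv> \<lambda>x. I +> x"

lemma carrier_quotient: "carrier (R Quot I) = q ` carrier R"
  by (auto simp: FactRing_def A_RCOSETS_def')

lemma quotientE:
  assumes "X \<in> carrier (R Quot I)"
  obtains x where "x \<in> carrier R" "X = q x"
  using assms by (auto simp: carrier_quotient)

lemma q_closed [simp]: "x \<in> carrier R \<Longrightarrow> q x \<in> carrier (R Quot I)"
  by (simp add: carrier_quotient)

lemma q_mult: "\<lbrakk>x \<in> carrier R; y \<in> carrier R\<rbrakk> \<Longrightarrow> q x \<otimes>\<^bsub>R Quot I\<^esub> q y = q (x \<otimes> y)"
  by (simp add: FactRing_def mult_coset)

lemma q_add: "\<lbrakk>x \<in> carrier R; y \<in> carrier R\<rbrakk> \<Longrightarrow> q x \<oplus>\<^bsub>R Quot I\<^esub> q y = q (x \<oplus> y)"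
  by (simp add: FactRing_def a_rcos_sum)

lemma q_zero_eq: "\<zero>\<^bsub>R Quot I\<^esub> = q \<zero>"
  by (simp add: FactRing_def a_rcos_const)

lemma q_eq_zero_iff: "x \<in> carrier R \<Longrightarrow> q x = \<zero>\<^bsub>R Quot I\<^esub> \<longleftrightarrow> x \<in> I"
  by (simp add: q_zero_eq coset_eq_iff minus_zero)

lemma nonunital_ring_quotient: "nonunital_ring (R Quot I)"
proof (intro nonunital_ring.intro nonunital_ring_axioms.intro)
  show "abelian_group (R Quot I)"
    by (rule comm_group_abelian_groupI)
      (simp add: FactRing_def a_factorgroup_is_comm_group[unfolded A_FactGroup_def'])
qed (auto simp: carrier_quotient q_mult q_add m_assoc l_distr r_distr)

lemma finsum_mem_ideal:
  assumes "\<And>i. i \<in> A \<Longrightarrow> f i \<in> I"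
  shows "(\<Oplus>i\<in>A. f i) \<in> I"
  using assms by (induction A rule: infinite_finite_induct) (auto simp: Pi_def)

end

section \<open>Properly infinite elements\<close>

text \<open>
  For idempotents this is subequivalence: \<open>e \<lesssim> f\<close> means that \<open>e\<close> is equivalent to an idempotent
  \<open>\<le> f\<close>.
\<close>

definition below :: "('a, 'm) ring_scheme \<Rightarrow> 'a \<Rightarrow> 'a \<Rightarrow> bool" where
  "below R b a \<longleftrightarrow> (\<exists>x\<in>carrier R. \<exists>y\<in>carrier R. b = x \<otimes>\<^bsub>R\<^esub> a \<otimes>\<^bsub>R\<^esub> y)"

context nonunital_ring
begin

lemma belowI: "\<lbrakk>x \<in> carrier R; y \<in> carrier R; b = x \<otimes> a \<otimes> y\<rbrakk> \<Longrightarrow> below R b a"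
  by (auto simp: below_def)

lemma belowE:
  assumes "below R b a"
  obtains x y where "x \<in> carrier R" "y \<in> carrier R" "b = x \<otimes> a \<otimes> y"
  using assms by (auto simp: below_def)

lemma below_closed: "\<lbrakk>below R b a; a \<in> carrier R\<rbrakk> \<Longrightarrow> b \<in> carrier R"
  by (auto simp: below_def)

lemma below_trans:
  assumes "below R c b" "below R b a" "a \<in> carrier R"
  shows "below R c a"
proof -
  obtain x y x' y' where *: "x \<in> carrier R" "y \<in> carrier R" "c = x \<otimes> b \<otimes> y"
     "x' \<in> carrier R" "y' \<in> carrier R" "b = x' \<otimes> a \<otimes> y'"
    using assms by (metis belowE)
  then show ?thesis
    using assms(3) by (intro belowI[of "x \<otimes> x'" "y' \<otimes> y"]) (simp_all add: m_assoc)
qed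

lemma below_mult_left:
  assumes "below R b a" "a \<in> carrier R" "r \<in> carrier R"
  shows "below R (r \<otimes> b) a"
proof -
  obtain x y where "x \<in> carrier R" "y \<in> carrier R" "b = x \<otimes> a \<otimes> y"
    using assms(1) by (rule belowE)
  then show ?thesis
    using assms by (intro belowI[of "r \<otimes> x" y]) (simp_all add: m_assoc)
qed

lemma below_mult_right:
  assumes "below R b a" "a \<in> carrier R" "r \<in> carrier R"
  shows "below R (b \<otimes> r) a"
proof -
  obtain x y where "x \<in> carrier R" "y \<in> carrier R" "b = x \<otimes> a \<otimes> y"
    using assms(1) by (rule belowE)
  then show ?thesis
    using assms by (intro belowI[of x "y \<otimes> r"]) (simp_all add: m_assoc)
qed

lemma below_uminus:
  assumes "below R b a" "a \<in> carrier R"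
  shows "below R (\<ominus> b) a"
proof -
  obtain x y where "x \<in> carrier R" "y \<in> carrier R" "b = x \<otimes> a \<otimes> y"
    using assms(1) by (rule belowE)
  then show ?thesis
    using assms by (intro belowI[of "\<ominus> x" y]) (simp_all add: l_minus)
qed

lemma below_zero: "a \<in> carrier R \<Longrightarrow> below R \<zero> a"
  by (rule belowI[of \<zero> \<zero>]) simp_all

lemma idempotent_below_self: "\<lbrakk>p \<in> carrier R; p \<otimes> p = p\<rbrakk> \<Longrightarrow> below R p p"
  by (rule belowI[of p p]) simp_all

lemma properly_infiniteE:
  assumes "properly_infinite R a"
  obtains \<alpha>1 \<alpha>2 \<beta>1 \<beta>2 where "\<alpha>1 \<in> carrier R" "\<alpha>2 \<in> carrier R" "\<beta>1 \<in> carrier R" "\<beta>2 \<in> carrier R"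
    "a \<in> carrier R" "a \<noteq> \<zero>"
    "\<alpha>1 \<otimes> (a \<otimes> \<beta>1) = a" "\<alpha>1 \<otimes> (a \<otimes> \<beta>2) = \<zero>" "\<alpha>2 \<otimes> (a \<otimes> \<beta>1) = \<zero>" "\<alpha>2 \<otimes> (a \<otimes> \<beta>2) = a"
  using assms unfolding properly_infinite_def by (auto simp: m_assoc)

lemma properly_infiniteI:
  assumes "\<alpha>1 \<in> carrier R" "\<alpha>2 \<in> carrier R" "\<beta>1 \<in> carrier R" "\<beta>2 \<in> carrier R"
    "a \<in> carrier R" "a \<noteq> \<zero>"
    "\<alpha>1 \<otimes> (a \<otimes> \<beta>1) = a" "\<alpha>1 \<otimes> (a \<otimes> \<beta>2) = \<zero>" "\<alpha>2 \<otimes> (a \<otimes> \<beta>1) = \<zero>" "\<alpha>2 \<otimes> (a \<otimes> \<beta>2) = a"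
  shows "properly_infinite R a"
proof -
  have "\<alpha>1 \<otimes> a \<otimes> \<beta>1 = a \<and> \<alpha>1 \<otimes> a \<otimes> \<beta>2 = \<zero> \<and> \<alpha>2 \<otimes> a \<otimes> \<beta>1 = \<zero> \<and> \<alpha>2 \<otimes> a \<otimes> \<beta>2 = a"
    using assms by (simp add: m_assoc)
  then show ?thesis
    unfolding properly_infinite_def using assms by blast
qed

text \<open>
  With products associated to the right, a known product \<open>x y = z\<close> has to be recognised in front of
  a further factor; this and the next lemma turn such equations into rewrite rules.
\<close>

lemma mult_cancel_assoc:
  assumes "x \<otimes> y = z" "x \<in> carrier R" "y \<in> carrier R" "t \<in> carrier R"
  shows "x \<otimes> (y \<otimes> t) = z \<otimes> t"
  using assms by (metis m_assoc)

lemma mult_cancel_assoc3: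
  assumes "x \<otimes> (y \<otimes> w) = z" "x \<in> carrier R" "y \<in> carrier R" "w \<in> carrier R" "t \<in> carrier R"
  shows "x \<otimes> (y \<otimes> (w \<otimes> t)) = z \<otimes> t"
  using assms by (metis m_assoc m_closed)

text \<open>
  The two copies of \<open>a\<close> inside \<open>a\<close> carry the two summands.
\<close>

lemma below_add:
  assumes a: "properly_infinite R a" and b: "below R b a" and c: "below R c a"
  shows "below R (b \<oplus> c) a"
proof -
  obtain \<alpha>1 \<alpha>2 \<beta>1 \<beta>2 where *: "\<alpha>1 \<in> carrier R" "\<alpha>2 \<in> carrier R" "\<beta>1 \<in> carrier R" "\<beta>2 \<in> carrier R"
    "a \<in> carrier R" "a \<noteq> \<zero>"
    "\<alpha>1 \<otimes> (a \<otimes> \<beta>1) = a" "\<alpha>1 \<otimes> (a \<otimes> \<beta>2) = \<zero>" "\<alpha>2 \<otimes> (a \<otimes> \<beta>1) = \<zero>" "\<alpha>2 \<otimes> (a \<otimes> \<beta>2) = a"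
    using a by (rule properly_infiniteE)
  obtain x y where x: "x \<in> carrier R" "y \<in> carrier R" "b = x \<otimes> a \<otimes> y"
    using b by (rule belowE)
  obtain x' y' where x': "x' \<in> carrier R" "y' \<in> carrier R" "c = x' \<otimes> a \<otimes> y'"
    using c by (rule belowE)
  have "(x \<otimes> \<alpha>1 \<oplus> x' \<otimes> \<alpha>2) \<otimes> a \<otimes> (\<beta>1 \<otimes> y \<oplus> \<beta>2 \<otimes> y') = b \<oplus> c"
    using * x x' by (simp add: m_assoc l_distr r_distr mult_cancel_assoc3[OF *(7)]
        mult_cancel_assoc3[OF *(8)] mult_cancel_assoc3[OF *(9)] mult_cancel_assoc3[OF *(10)])
  then show ?thesis
    using * x x' by (metis belowI add.m_closed m_closed)
qed

lemma properly_infinite_below_self: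
  assumes "properly_infinite R a"
  shows "below R a a"
  using assms by (auto simp: properly_infinite_def below_def) metis

text \<open>
  The idempotents \<open>P\<close> and \<open>Q\<close> of the proof, both equivalent to \<open>p\<close>, satisfy \<open>P a = a Q\<close>. So
  \<open>a\<close> is the orthogonal sum of \<open>P a\<close>, which is equivalent to \<open>p\<close>, and of \<open>a - P a\<close>. Modulo the ideal
  generated by \<open>p\<close> only the second part matters, and the first part takes care of everything that lies
  in this ideal. This replaces the lifting of idempotents from quotients.
\<close>

lemma below_of_decomposition:
  assumes a: "a \<in> carrier R" and pi: "properly_infinite R p" and pp: "p \<otimes> p = p"
    and pa: "below R p a" and z: "z \<in> carrier R" and w: "w \<in> carrier R" and j: "below R j p"
  shows "below R (z \<otimes> a \<otimes> w \<oplus> j) a"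
proof -
  have p: "p \<in> carrier R"
    using pi by (simp add: properly_infinite_def)
  obtain z' w' where zw': "z' \<in> carrier R" "w' \<in> carrier R" "p = z' \<otimes> a \<otimes> w'"
    using pa by (rule belowE)
  \<comment> \<open>\<open>P \<in> a R\<close> and \<open>Q \<in> R a\<close> are the idempotents equivalent to \<open>p\<close> that \<open>p = z' a w'\<close> provides.\<close>
  define P where "P = a \<otimes> (w' \<otimes> (p \<otimes> z'))"
  define Q where "Q = w' \<otimes> (p \<otimes> (z' \<otimes> a))"
  have c: "P \<in> carrier R" "Q \<in> carrier R"
    using zw'(1,2) a p by (simp_all add: P_def Q_def)
  have h: "z' \<otimes> (a \<otimes> w') = p"
    using zw'(1,2) a by (simp add: zw'(3) m_assoc)
  have h': "z' \<otimes> (a \<otimes> (w' \<otimes> t)) = p \<otimes> t" if "t \<in> carrier R" for t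
    using h zw' a that by (rule_tac mult_cancel_assoc3)
  have pp': "p \<otimes> (p \<otimes> t) = p \<otimes> t" if "t \<in> carrier R" for t
    using mult_cancel_assoc[OF pp] p that by simp
  \<comment> \<open>Replacing \<open>a\<close> by \<open>a - P a\<close> in \<open>z a w\<close> changes it by an element below \<open>p\<close>, which is merged with \<open>j\<close>.\<close>
  have "below R (z \<otimes> (P \<otimes> (a \<otimes> w))) p"
    using z w zw'(1,2) a p by (intro belowI[of "z \<otimes> (a \<otimes> w')" "z' \<otimes> (a \<otimes> w)"]) (simp_all add: P_def m_assoc)
  then have "below R (z \<otimes> (P \<otimes> (a \<otimes> w)) \<oplus> j) p"
    using j by (rule below_add[OF pi])
  then obtain x y where xy: "x \<in> carrier R" "y \<in> carrier R"
      "z \<otimes> (P \<otimes> (a \<otimes> w)) \<oplus> j = x \<otimes> p \<otimes> y"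
    by (rule belowE)
  have jc: "j \<in> carrier R"
    using j p by (rule below_closed)
  define Z1 where "Z1 = z \<ominus> z \<otimes> P"
  define Z2 where "Z2 = x \<otimes> (p \<otimes> z')"
  define W1 where "W1 = w \<ominus> Q \<otimes> w"
  define W2 where "W2 = w' \<otimes> (p \<otimes> y)"
  note carr = xy(1,2) c z w zw'(1,2) p a
  have zc: "Z1 \<in> carrier R" "Z2 \<in> carrier R" "W1 \<in> carrier R" "W2 \<in> carrier R"
    using carr by (simp_all add: Z1_def Z2_def W1_def W2_def)
  \<comment> \<open>The mixed terms vanish, as the two parts of \<open>a\<close> are orthogonal.\<close>
  have "Z1 \<otimes> (a \<otimes> W2) = \<zero>"
    using carr
    by (simp add: Z1_def W2_def P_def l_distr_minus r_distr_minus m_assoc h' pp' pp)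
  moreover have "Z2 \<otimes> (a \<otimes> W1) = \<zero>"
    using carr
    by (simp add: Z2_def W1_def Q_def l_distr_minus r_distr_minus m_assoc h' pp' pp)
  moreover have "Z2 \<otimes> (a \<otimes> W2) = x \<otimes> p \<otimes> y"
    using carr by (simp add: Z2_def W2_def m_assoc h' pp' pp)
  moreover have "Z1 \<otimes> (a \<otimes> W1) = z \<otimes> a \<otimes> w \<ominus> z \<otimes> (P \<otimes> (a \<otimes> w))"
    using carr
    by (simp add: Z1_def W1_def P_def Q_def l_distr_minus r_distr_minus m_assoc h' pp' pp minus_zero)
  ultimately have "(Z1 \<oplus> Z2) \<otimes> a \<otimes> (W1 \<oplus> W2) = (z \<otimes> a \<otimes> w \<ominus> z \<otimes> (P \<otimes> (a \<otimes> w))) \<oplus> x \<otimes> p \<otimes> y"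
    using zc carr by (simp add: m_assoc l_distr r_distr)
  also have "\<dots> = z \<otimes> a \<otimes> w \<oplus> j"
    unfolding xy(3)[symmetric] using z w a c jc by (simp add: minus_eq a_assoc r_neg1 r_neg2)
  finally show ?thesis
    using zc by (metis belowI add.m_closed)
qed

lemma properly_infinite_cong:
  assumes p: "properly_infinite R p" and pa: "below R p a" and ap: "below R a p"
    and a: "a \<in> carrier R" "a \<noteq> \<zero>"
  shows "properly_infinite R a"
proof -
  obtain \<alpha>1 \<alpha>2 \<beta>1 \<beta>2 where *: "\<alpha>1 \<in> carrier R" "\<alpha>2 \<in> carrier R" "\<beta>1 \<in> carrier R" "\<beta>2 \<in> carrier R"
    "p \<in> carrier R" "p \<noteq> \<zero>"
    "\<alpha>1 \<otimes> (p \<otimes> \<beta>1) = p" "\<alpha>1 \<otimes> (p \<otimes> \<beta>2) = \<zero>" "\<alpha>2 \<otimes> (p \<otimes> \<beta>1) = \<zero>" "\<alpha>2 \<otimes> (p \<otimes> \<beta>2) = p"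
    using p by (rule properly_infiniteE)
  obtain x y where x: "x \<in> carrier R" "y \<in> carrier R" "a = x \<otimes> p \<otimes> y"
    using ap by (rule belowE)
  obtain z w where z: "z \<in> carrier R" "w \<in> carrier R" "p = z \<otimes> a \<otimes> w"
    using pa by (rule belowE)
  have h: "z \<otimes> (a \<otimes> (w \<otimes> t)) = p \<otimes> t" if "t \<in> carrier R" for t
    using z a that by (simp add: m_assoc)
  have xp: "x \<otimes> (p \<otimes> y) = a"
    using x * by (simp add: m_assoc)
  show ?thesis
    by (rule properly_infiniteI[of "x \<otimes> (\<alpha>1 \<otimes> z)" "x \<otimes> (\<alpha>2 \<otimes> z)" "w \<otimes> (\<beta>1 \<otimes> y)" "w \<otimes> (\<beta>2 \<otimes> y)"])
      (use * x(1,2) z(1,2) a in \<open>simp_all add: m_assoc h mult_cancel_assoc3[OF *(7)]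
        mult_cancel_assoc3[OF *(8)] mult_cancel_assoc3[OF *(9)] mult_cancel_assoc3[OF *(10)] xp\<close>)
qed

text \<open>
  The witnesses for \<open>p\<close> and \<open>q\<close> can be added once they are cut down to the corners of \<open>p\<close> and \<open>q\<close>.
\<close>

lemma properly_infinite_orthogonal_sum:
  assumes p: "properly_infinite R p" "p \<otimes> p = p" and q: "properly_infinite R q" "q \<otimes> q = q"
    and pq: "p \<otimes> q = \<zero>" "q \<otimes> p = \<zero>"
  shows "properly_infinite R (p \<oplus> q)"
proof -
  obtain \<alpha>1 \<alpha>2 \<beta>1 \<beta>2 where *: "\<alpha>1 \<in> carrier R" "\<alpha>2 \<in> carrier R" "\<beta>1 \<in> carrier R" "\<beta>2 \<in> carrier R"
    "p \<in> carrier R" "p \<noteq> \<zero>"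
    "\<alpha>1 \<otimes> (p \<otimes> \<beta>1) = p" "\<alpha>1 \<otimes> (p \<otimes> \<beta>2) = \<zero>" "\<alpha>2 \<otimes> (p \<otimes> \<beta>1) = \<zero>" "\<alpha>2 \<otimes> (p \<otimes> \<beta>2) = p"
    using p(1) by (rule properly_infiniteE)
  obtain \<gamma>1 \<gamma>2 \<delta>1 \<delta>2 where **: "\<gamma>1 \<in> carrier R" "\<gamma>2 \<in> carrier R" "\<delta>1 \<in> carrier R" "\<delta>2 \<in> carrier R"
    "q \<in> carrier R" "q \<noteq> \<zero>"
    "\<gamma>1 \<otimes> (q \<otimes> \<delta>1) = q" "\<gamma>1 \<otimes> (q \<otimes> \<delta>2) = \<zero>" "\<gamma>2 \<otimes> (q \<otimes> \<delta>1) = \<zero>" "\<gamma>2 \<otimes> (q \<otimes> \<delta>2) = q"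
    using q(1) by (rule properly_infiniteE)
  have "p \<oplus> q \<noteq> \<zero>"
  proof
    assume "p \<oplus> q = \<zero>"
    then have "p \<otimes> (p \<oplus> q) = \<zero>"
      using * by simp
    then show False
      using * ** p pq by (simp add: r_distr)
  qed
  then show ?thesis
    using * ** by (intro properly_infiniteI[of "p \<otimes> (\<alpha>1 \<otimes> p) \<oplus> q \<otimes> (\<gamma>1 \<otimes> q)"
        "p \<otimes> (\<alpha>2 \<otimes> p) \<oplus> q \<otimes> (\<gamma>2 \<otimes> q)" "p \<otimes> (\<beta>1 \<otimes> p) \<oplus> q \<otimes> (\<delta>1 \<otimes> q)" "p \<otimes> (\<beta>2 \<otimes> p) \<oplus> q \<otimes> (\<delta>2 \<otimes> q)"])
      (simp_all add: m_assoc l_distr r_distr p(2) q(2) pq mult_cancel_assoc[OF p(2)]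
        mult_cancel_assoc[OF q(2)] mult_cancel_assoc[OF pq(1)] mult_cancel_assoc[OF pq(2)]
        mult_cancel_assoc3[OF *(7)] mult_cancel_assoc3[OF *(8)] mult_cancel_assoc3[OF *(9)]
        mult_cancel_assoc3[OF *(10)] mult_cancel_assoc3[OF **(7)] mult_cancel_assoc3[OF **(8)]
        mult_cancel_assoc3[OF **(9)] mult_cancel_assoc3[OF **(10)])
qed

subsection \<open>Sums of orthogonal idempotents\<close>

definition orthogonal_idempotents :: "'a set \<Rightarrow> bool" where
  "orthogonal_idempotents S \<longleftrightarrow> S \<subseteq> carrier R \<and> (\<forall>s\<in>S. \<forall>t\<in>S. s \<otimes> t = (if s = t then s else \<zero>))"

abbreviation idem_sum :: "'a set \<Rightarrow> 'a" where
  "idem_sum F \<equiv> (\<Oplus>s\<in>F. s)"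

lemma idem_sum_closed: "F \<subseteq> carrier R \<Longrightarrow> idem_sum F \<in> carrier R"
  by (rule finsum_closed) auto

lemma idem_sum_mult_right:
  assumes S: "orthogonal_idempotents S" and F: "finite F" "F \<subseteq> S" and s: "s \<in> S"
  shows "idem_sum F \<otimes> s = (if s \<in> F then s else \<zero>)"
  using F
proof (induction F rule: finite_induct)
  case empty
  then show ?case
    using S s by (auto simp: orthogonal_idempotents_def)
next
  case (insert t F)
  have c: "t \<in> carrier R" "F \<subseteq> carrier R" "s \<in> carrier R"
    using insert.prems S s by (auto simp: orthogonal_idempotents_def)
  then have F: "idem_sum F \<in> carrier R"
    by (simp add: idem_sum_closed)
  have ts: "t \<otimes> s = (if t = s then t else \<zero>)"
    using S s insert.prems by (auto simp: orthogonal_idempotents_def)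
  have "idem_sum (insert t F) = t \<oplus> idem_sum F"
    using insert.hyps c by (subst finsum_insert) auto
  then show ?case
    using insert c F ts by (auto simp: l_distr)
qed

lemma idem_sum_mult_left:
  assumes S: "orthogonal_idempotents S" and F: "finite F" "F \<subseteq> S" and s: "s \<in> S"
  shows "s \<otimes> idem_sum F = (if s \<in> F then s else \<zero>)"
  using F
proof (induction F rule: finite_induct)
  case empty
  then show ?case
    using S s by (auto simp: orthogonal_idempotents_def)
next
  case (insert t F)
  have c: "t \<in> carrier R" "F \<subseteq> carrier R" "s \<in> carrier R"
    using insert.prems S s by (auto simp: orthogonal_idempotents_def)
  then have F: "idem_sum F \<in> carrier R"
    by (simp add: idem_sum_closed)
  have ts: "s \<otimes> t = (if s = t then s else \<zero>)"
    using S s insert.prems by (auto simp: orthogonal_idempotents_def)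
  have "idem_sum (insert t F) = t \<oplus> idem_sum F"
    using insert.hyps c by (subst finsum_insert) auto
  then show ?case
    using insert c F ts by (auto simp: r_distr)
qed

lemma idem_sum_mult_subset:
  assumes S: "orthogonal_idempotents S" and F: "finite F" "F \<subseteq> F'" "finite F'" "F' \<subseteq> S"
  shows "idem_sum F \<otimes> idem_sum F' = idem_sum F" "idem_sum F' \<otimes> idem_sum F = idem_sum F"
proof -
  have c: "F \<subseteq> carrier R" "F' \<subseteq> carrier R" "F \<subseteq> S"
    using assms by (auto simp: orthogonal_idempotents_def)
  have "idem_sum F \<otimes> idem_sum F' = (\<Oplus>s\<in>F. s \<otimes> idem_sum F')"
    using c by (intro finsum_mult_right) (auto simp: idem_sum_closed)
  also have "\<dots> = idem_sum F"
    by (intro finsum_cong')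
      (use c S F in \<open>auto simp: idem_sum_mult_left[OF S F(3,4)] subset_iff\<close>)
  finally show "idem_sum F \<otimes> idem_sum F' = idem_sum F" .
  have "idem_sum F' \<otimes> idem_sum F = (\<Oplus>s\<in>F. idem_sum F' \<otimes> s)"
    using c by (intro finsum_mult_left) (auto simp: idem_sum_closed)
  also have "\<dots> = idem_sum F"
    by (intro finsum_cong')
      (use c S F in \<open>auto simp: idem_sum_mult_right[OF S F(3,4)] subset_iff\<close>)
  finally show "idem_sum F' \<otimes> idem_sum F = idem_sum F" .
qed

lemma properly_infinite_idem_sum:
  assumes S: "orthogonal_idempotents S" "\<And>s. s \<in> S \<Longrightarrow> properly_infinite R s"
    and F: "finite F" "F \<noteq> {}" "F \<subseteq> S"
  shows "properly_infinite R (idem_sum F)"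
  using F
proof (induction F rule: finite_ne_induct)
  case (singleton s)
  then show ?case
    using S by (auto simp: orthogonal_idempotents_def)
next
  case (insert t F)
  have c: "t \<in> carrier R" "F \<subseteq> carrier R" "F \<subseteq> S" "t \<in> S"
    using insert.prems S by (auto simp: orthogonal_idempotents_def)
  have "idem_sum (insert t F) = t \<oplus> idem_sum F"
    using insert.hyps c by (subst finsum_insert) auto
  moreover have "properly_infinite R (t \<oplus> idem_sum F)"
    using insert c S idem_sum_mult_left[OF S(1) \<open>finite F\<close> \<open>F \<subseteq> S\<close> \<open>t \<in> S\<close>]
      idem_sum_mult_right[OF S(1) \<open>finite F\<close> \<open>F \<subseteq> S\<close> \<open>t \<in> S\<close>]
      idem_sum_mult_subset[OF S(1) \<open>finite F\<close> order_refl \<open>finite F\<close> \<open>F \<subseteq> S\<close>]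
    by (intro properly_infinite_orthogonal_sum) (auto simp: orthogonal_idempotents_def)
  ultimately show ?case
    by simp
qed

text \<open>
  Each further idempotent is absorbed by \<open>below_of_decomposition\<close>, applied to the sum of the
  preceding ones; the summands need no simultaneous orthogonal embedding into \<open>a\<close>.
\<close>

lemma idem_sum_below:
  assumes S: "orthogonal_idempotents S" "\<And>s. s \<in> S \<Longrightarrow> properly_infinite R s"
    and a: "a \<in> carrier R" "\<And>s. s \<in> S \<Longrightarrow> below R s a"
    and F: "finite F" "F \<subseteq> S"
  shows "below R (idem_sum F) a"
  using F
proof (induction F rule: finite_induct)
  case empty
  then show ?case
    using a by (simp add: below_zero)
next
  case (insert t F)
  have c: "t \<in> carrier R" "F \<subseteq> carrier R" "F \<subseteq> S" "t \<in> S"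
    using insert.prems S by (auto simp: orthogonal_idempotents_def)
  have eq: "idem_sum (insert t F) = t \<oplus> idem_sum F"
    using insert.hyps c by (subst finsum_insert) auto
  show ?case
  proof (cases "F = {}")
    case True
    then show ?thesis
      using a(2)[OF c(4)] c by simp
  next
    case False
    obtain z w where z: "z \<in> carrier R" "w \<in> carrier R" "t = z \<otimes> a \<otimes> w"
      using a(2)[OF c(4)] by (rule belowE)
    have pi: "properly_infinite R (idem_sum F)"
      using properly_infinite_idem_sum[OF S \<open>finite F\<close> False c(3)] .
    have "below R (z \<otimes> a \<otimes> w \<oplus> idem_sum F) a"
      by (rule below_of_decomposition[OF a(1) pi _ insert.IH[OF c(3)] z(1,2)
            properly_infinite_below_self[OF pi]])
        (rule idem_sum_mult_subset(1)[OF S(1) \<open>finite F\<close> order_refl \<open>finite F\<close> c(3)])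
    then show ?thesis
      unfolding eq z(3)[symmetric] .
  qed
qed

text \<open>
  For orthogonal properly infinite idempotents this is the two-sided ideal generated by \<open>S\<close>: sums of
  several products are again single products.
\<close>

definition idempotents_ideal :: "'a set \<Rightarrow> 'a set" where
  "idempotents_ideal S = {x. \<exists>F. finite F \<and> F \<subseteq> S \<and> below R x (idem_sum F)}"

lemma idempotents_ideal_superset:
  assumes "orthogonal_idempotents S"
  shows "S \<subseteq> idempotents_ideal S"
proof
  fix s assume "s \<in> S"
  then have s: "s \<in> carrier R" "s \<otimes> s = s"
    using assms by (auto simp: orthogonal_idempotents_def)
  then have "below R s (idem_sum {s})"
    using idempotent_below_self[of s] by simp
  then show "s \<in> idempotents_ideal S"
    unfolding idempotents_ideal_def using \<open>s \<in> S\<close> by blast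
qed

lemma two_sided_idempotents_ideal:
  assumes S: "orthogonal_idempotents S" "\<And>s. s \<in> S \<Longrightarrow> properly_infinite R s"
  shows "two_sided_ideal (idempotents_ideal S) R"
proof (rule two_sided_idealI)
  have c: "idem_sum F \<in> carrier R" if "F \<subseteq> S" for F
    using S that by (intro idem_sum_closed) (auto simp: orthogonal_idempotents_def)
  show "idempotents_ideal S \<subseteq> carrier R"
    using c unfolding idempotents_ideal_def by (blast intro: below_closed)
  have "below R \<zero> (idem_sum {})"
    by (rule below_zero) simp
  then show "\<zero> \<in> idempotents_ideal S"
    unfolding idempotents_ideal_def by blast
  show "\<ominus> x \<in> idempotents_ideal S" if "x \<in> idempotents_ideal S" for x
    using that c unfolding idempotents_ideal_def by (blast intro: below_uminus)
  show "r \<otimes> x \<in> idempotents_ideal S" "x \<otimes> r \<in> idempotents_ideal S"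
    if "x \<in> idempotents_ideal S" "r \<in> carrier R" for x r
    using that c unfolding idempotents_ideal_def by (blast intro: below_mult_left below_mult_right)+
  fix x y assume "x \<in> idempotents_ideal S" "y \<in> idempotents_ideal S"
  then obtain F F' where F: "finite F" "F \<subseteq> S" "below R x (idem_sum F)"
      "finite F'" "F' \<subseteq> S" "below R y (idem_sum F')"
    by (auto simp: idempotents_ideal_def)
  have "below R x (idem_sum (F \<union> F')) \<and> below R y (idem_sum (F \<union> F'))"
  proof -
    have "below R (idem_sum H) (idem_sum (F \<union> F'))" if "finite H" "H \<subseteq> F \<union> F'" for H
    proof -
      have "H \<subseteq> S"
        using that F by auto
      then have "idem_sum H = idem_sum H \<otimes> idem_sum (F \<union> F') \<otimes> idem_sum H"
        using idem_sum_mult_subset[OF S(1) that] idem_sum_mult_subset[OF S(1) that(1) order_refl that(1)] F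
        by simp
      then show ?thesis
        using c[OF \<open>H \<subseteq> S\<close>] by (metis belowI)
    qed
    note * = this
    have "idem_sum (F \<union> F') \<in> carrier R"
      using F by (intro c) auto
    then show ?thesis
      using below_trans[OF F(3) *[OF F(1)]] below_trans[OF F(6) *[OF F(4)]] by simp
  qed
  moreover have "below R (x \<oplus> y) (idem_sum (F \<union> F'))"
    if "below R x (idem_sum (F \<union> F'))" "below R y (idem_sum (F \<union> F'))"
  proof (cases "F \<union> F' = {}")
    case True
    then have "x = \<zero>" "y = \<zero>"
      using that by (auto simp: below_def)
    then show ?thesis
      using True by (simp add: below_zero)
  next
    case False
    have "properly_infinite R (idem_sum (F \<union> F'))"
      by (rule properly_infinite_idem_sum[OF S]) (use F False in auto)
    then show ?thesis
      using that by (rule below_add)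
  qed
  ultimately show "x \<oplus> y \<in> idempotents_ideal S"
    unfolding idempotents_ideal_def using F by blast
qed

lemma properly_infinite_of_mem_idempotents_ideal:
  assumes S: "orthogonal_idempotents S" "\<And>s. s \<in> S \<Longrightarrow> properly_infinite R s"
    and a: "a \<in> carrier R" "\<And>s. s \<in> S \<Longrightarrow> below R s a" "a \<noteq> \<zero>" "a \<in> idempotents_ideal S"
  shows "properly_infinite R a"
proof -
  obtain F where F: "finite F" "F \<subseteq> S" "below R a (idem_sum F)"
    using a by (auto simp: idempotents_ideal_def)
  have "F \<noteq> {}"
    using F(3) a(3) by (auto simp: below_def)
  show ?thesis
    by (rule properly_infinite_cong[OF properly_infinite_idem_sum[OF S F(1) \<open>F \<noteq> {}\<close> F(2)]
          idem_sum_below[OF S a(1,2) F(1,2)] F(3) a(1,3)])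
qed

subsection \<open>Infinite idempotents\<close>

text \<open>
  The witnesses can be chosen inside the corner of \<open>e\<close>, which is what later computations need.
\<close>

lemma infinite_idempotentE:
  assumes "infinite_idempotent R e"
  obtains f x y where "e \<in> carrier R" "f \<in> carrier R" "x \<in> carrier R" "y \<in> carrier R"
    "e \<otimes> e = e" "f \<otimes> f = f" "f \<otimes> e = f" "e \<otimes> f = f" "f \<noteq> e" "x \<otimes> y = e" "y \<otimes> x = f"
    "e \<otimes> x = x" "x \<otimes> f = x" "f \<otimes> y = y" "y \<otimes> e = y"
proof -
  obtain f x y where *: "e \<in> carrier R" "f \<in> carrier R" "x \<in> carrier R" "y \<in> carrier R"
    "e \<otimes> e = e" "f \<otimes> f = f" "f \<otimes> e = f" "e \<otimes> f = f" "f \<noteq> e" "e = x \<otimes> y" "f = y \<otimes> x"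
    using assms unfolding infinite_idempotent_def idempotent_elem_def idem_le_def idem_equiv_def
    by blast
  note c = *(1-4)
  note simps = m_assoc *(10,11)[symmetric] *(5-8) mult_cancel_assoc[OF *(10)[symmetric]]
      mult_cancel_assoc[OF *(11)[symmetric]] mult_cancel_assoc[OF *(5)] mult_cancel_assoc[OF *(6)]
      mult_cancel_assoc[OF *(7)] mult_cancel_assoc[OF *(8)]
  have h: "x \<otimes> f = e \<otimes> x" "f \<otimes> y = y \<otimes> e"
    using c *(10,11) by (metis m_assoc)+
  show thesis
  proof (rule that[of f "x \<otimes> f" "f \<otimes> y"])
    show "x \<otimes> f \<otimes> (f \<otimes> y) = e"
      using c h by (simp add: simps)
    show "f \<otimes> y \<otimes> (x \<otimes> f) = f"
      using c by (simp add: simps)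
    show "e \<otimes> (x \<otimes> f) = x \<otimes> f" "f \<otimes> y \<otimes> e = f \<otimes> y"
      using c h by (simp_all add: simps)
  qed (use c * in \<open>simp_all add: m_assoc mult_cancel_assoc[OF *(6)]\<close>)
qed

lemma infinite_idempotentI:
  assumes "e \<in> carrier R" "f \<in> carrier R" "x \<in> carrier R" "y \<in> carrier R"
    "e \<otimes> e = e" "f \<otimes> f = f" "f \<otimes> e = f" "e \<otimes> f = f" "f \<noteq> e" "x \<otimes> y = e" "y \<otimes> x = f"
  shows "infinite_idempotent R e"
  unfolding infinite_idempotent_def idempotent_elem_def idem_le_def idem_equiv_def
  using assms by metis

text \<open>
  One of the two copies of \<open>p\<close> inside \<open>p\<close> is proper, because the other one is orthogonal to it.
\<close>

lemma infinite_of_properly_infinite: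
  assumes "properly_infinite R p" "p \<otimes> p = p"
  shows "infinite_idempotent R p"
proof -
  obtain \<alpha>1 \<alpha>2 \<beta>1 \<beta>2 where *: "\<alpha>1 \<in> carrier R" "\<alpha>2 \<in> carrier R" "\<beta>1 \<in> carrier R" "\<beta>2 \<in> carrier R"
    "p \<in> carrier R" "p \<noteq> \<zero>"
    "\<alpha>1 \<otimes> (p \<otimes> \<beta>1) = p" "\<alpha>1 \<otimes> (p \<otimes> \<beta>2) = \<zero>" "\<alpha>2 \<otimes> (p \<otimes> \<beta>1) = \<zero>" "\<alpha>2 \<otimes> (p \<otimes> \<beta>2) = p"
    using assms(1) by (rule properly_infiniteE)
  note simps = m_assoc assms(2) mult_cancel_assoc[OF assms(2)] *(7-10) mult_cancel_assoc3[OF *(7)]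
        mult_cancel_assoc3[OF *(8)] mult_cancel_assoc3[OF *(9)] mult_cancel_assoc3[OF *(10)]
  define x where "x = p \<otimes> (\<alpha>1 \<otimes> p)"
  define y where "y = p \<otimes> (\<beta>1 \<otimes> p)"
  have c: "x \<in> carrier R" "y \<in> carrier R"
    using * by (simp_all add: x_def y_def)
  have "y \<otimes> x \<noteq> p"
  proof
    assume eq: "y \<otimes> x = p"
    have "\<zero> = \<alpha>2 \<otimes> (y \<otimes> x) \<otimes> \<beta>2"
      using * by (simp add: x_def y_def simps)
    also have "\<dots> = p"
      unfolding eq using * by (simp add: simps)
    finally show False
      using * by simp
  qed
  then show ?thesis
    using * c by (intro infinite_idempotentI[of p "y \<otimes> x" x y]) (simp_all add: x_def y_def simps)
qed

text \<open>
  If \<open>w = z a y\<close> then \<open>u \<mapsto> a y u z\<close> transports the corner of \<open>w\<close> into the right ideal \<open>a R\<close>.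
\<close>

lemma infinite_idempotent_below:
  assumes w: "infinite_idempotent R w" and a: "a \<in> carrier R" and "below R w a"
  shows "\<exists>r\<in>carrier R. infinite_idempotent R (a \<otimes> r)"
proof -
  obtain z y where zy: "z \<in> carrier R" "y \<in> carrier R" and eq: "w = z \<otimes> a \<otimes> y"
    using assms(3) by (rule belowE)
  obtain f s t where *: "w \<in> carrier R" "f \<in> carrier R" "s \<in> carrier R" "t \<in> carrier R"
    "w \<otimes> w = w" "f \<otimes> f = f" "f \<otimes> w = f" "w \<otimes> f = f" "f \<noteq> w" "s \<otimes> t = w" "t \<otimes> s = f"
    "w \<otimes> s = s" "s \<otimes> f = s" "f \<otimes> t = t" "t \<otimes> w = t"
    using w by (rule infinite_idempotentE)
  have h: "z \<otimes> (a \<otimes> y) = w"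
    using eq zy a by (simp add: m_assoc)
  have ft: "w \<otimes> t = t" "s \<otimes> w = s"
    using * by (metis m_assoc)+
  note simps = m_assoc h mult_cancel_assoc3[OF h] *(5-8,10-15) mult_cancel_assoc[OF *(5)]
    mult_cancel_assoc[OF *(6)] mult_cancel_assoc[OF *(7)] mult_cancel_assoc[OF *(8)]
    mult_cancel_assoc[OF *(10)] mult_cancel_assoc[OF *(11)] mult_cancel_assoc[OF *(12)]
    mult_cancel_assoc[OF *(13)] mult_cancel_assoc[OF *(14)] mult_cancel_assoc[OF *(15)] ft
    mult_cancel_assoc[OF ft(1)] mult_cancel_assoc[OF ft(2)]
  define conj where "conj u = a \<otimes> (y \<otimes> (u \<otimes> z))" for u
  have cc: "conj u \<in> carrier R" if "u \<in> carrier R" for u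
    using that zy a by (simp add: conj_def)
  have cm: "conj u \<otimes> conj u' = conj (u \<otimes> (w \<otimes> u'))" if "u \<in> carrier R" "u' \<in> carrier R" for u u'
    using that zy a *(1) by (simp add: conj_def m_assoc mult_cancel_assoc3[OF h])
  have "conj f \<noteq> conj w"
  proof
    assume "conj f = conj w"
    then have "z \<otimes> (conj f \<otimes> (a \<otimes> y)) = z \<otimes> (conj w \<otimes> (a \<otimes> y))"
      by simp
    then have "f = w"
      using * zy a by (simp add: conj_def simps)
    then show False
      using *(9) by simp
  qed
  then have "infinite_idempotent R (conj w)"
    using *(1-4) by (intro infinite_idempotentI[of _ "conj f" "conj s" "conj t"]) (simp_all add: cc cm simps)
  then show ?thesis
    using zy a *(1) unfolding conj_def by (intro bexI[of _ "y \<otimes> (w \<otimes> z)"]) simp_all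
qed

text \<open>
  An infinite idempotent \<open>e\<close> of the right ideal \<open>v R\<close> satisfies \<open>v e = e\<close>, and \<open>e v\<close> is an
  equivalent idempotent of the corner \<open>v R v\<close>.
\<close>

lemma infinite_idempotent_in_corner:
  assumes J: "\<And>J. \<lbrakk>right_ideal J R; J \<noteq> {\<zero>}\<rbrakk> \<Longrightarrow> \<exists>e\<in>J. infinite_idempotent R e"
    and v: "v \<in> carrier R" "v \<otimes> v = v" "v \<noteq> \<zero>"
  obtains e where "infinite_idempotent R e" "v \<otimes> e = e" "e \<otimes> v = e"
proof -
  define J where "J = {x \<in> carrier R. v \<otimes> x = x}"
  have "additive_subgroup J R"
    by (rule additive_subgroupI, rule add.subgroupI)
      (use v in \<open>auto simp: J_def r_distr r_minus simp flip: a_inv_def\<close>)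
  then have "right_ideal J R"
    using v(1) by (auto simp: right_ideal_def J_def mult_cancel_assoc)
  moreover have "J \<noteq> {\<zero>}"
    using v by (auto simp: J_def)
  ultimately obtain e where e: "e \<in> J" "infinite_idempotent R e"
    using assms(1) by blast
  obtain f x y where *: "e \<in> carrier R" "f \<in> carrier R" "x \<in> carrier R" "y \<in> carrier R"
    "e \<otimes> e = e" "f \<otimes> f = f" "f \<otimes> e = f" "e \<otimes> f = f" "f \<noteq> e" "x \<otimes> y = e" "y \<otimes> x = f"
    "e \<otimes> x = x" "x \<otimes> f = x" "f \<otimes> y = y" "y \<otimes> e = y"
    using e(2) by (rule infinite_idempotentE)
  have ve: "v \<otimes> e = e"
    using e by (simp add: J_def)
  have vf: "v \<otimes> f = f" "v \<otimes> x = x" 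
    using ve * v(1) by (metis m_assoc)+
  have vy: "v \<otimes> y = y"
    using vf * v(1) by (metis m_assoc)
  note simps = m_assoc *(5-8,10-15) mult_cancel_assoc[OF *(5)]
    mult_cancel_assoc[OF *(6)] mult_cancel_assoc[OF *(7)] mult_cancel_assoc[OF *(8)]
    mult_cancel_assoc[OF *(10)] mult_cancel_assoc[OF *(11)] mult_cancel_assoc[OF *(12)]
    mult_cancel_assoc[OF *(13)] mult_cancel_assoc[OF *(14)] mult_cancel_assoc[OF *(15)] 
    ve vf vy mult_cancel_assoc[OF ve] mult_cancel_assoc[OF vf(1)] mult_cancel_assoc[OF vf(2)]
    mult_cancel_assoc[OF vy] v(2) mult_cancel_assoc[OF v(2)]
  have "f \<otimes> v \<noteq> e \<otimes> v"
  proof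
    assume "f \<otimes> v = e \<otimes> v"
    then have "f \<otimes> v \<otimes> e = e \<otimes> v \<otimes> e"
      by simp
    then show False
      using * v(1) by (simp add: simps)
  qed
  then have "infinite_idempotent R (e \<otimes> v)"
    using * v(1) by (intro infinite_idempotentI[of _ "f \<otimes> v" "x \<otimes> v" "y \<otimes> v"]) (simp_all add: simps)
  moreover have "v \<otimes> (e \<otimes> v) = e \<otimes> v" "e \<otimes> v \<otimes> v = e \<otimes> v"
    using * v(1) by (simp_all add: simps)
  ultimately show thesis
    by (rule that)
qed

lemma infinite_idempotent_in_right_ideal:
  assumes J: "right_ideal J R" "a \<in> J" and w: "infinite_idempotent R w" "below R w a"
  shows "\<exists>e\<in>J. infinite_idempotent R e"
proof -
  have a: "a \<in> carrier R"
    using J additive_subgroup.a_Hcarr by (auto simp: right_ideal_def)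
  then show ?thesis
    using infinite_idempotent_below[OF w(1) a w(2)] J by (auto simp: right_ideal_def)
qed

lemma below_opposite_ring: "a \<in> carrier R \<Longrightarrow> below (opposite_ring R) b a \<longleftrightarrow> below R b a"
  unfolding below_def opposite_ring_simps by (metis m_assoc)

lemma infinite_idempotent_in_left_ideal:
  assumes J: "left_ideal J R" "a \<in> J" and w: "infinite_idempotent R w" "below R w a"
  shows "\<exists>e\<in>J. infinite_idempotent R e"
proof -
  interpret O: nonunital_ring "opposite_ring R"
    by (rule nonunital_ring_opposite)
  have "a \<in> carrier R"
    using J additive_subgroup.a_Hcarr by (auto simp: left_ideal_def)
  then show ?thesis
    using O.infinite_idempotent_in_right_ideal[of J a w] J w
    by (simp add: left_ideal_iff_right_ideal_opposite infinite_idempotent_opposite below_opposite_ring)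
qed

lemma infinite_idempotent_in_corner_left:
  assumes J: "\<And>J. \<lbrakk>left_ideal J R; J \<noteq> {\<zero>}\<rbrakk> \<Longrightarrow> \<exists>e\<in>J. infinite_idempotent R e"
    and v: "v \<in> carrier R" "v \<otimes> v = v" "v \<noteq> \<zero>"
  obtains e where "infinite_idempotent R e" "v \<otimes> e = e" "e \<otimes> v = e"
proof -
  interpret O: nonunital_ring "opposite_ring R"
    by (rule nonunital_ring_opposite)
  have "\<exists>e\<in>J. infinite_idempotent (opposite_ring R) e"
    if "right_ideal J (opposite_ring R)" "J \<noteq> {\<zero>\<^bsub>opposite_ring R\<^esub>}" for J
    using J[of J] that
    by (simp add: left_ideal_iff_right_ideal_opposite infinite_idempotent_opposite)
  then obtain e where "infinite_idempotent (opposite_ring R) e"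
      "v \<otimes>\<^bsub>opposite_ring R\<^esub> e = e" "e \<otimes>\<^bsub>opposite_ring R\<^esub> v = e"
    using O.infinite_idempotent_in_corner[of v] v unfolding opposite_ring_simps by metis
  then show thesis
    by (intro that[of e]) (simp_all add: infinite_idempotent_opposite)
qed

text \<open>
  In a division ring \<open>\<alpha>\<^sub>1 u \<beta>\<^sub>2 = 0\<close> forces \<open>\<alpha>\<^sub>1 = 0\<close> or \<open>\<beta>\<^sub>2 = 0\<close>, so the unit is not properly
  infinite.
\<close>

lemma not_division_ring_of_properly_infinite:
  assumes "properly_purely_infinite R"
  shows "\<not> is_division_ring R"
proof
  assume "is_division_ring R"
  then obtain u where u: "u \<in> carrier R" "u \<noteq> \<zero>" "\<And>x. x \<in> carrier R \<Longrightarrow> u \<otimes> x = x \<and> x \<otimes> u = x"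
    and inv: "\<And>x. \<lbrakk>x \<in> carrier R; x \<noteq> \<zero>\<rbrakk> \<Longrightarrow> \<exists>y\<in>carrier R. x \<otimes> y = u \<and> y \<otimes> x = u"
    unfolding is_division_ring_def by blast
  have "properly_infinite R u"
    using assms u by (simp add: properly_purely_infinite_def)
  then obtain \<alpha>1 \<alpha>2 \<beta>1 \<beta>2 where *: "\<alpha>1 \<in> carrier R" "\<alpha>2 \<in> carrier R" "\<beta>1 \<in> carrier R" "\<beta>2 \<in> carrier R"
    "u \<in> carrier R" "u \<noteq> \<zero>"
    "\<alpha>1 \<otimes> (u \<otimes> \<beta>1) = u" "\<alpha>1 \<otimes> (u \<otimes> \<beta>2) = \<zero>" "\<alpha>2 \<otimes> (u \<otimes> \<beta>1) = \<zero>" "\<alpha>2 \<otimes> (u \<otimes> \<beta>2) = u"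
    by (rule properly_infiniteE)
  have nz: "\<alpha>1 \<noteq> \<zero>" "\<beta>2 \<noteq> \<zero>"
    using *(2,3,5,6,7,10) by force+
  obtain y where y: "y \<in> carrier R" "y \<otimes> \<alpha>1 = u"
    using inv[OF *(1) nz(1)] by blast
  have "\<beta>2 = (y \<otimes> \<alpha>1) \<otimes> \<beta>2"
    unfolding y(2) using u(3)[OF *(4)] by simp
  also have "\<dots> = y \<otimes> (\<alpha>1 \<otimes> (u \<otimes> \<beta>2))"
    using u(3)[OF *(4)] y(1) *(1,4) by (simp add: m_assoc)
  also have "\<dots> = \<zero>"
    unfolding *(8) using y(1) by simp
  finally show False
    using nz by simp
qed

lemma sandwich_sums_below:
  assumes a: "properly_infinite R a" and b: "b \<in> sandwich_sums R a"
  shows "below R b a"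
proof -
  have ac: "a \<in> carrier R"
    using a by (simp add: properly_infinite_def)
  obtain n :: nat and r s where b: "b = (\<Oplus>i\<in>{..<n}. r i \<otimes> a \<otimes> s i)"
      "r \<in> {..<n} \<rightarrow> carrier R" "s \<in> {..<n} \<rightarrow> carrier R"
    using b by (auto simp: sandwich_sums_def)
  have "below R (\<Oplus>i\<in>A. r i \<otimes> a \<otimes> s i) a" if "finite A" "A \<subseteq> {..<n}" for A
    using that
  proof (induction A rule: finite_induct)
    case empty
    then show ?case
      using ac by (simp add: below_zero)
  next
    case (insert i A)
    have c: "r j \<otimes> a \<otimes> s j \<in> carrier R" "r j \<in> carrier R" "s j \<in> carrier R" if "j \<in> insert i A" for j
    proof -
      have "j \<in> {..<n}"
        using that insert.prems by auto
      then show "r j \<in> carrier R" "s j \<in> carrier R"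
        using b(2,3) by (meson Pi_mem)+
      then show "r j \<otimes> a \<otimes> s j \<in> carrier R"
        using ac by simp
    qed
    have "below R (r i \<otimes> a \<otimes> s i) a"
      using c by (intro belowI[of "r i" "s i"]) auto
    then have "below R (r i \<otimes> a \<otimes> s i \<oplus> (\<Oplus>i\<in>A. r i \<otimes> a \<otimes> s i)) a"
      using insert by (intro below_add[OF a]) auto
    then show ?case
      using insert.hyps c by (simp add: Pi_def)
  qed
  then show ?thesis
    unfolding b(1) by simp
qed

end

context nonunital_ring_ideal
begin

lemma properly_infinite_quotient:
  assumes a: "properly_infinite R a" "a \<notin> I"
  shows "properly_infinite (R Quot I) (q a)"
proof -
  interpret Q: nonunital_ring "R Quot I"
    by (rule nonunital_ring_quotient)
  obtain \<alpha>1 \<alpha>2 \<beta>1 \<beta>2 where *: "\<alpha>1 \<in> carrier R" "\<alpha>2 \<in> carrier R" "\<beta>1 \<in> carrier R" "\<beta>2 \<in> carrier R"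
    "a \<in> carrier R" "a \<noteq> \<zero>"
    "\<alpha>1 \<otimes> (a \<otimes> \<beta>1) = a" "\<alpha>1 \<otimes> (a \<otimes> \<beta>2) = \<zero>" "\<alpha>2 \<otimes> (a \<otimes> \<beta>1) = \<zero>" "\<alpha>2 \<otimes> (a \<otimes> \<beta>2) = a"
    using a(1) by (rule properly_infiniteE)
  show ?thesis
    by (rule Q.properly_infiniteI[of "q \<alpha>1" "q \<alpha>2" "q \<beta>1" "q \<beta>2"])
      (use * a(2) in \<open>simp_all add: q_mult q_zero_eq q_eq_zero_iff[unfolded q_zero_eq]\<close>)
qed

lemma properly_purely_infinite_quotient:
  assumes "properly_purely_infinite R"
  shows "properly_purely_infinite (R Quot I)"
  unfolding properly_purely_infinite_def
proof (intro ballI impI)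
  fix X assume X: "X \<in> carrier (R Quot I)" "X \<noteq> \<zero>\<^bsub>R Quot I\<^esub>"
  then obtain x where x: "x \<in> carrier R" "X = q x"
    by (auto elim: quotientE)
  then have "x \<notin> I"
    using X by (simp add: q_eq_zero_iff)
  moreover have "x \<noteq> \<zero>"
    using \<open>x \<notin> I\<close> by auto
  ultimately show "properly_infinite (R Quot I) X"
    using assms x by (simp add: properly_purely_infinite_def properly_infinite_quotient)
qed

lemma below_quotient:
  assumes "below R b a" "a \<in> carrier R"
  shows "below (R Quot I) (q b) (q a)"
proof -
  obtain x y where "x \<in> carrier R" "y \<in> carrier R" "b = x \<otimes> a \<otimes> y"
    using assms(1) unfolding below_def by blast
  then show ?thesis
    unfolding below_def using assms(2) by (intro bexI[of _ "q x"] bexI[of _ "q y"]) (simp_all add: q_mult)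
qed

end

theorem (in nonunital_ring) purely_infinite_of_properly_purely_infinite:
  assumes ppi: "properly_purely_infinite R"
  shows "purely_infinite R"
  unfolding purely_infinite_def
proof (intro conjI allI impI ballI)
  fix I assume "two_sided_ideal I R"
  then interpret nonunital_ring_ideal R I
    by unfold_locales
  interpret Q: nonunital_ring "R Quot I"
    by (rule nonunital_ring_quotient)
  show "\<not> is_division_ring (R Quot I)"
    by (intro Q.not_division_ring_of_properly_infinite properly_purely_infinite_quotient ppi)
next
  fix a b assume a: "a \<in> carrier R" and b: "b \<in> sandwich_sums R a"
  show "\<exists>x\<in>carrier R. \<exists>y\<in>carrier R. b = x \<otimes> a \<otimes> y"
  proof (cases "a = \<zero>")
    case True
    have "(\<Oplus>i\<in>{..<n}. r i \<otimes> \<zero> \<otimes> s i) = \<zero>" if "r \<in> {..<n} \<rightarrow> carrier R" "s \<in> {..<n} \<rightarrow> carrier R"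
      for n :: nat and r s
    proof -
      have "r i \<otimes> \<zero> \<otimes> s i = \<zero>" if "i < n" for i
        using \<open>r \<in> _\<close> \<open>s \<in> _\<close> that by (simp add: Pi_def)
      then have "(\<Oplus>i\<in>{..<n}. r i \<otimes> \<zero> \<otimes> s i) = (\<Oplus>i\<in>{..<n}. \<zero>)"
        by (intro finsum_cong') auto
      then show ?thesis
        by simp
    qed
    then have "b = \<zero>"
      using b True by (auto simp: sandwich_sums_def)
    then show ?thesis
      using True by (intro bexI[of _ \<zero>]) auto
  next
    case False
    then have "below R b a"
      using ppi a b by (intro sandwich_sums_below) (auto simp: properly_purely_infinite_def)
    then show ?thesis
      by (simp add: below_def)
  qed
qed

section \<open>Cycles, Condition (K) and maximal tails\<close>

text \<open>
  Iterating \<open>\<gamma> \<delta> = \<delta> \<eta>\<close> shows that \<open>\<delta>\<close> is an initial segment of the periodic word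
  \<open>\<gamma> \<gamma> \<gamma> \<dots>\<close>.
\<close>

lemma prefix_power_of_conjugation:
  assumes "\<gamma> \<noteq> []" "\<gamma> @ \<delta> = \<delta> @ \<eta>" "length \<delta> \<le> k"
  shows "prefix \<delta> (concat (replicate k \<gamma>))"
proof -
  have "prefix \<delta> (concat (replicate k \<gamma>) @ \<delta>)"
  proof (induction k)
    case (Suc k)
    have "prefix \<delta> (\<gamma> @ \<delta>)"
      using assms(2) by simp
    also have "prefix \<dots> (\<gamma> @ concat (replicate k \<gamma>) @ \<delta>)"
      using Suc by simp
    finally show ?case
      by simp
  qed simp
  moreover have "length \<delta> \<le> length (concat (replicate k \<gamma>))"
  proof -
    have "k * 1 \<le> k * length \<gamma>"
      using assms(1) by (intro mult_le_mono2) (simp add: Suc_le_eq)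
    then have "length \<delta> \<le> k * length \<gamma>"
      using assms(3) by linarith
    then show ?thesis
      by (simp add: length_concat sum_list_replicate)
  qed
  ultimately show ?thesis
    by (metis prefix_length_prefix prefixI)
qed

text \<open>
  Both words are initial segments of \<open>\<gamma> \<gamma> \<gamma> \<dots>\<close>. This decides the reduction theorem: of two
  incomparable closed paths at least one annihilates a given closed path by conjugation.
\<close>

lemma prefix_of_conjugation:
  assumes "\<gamma> \<noteq> []" "\<gamma> @ \<alpha> = \<alpha> @ \<gamma>'" "\<gamma> @ \<beta> = \<beta> @ \<gamma>''"
  shows "prefix \<alpha> \<beta> \<or> prefix \<beta> \<alpha>"
  using prefix_power_of_conjugation[OF assms(1,2), of "length \<alpha> + length \<beta>"]
    prefix_power_of_conjugation[OF assms(1,3), of "length \<alpha> + length \<beta>"]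
  by (metis le_add1 le_add2 prefix_same_cases)

context wf_digraph
begin

lemma connects_refl: "v \<in> verts G \<Longrightarrow> connects G v v"
  unfolding connects_def by (intro exI[of _ "[]"]) (simp add: awalk_Nil_iff)

lemma connects_trans: "\<lbrakk>connects G u v; connects G v w\<rbrakk> \<Longrightarrow> connects G u w"
  unfolding connects_def by (meson awalk_appendI)

lemma connects_verts: "connects G u v \<Longrightarrow> u \<in> verts G \<and> v \<in> verts G"
  by (auto simp: connects_def)

lemma connects_arc: "e \<in> arcs G \<Longrightarrow> connects G (tail G e) (head G e)"
  unfolding connects_def by (metis arc_implies_awalk)

lemma awalk_tail_hd: "\<lbrakk>awalk u p v; p \<noteq> []\<rbrakk> \<Longrightarrow> tail G (hd p) = u"
  by (cases p) (auto simp: awalk_Cons_iff)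

lemma awalk_vertex_split:
  assumes "awalk u p v" "e \<in> set p"
  obtains q r where "p = q @ e # r" "awalk u q (tail G e)" "awalk (tail G e) (e # r) v"
    "awalk (head G e) r v"
proof -
  obtain q r where qr: "p = q @ e # r"
    using assms(2) by (meson split_list)
  with assms(1) obtain w where w: "awalk u q w" "awalk w (e # r) v"
    by auto
  then have "w = tail G e"
    by (simp add: awalk_Cons_iff)
  with w qr show thesis
    by (intro that[of q r]) (auto simp: awalk_Cons_iff)
qed

lemma connects_path_vert:
  assumes "awalk u p v" "w \<in> path_verts G p"
  shows "connects G u w" "connects G w v"
proof -
  obtain e where e: "e \<in> set p" "w = tail G e \<or> w = head G e"
    using assms(2) by (auto simp: path_verts_def)
  obtain q r where qr: "p = q @ e # r" "awalk u q (tail G e)" "awalk (tail G e) (e # r) v"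
    "awalk (head G e) r v"
    using assms(1) e(1) by (rule awalk_vertex_split)
  then have "awalk u (q @ [e]) (head G e)"
    by (intro awalk_appendI[of u q "tail G e"]) (auto simp: awalk_simps)
  with qr e(2) show "connects G u w" "connects G w v"
    unfolding connects_def by metis+
qed

lemma closed_walk_rotate:
  assumes "awalk u p u" "w \<in> path_verts G p"
  shows "\<exists>c. awalk w c w \<and> c \<noteq> []"
proof -
  obtain e where e: "e \<in> set p" "w = tail G e \<or> w = head G e"
    using assms(2) by (auto simp: path_verts_def)
  obtain q r where qr: "p = q @ e # r" "awalk u q (tail G e)" "awalk (tail G e) (e # r) u"
    "awalk (head G e) r u"
    using assms(1) e(1) by (rule awalk_vertex_split)
  have "awalk (tail G e) ((e # r) @ q) (tail G e)"
    using qr by (intro awalk_appendI)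
  moreover have "awalk (head G e) (r @ q @ [e]) (head G e)"
    using qr by (auto simp: awalk_simps)
  ultimately show ?thesis
    using e(2) by (metis Nil_is_append_conv list.distinct(1))
qed

lemma closed_walk_verts_tails:
  assumes "awalk u p u"
  shows "path_verts G p \<subseteq> tail G ` set p"
proof -
  have "head G e \<in> tail G ` set p" if e: "e \<in> set p" for e
  proof -
    obtain q r where qr: "p = q @ e # r" "awalk u q (tail G e)" "awalk (head G e) r u"
      using assms e by (rule awalk_vertex_split)
    show ?thesis
    proof (cases r)
      case Nil
      then have "head G e = u"
        using qr by (simp add: awalk_Nil_iff)
      also have "\<dots> = tail G (hd p)"
        using awalk_tail_hd[OF assms] qr(1) by simp
      finally show ?thesis
        using hd_in_set[of p] qr(1) by (metis image_eqI append_is_Nil_conv list.distinct(1))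
    next
      case (Cons f r')
      then show ?thesis
        using qr by (auto simp: awalk_Cons_iff)
    qed
  qed
  then show ?thesis
    by (auto simp: path_verts_def)
qed

lemma closed_simple_path_cycleI:
  assumes "awalk v c v" "c \<noteq> []" "distinct (map (tail G) c)"
  shows "closed_simple_path G v c" "cycle c"
proof -
  obtain e r where c: "c = e # r"
    using assms(2) by (cases c) auto
  have "tail G e = v"
    using assms(1) c by (simp add: awalk_Cons_iff)
  then show "closed_simple_path G v c"
    using assms c by (auto simp: closed_simple_path_def image_iff)
  have "head G (last c) = v"
    using awlast_of_awalk[OF assms(1)] assms(2) by (simp add: awalk_verts_conv)
  then have "tl (awalk_verts v c) = map (tail G) r @ [v]"
    using c by (simp add: awalk_verts_conv)
  then show "cycle c"
    using assms c \<open>tail G e = v\<close> unfolding cycle_def by auto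
qed

text \<open>
  A repeated vertex would allow a detour to be cut out of a shortest closed walk.
\<close>

lemma shortest_closed_walk:
  assumes "awalk v p v" "p \<noteq> []"
  obtains c where "awalk v c v" "c \<noteq> []" "distinct (map (tail G) c)"
proof -
  define c where "c = arg_min length (\<lambda>c. awalk v c v \<and> c \<noteq> [])"
  have c: "awalk v c v" "c \<noteq> []" and min: "\<And>d. \<lbrakk>awalk v d v; d \<noteq> []\<rbrakk> \<Longrightarrow> length c \<le> length d"
    using arg_min_nat_lemma[of "\<lambda>c. awalk v c v \<and> c \<noteq> []" p length] assms
    by (auto simp: c_def)
  have "distinct (map (tail G) c)"
  proof (rule ccontr)
    assume "\<not> ?thesis"
    then obtain i j where ij: "i < j" "j < length c" "tail G (c ! i) = tail G (c ! j)"
      unfolding distinct_conv_nth by (metis length_map linorder_neqE_nat nth_map)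
    have "c = take i c @ drop i c" "c = take j c @ drop j c"
      by simp_all
    then obtain x y where xy: "awalk v (take i c) x" "awalk x (drop i c) v"
        "awalk v (take j c) y" "awalk y (drop j c) v"
      using c(1) by (metis awalk_append_iff)
    have "drop i c = c ! i # drop (Suc i) c" "drop j c = c ! j # drop (Suc j) c"
      using ij by (simp_all add: Cons_nth_drop_Suc)
    then have "x = y"
      using xy ij(3) by (simp add: awalk_Cons_iff)
    then have "awalk v (take i c @ drop j c) v"
      using xy by (auto intro: awalk_appendI)
    then have "length c \<le> length (take i c @ drop j c)"
      using ij by (intro min) auto
    then show False
      using ij by simp
  qed
  with c show thesis
    by (rule that)
qed

lemma cycle_closed_walk:
  assumes "cycle p" "w \<in> path_verts G p"
  shows "\<exists>c. awalk w c w \<and> c \<noteq> []"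
  using assms closed_walk_rotate unfolding cycle_def by blast

lemma condition_K_closed_walk:
  assumes "condition_K G" "awalk v p v" "p \<noteq> []"
  obtains \<alpha> \<beta> where "\<alpha> \<noteq> \<beta>" "closed_simple_path G v \<alpha>" "closed_simple_path G v \<beta>"
proof -
  obtain c where c: "awalk v c v" "c \<noteq> []" "distinct (map (tail G) c)"
    using assms(2,3) by (rule shortest_closed_walk)
  then have "closed_simple_path G v c" "v \<in> path_verts G c"
    using closed_simple_path_cycleI(1)[OF c] awalk_tail_hd[OF c(1,2)]
    by (auto simp: path_verts_def)
  then show thesis
    using assms(1) that unfolding condition_K_def by blast
qed

text \<open>
  A closed simple path returns to its base only at its end, so no proper extension of it is simple.
\<close>

lemma closed_simple_path_not_prefix:
  assumes "closed_simple_path G v \<alpha>" "closed_simple_path G v \<beta>" "\<alpha> \<noteq> \<beta>"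
  shows "\<not> prefix \<alpha> \<beta>"
proof
  assume "prefix \<alpha> \<beta>"
  then obtain \<delta> where \<delta>: "\<beta> = \<alpha> @ \<delta>" "\<delta> \<noteq> []"
    using assms(3) by (auto simp: prefix_def)
  have "awalk v \<delta> v"
  proof -
    obtain x where "awalk v \<alpha> x" "awalk x \<delta> v"
      using assms(2) \<delta> by (auto simp: closed_simple_path_def)
    moreover have "x = v"
      using awlast_of_awalk[OF \<open>awalk v \<alpha> x\<close>] assms(1) awlast_of_awalk[of v \<alpha> v]
      by (simp add: closed_simple_path_def)
    ultimately show ?thesis
      by simp
  qed
  then have "tail G (hd \<delta>) = v"
    using \<delta>(2) by (rule awalk_tail_hd)
  moreover have "hd \<delta> \<in> set (tl \<beta>)"
    using \<delta> assms(1) by (auto simp: closed_simple_path_def)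
  ultimately show False
    using assms(2) by (auto simp: closed_simple_path_def)
qed

subsection \<open>Complements of hereditary sets\<close>

lemma hereditary_complement:
  assumes "hereditary G (verts G - M)" "connects G u v" "v \<in> M"
  shows "u \<in> M"
  using assms connects_verts unfolding hereditary_def by blast

text \<open>
  Inside \<open>M\<close> there is at most one way to go on from any vertex that \<open>v\<close> reaches.
\<close>

definition unbranched_in :: "'a set \<Rightarrow> 'a \<Rightarrow> bool" where
  "unbranched_in M v \<longleftrightarrow> (\<forall>u\<in>M. connects G v u \<longrightarrow>
     (\<forall>e\<in>out_arcs G u. \<forall>f\<in>out_arcs G u. head G e \<in> M \<longrightarrow> head G f \<in> M \<longrightarrow> e = f))"

text \<open>
  Without exits in \<open>M\<close>, a path inside \<open>M\<close> that starts on the cycle has to follow the cycle.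
\<close>

lemma unbranched_in_cycle:
  assumes M: "hereditary G (verts G - M)" and p: "cycle_in G M p" "\<not> has_exit_in G M p"
  obtains v c where "v \<in> M" "unbranched_in M v" "awalk v c v" "c \<noteq> []"
proof -
  have forced: "e \<in> set p \<and> (\<forall>f\<in>set p. tail G f = tail G e \<longrightarrow> f = e)"
    if "e \<in> arcs G" "head G e \<in> M" "tail G e \<in> tail G ` set p" for e
    using p(2) that unfolding has_exit_in_def exit_of_def by (metis imageE in_set_conv_nth)
  obtain u where u: "awalk u p u" "p \<noteq> []"
    using p by (auto simp: cycle_in_def cycle_def)
  have tails: "path_verts G p \<subseteq> tail G ` set p"
    using u(1) by (rule closed_walk_verts_tails)
  have stay: "y \<in> tail G ` set p" if "awalk x r y" "x \<in> tail G ` set p" "y \<in> M" for x r y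
    using that
  proof (induction r arbitrary: x)
    case Nil
    then show ?case
      by (simp add: awalk_Nil_iff)
  next
    case (Cons e r)
    then have e: "e \<in> arcs G" "tail G e = x" "awalk (head G e) r y"
      by (auto simp: awalk_Cons_iff)
    then have "head G e \<in> M"
      using Cons.prems hereditary_complement[OF M] unfolding connects_def by metis
    then have "e \<in> set p"
      using forced[of e] e Cons.prems by auto
    then show ?case
      using Cons.IH[OF e(3)] Cons.prems tails by (auto simp: path_verts_def)
  qed
  have ut: "u \<in> tail G ` set p"
    using awalk_tail_hd[OF u] u(2) by force
  have "unbranched_in M u"
    unfolding unbranched_in_def
  proof (intro ballI impI)
    fix x e f assume "x \<in> M" "connects G u x" "e \<in> out_arcs G x" "f \<in> out_arcs G x"
        "head G e \<in> M" "head G f \<in> M"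
    then show "e = f"
      using stay[of u _ x] ut forced[of e] forced[of f] by (auto simp: connects_def out_arcs_def)
  qed
  moreover have "u \<in> M"
    using ut p by (auto simp: cycle_in_def path_verts_def)
  ultimately show thesis
    using that u by blast
qed

lemma unbranched_walks_comparable:
  assumes M: "hereditary G (verts G - M)"
  shows "\<lbrakk>unbranched_in M x; awalk x \<alpha> y; awalk x \<beta> z; y \<in> M; z \<in> M\<rbrakk> \<Longrightarrow> prefix \<alpha> \<beta> \<or> prefix \<beta> \<alpha>"
proof (induction \<alpha> arbitrary: x \<beta>)
  case Nil
  then show ?case
    by simp
next
  case (Cons e \<alpha>)
  show ?case
  proof (cases \<beta>)
    case Nil
    then show ?thesis
      by simp
  next
    case (Cons f \<beta>')
    have ef: "e \<in> out_arcs G x" "awalk (head G e) \<alpha> y" "f \<in> out_arcs G x" "awalk (head G f) \<beta>' z"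
      using Cons Cons.prems by (auto simp: awalk_Cons_iff)
    then have "head G e \<in> M" "head G f \<in> M"
      using Cons.prems hereditary_complement[OF M] unfolding connects_def by metis+
    moreover have xe: "connects G x (head G e)"
      using ef(1) connects_arc[of e] by auto
    moreover have "x \<in> M"
      using hereditary_complement[OF M xe] calculation by blast
    ultimately have "e = f"
      using Cons.prems(1) ef connects_refl connects_verts[OF xe] unfolding unbranched_in_def by blast
    moreover have "unbranched_in M (head G e)"
      using Cons.prems(1) connects_trans[OF xe] unfolding unbranched_in_def by blast
    ultimately show ?thesis
      using Cons.IH[OF _ ef(2), of \<beta>'] ef Cons Cons.prems by auto
  qed
qed

lemma condition_K_imp_exit:
  assumes K: "condition_K G" and M: "hereditary G (verts G - M)" and p: "cycle_in G M p"
  shows "has_exit_in G M p"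
proof (rule ccontr)
  assume "\<not> has_exit_in G M p"
  then obtain v c where v: "v \<in> M" "unbranched_in M v" "awalk v c v" "c \<noteq> []"
    using unbranched_in_cycle[OF M p] by metis
  obtain \<alpha> \<beta> where \<alpha>\<beta>: "\<alpha> \<noteq> \<beta>" "closed_simple_path G v \<alpha>" "closed_simple_path G v \<beta>"
    using K v(3,4) by (rule condition_K_closed_walk)
  then have "prefix \<alpha> \<beta> \<or> prefix \<beta> \<alpha>"
    using unbranched_walks_comparable[OF M v(2)] v(1) unfolding closed_simple_path_def by blast
  then show False
    using closed_simple_path_not_prefix \<alpha>\<beta> by blast
qed

text \<open>
  Saturation of the complement is where the closed walk is used: it provides an edge from \<open>v\<close> back
  into the tail.
\<close>

lemma maximal_tail_of_closed_walk:
  assumes "awalk v p v" "p \<noteq> []"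
  shows "maximal_tail G {u. connects G u v}"
  unfolding maximal_tail_def
proof (intro conjI)
  let ?M = "{u. connects G u v}"
  have v: "v \<in> verts G" "connects G v v"
    using assms connects_refl by auto
  show "?M \<noteq> {}" "?M \<subseteq> verts G"
    using v connects_verts by blast+
  show "hereditary G (verts G - ?M)"
    unfolding hereditary_def using connects_verts connects_trans by blast
  show "\<forall>u\<in>?M. \<forall>w\<in>?M. \<exists>y\<in>?M. connects G u y \<and> connects G w y"
    using v by blast
  show "saturated G (verts G - ?M)"
    unfolding saturated_def
  proof (intro ballI impI)
    fix u assume u: "u \<in> verts G" "out_arcs G u \<noteq> {} \<and> head G ` out_arcs G u \<subseteq> verts G - ?M"
    have "\<not> connects G u v"
    proof
      assume "connects G u v"
      then obtain r where "awalk u r v"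
        by (auto simp: connects_def)
      moreover have "\<exists>r. awalk u r v \<and> r \<noteq> []"
        using \<open>awalk u r v\<close> assms by (cases "r = []") (auto simp: awalk_Nil_iff)
      then obtain e r where "awalk u (e # r) v"
        by (metis list.exhaust)
      then have "e \<in> out_arcs G u" "connects G (head G e) v"
        by (auto simp: awalk_Cons_iff out_arcs_def connects_def)
      then show False
        using u(2) by blast
    qed
    then show "u \<in> verts G - ?M"
      using u by simp
  qed
qed

text \<open>
  A shortest closed walk \<open>c\<close> at \<open>v\<close> is a cycle in the maximal tail of all vertices that connect to
  \<open>v\<close>, so it has an exit \<open>e\<close> whose head connects back to \<open>v\<close>. Following \<open>c\<close> up to \<open>e\<close> and
  then a shortest way home gives a second closed simple path at \<open>v\<close>.
\<close>

lemma exits_imp_condition_K: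
  assumes exits: "\<And>M p. \<lbrakk>maximal_tail G M; cycle_in G M p\<rbrakk> \<Longrightarrow> has_exit_in G M p"
  shows "condition_K G"
  unfolding condition_K_def
proof (intro allI impI)
  fix v assume "\<exists>u p. closed_simple_path G u p \<and> v \<in> path_verts G p"
  then obtain u p where "closed_simple_path G u p" "v \<in> path_verts G p"
    by blast
  then obtain d where d: "awalk v d v" "d \<noteq> []"
    using closed_walk_rotate unfolding closed_simple_path_def by blast
  obtain c where c: "awalk v c v" "c \<noteq> []" "distinct (map (tail G) c)"
    using d by (rule shortest_closed_walk)
  let ?M = "{u. connects G u v}"
  have "cycle_in G ?M c"
    using closed_simple_path_cycleI(2)[OF c] connects_path_vert(2)[OF c(1)]
    by (auto simp: cycle_in_def)
  then have "has_exit_in G ?M c"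
    using exits maximal_tail_of_closed_walk[OF d] by blast
  then obtain e i where e: "e \<in> arcs G" "i < length c" "tail G e = tail G (c ! i)" "e \<noteq> c ! i"
      "connects G (head G e) v"
    by (auto simp: has_exit_in_def exit_of_def)
  define r where "r = arg_min length (\<lambda>r. awalk (head G e) r v)"
  have r: "awalk (head G e) r v" and min: "\<And>d. awalk (head G e) d v \<Longrightarrow> length r \<le> length d"
  proof -
    obtain r0 where "awalk (head G e) r0 v"
      using e(5) by (auto simp: connects_def)
    from arg_min_nat_lemma[of "\<lambda>r. awalk (head G e) r v", OF this, of length]
    show "awalk (head G e) r v" "\<And>d. awalk (head G e) d v \<Longrightarrow> length r \<le> length d"
      by (auto simp: r_def)
  qed
  have r_avoids: "tail G f \<noteq> v" if f: "f \<in> set r" for f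
  proof
    assume "tail G f = v"
    moreover obtain q s where "r = q @ f # s" "awalk (head G e) q (tail G f)"
      using awalk_vertex_split[OF r f] by metis
    ultimately show False
      using min[of q] by simp
  qed
  define c' where "c' = take i c @ e # r"
  have drop: "drop i c = c ! i # drop (Suc i) c"
    using e(2) by (simp add: Cons_nth_drop_Suc)
  have "awalk v (take i c @ drop i c) v"
    using c(1) by simp
  then have "awalk v (take i c) (tail G e)"
    unfolding awalk_append_iff drop using e(3) by (auto simp: awalk_Cons_iff)
  then have "awalk v c' v"
    unfolding c'_def using r e(1) by (auto simp: awalk_Cons_iff)
  moreover have "tail G f \<noteq> v" if "f \<in> set (tl c')" for f
  proof -
    have hd: "tail G (c ! 0) = v"
      using awalk_tail_hd[OF c(1,2)] c(2) by (simp add: hd_conv_nth)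
    have late: "tail G (c ! k) \<noteq> v" if "0 < k" "k < length c" for k
      using c(2,3) hd that unfolding distinct_conv_nth
      by (metis length_greater_0_conv length_map less_numeral_extra(3) nth_map)
    show ?thesis
    proof (cases "i = 0")
      case True
      then show ?thesis
        using \<open>f \<in> set (tl c')\<close> r_avoids by (simp add: c'_def)
    next
      case False
      then have "f \<in> set (tl (take i c)) \<or> f = e \<or> f \<in> set r"
        using \<open>f \<in> set (tl c')\<close> c(2) by (auto simp: c'_def tl_append split: list.splits)
      moreover have "tail G f \<noteq> v" if "f \<in> set (tl (take i c))"
      proof -
        obtain k where "k < length (tl (take i c))" "f = tl (take i c) ! k"
          using \<open>f \<in> set (tl (take i c))\<close> by (metis in_set_conv_nth)
        then have "f = c ! Suc k" "Suc k < length c"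
          by (auto simp: nth_tl)
        then show ?thesis
          using late by simp
      qed
      ultimately show ?thesis
        using late[of i] e r_avoids False by auto
    qed
  qed
  ultimately have "closed_simple_path G v c'"
    by (auto simp: closed_simple_path_def c'_def)
  moreover have "c \<noteq> c'"
  proof
    assume "c = c'"
    then have "c ! i = e"
      using e(2) by (metis c'_def length_take min.absorb4 nth_append_length)
    then show False
      using e(4) by simp
  qed
  ultimately show "\<exists>p q. p \<noteq> q \<and> closed_simple_path G v p \<and> closed_simple_path G v q"
    using closed_simple_path_cycleI(1)[OF c] by blast
qed

text \<open>
  Outside a hereditary saturated set one can always move on to a vertex outside this set, unless a
  sink is reached. The vertices that connect to the resulting infinite path (constant once it reaches a
  sink) form a maximal tail.
\<close>

lemma maximal_tail_avoiding:
  assumes H: "hereditary G H" "saturated G H" and v: "v \<in> verts G" "v \<notin> H"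
  obtains M where "maximal_tail G M" "v \<in> M" "M \<inter> H = {}"
proof -
  define step where "step u w \<longleftrightarrow> w \<in> verts G - H \<and> connects G u w \<and>
      (if out_arcs G u = {} then w = u else w \<in> head G ` out_arcs G u)" for u w
  have "\<exists>w. step u w" if u: "u \<in> verts G - H" for u
  proof (cases "out_arcs G u = {}")
    case True
    then show ?thesis
      using u by (auto simp: step_def connects_refl)
  next
    case False
    then obtain e where e: "e \<in> out_arcs G u" "head G e \<notin> H"
      using H(2) u unfolding saturated_def by blast
    then have "step u (head G e)"
      using connects_arc[of e] by (auto simp: step_def out_arcs_def)
    then show ?thesis ..
  qed
  then obtain vs where vs: "vs 0 = v" "\<And>n. vs n \<in> verts G - H" "\<And>n. step (vs n) (vs (Suc n))"
    using dependent_nat_choice[of "\<lambda>n u. u \<in> verts G - H \<and> (n = 0 \<longrightarrow> u = v)" "\<lambda>n. step"] v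
    by (auto simp: step_def)
  have mono: "connects G (vs m) (vs n)" if "m \<le> n" for m n
    using that
  proof (induction n rule: dec_induct)
    case base
    then show ?case
      using vs(2) by (auto intro: connects_refl)
  next
    case (step n)
    then show ?case
      using vs(3)[of n] by (auto simp: \<open>step \<equiv> _\<close> step_def intro: connects_trans)
  qed
  define M where "M = {u. \<exists>n. connects G u (vs n)}"
  have "maximal_tail G M"
    unfolding maximal_tail_def
  proof (intro conjI)
    show "M \<noteq> {}" "M \<subseteq> verts G"
      using mono[of 0 0] connects_verts by (auto simp: M_def)
    show "hereditary G (verts G - M)"
      unfolding hereditary_def M_def using connects_verts connects_trans by blast
    show "\<forall>u\<in>M. \<forall>w\<in>M. \<exists>y\<in>M. connects G u y \<and> connects G w y"
    proof (intro ballI)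
      fix u w assume "u \<in> M" "w \<in> M"
      then obtain m n where "connects G u (vs m)" "connects G w (vs n)"
        by (auto simp: M_def)
      then have "connects G u (vs (max m n))" "connects G w (vs (max m n))"
        using mono[of m "max m n"] mono[of n "max m n"] by (auto intro: connects_trans)
      moreover have "vs (max m n) \<in> M"
        unfolding M_def using mono by blast
      ultimately show "\<exists>y\<in>M. connects G u y \<and> connects G w y"
        by blast
    qed
    show "saturated G (verts G - M)"
      unfolding saturated_def
    proof (intro ballI impI)
      fix u assume u: "u \<in> verts G" "out_arcs G u \<noteq> {} \<and> head G ` out_arcs G u \<subseteq> verts G - M"
      have "u \<notin> M"
      proof
        assume "u \<in> M"
        then obtain n r where r: "awalk u r (vs n)"
          by (auto simp: M_def connects_def)
        have "\<exists>e\<in>out_arcs G u. head G e \<in> M"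
        proof (cases r)
          case Nil
          then have "u = vs n"
            using r by (simp add: awalk_Nil_iff)
          then have "vs (Suc n) \<in> head G ` out_arcs G u"
            using vs(3)[of n] u(2) by (simp add: step_def)
          then obtain e where "e \<in> out_arcs G u" "vs (Suc n) = head G e"
            by blast
          moreover have "vs (Suc n) \<in> M"
            unfolding M_def using mono by blast
          ultimately show ?thesis
            by auto
        next
          case (Cons e r')
          then have "e \<in> out_arcs G u" "connects G (head G e) (vs n)"
            using r by (auto simp: awalk_Cons_iff out_arcs_def connects_def)
          then show ?thesis
            by (auto simp: M_def)
        qed
        then show False
          using u(2) by blast
      qed
      then show "u \<in> verts G - M"
        using u by simp
    qed
  qed
  moreover have "v \<in> M"
    using vs(1) mono[of 0 0] by (auto simp: M_def)
  moreover have "M \<inter> H = {}"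
    using vs(2) H(1) unfolding M_def hereditary_def by blast
  ultimately show thesis
    by (rule that)
qed

definition acyclic_in :: "'a set \<Rightarrow> 'a \<Rightarrow> bool" where
  "acyclic_in M v \<longleftrightarrow> (\<forall>u\<in>M. connects G v u \<longrightarrow> \<not> (\<exists>c. awalk u c u \<and> c \<noteq> []))"

lemma acyclic_in_of_no_cycle:
  assumes M: "hereditary G (verts G - M)"
    and "\<not> (\<exists>p. cycle_in G M p \<and> connects_to_cycle G v p)"
  shows "acyclic_in M v"
  unfolding acyclic_in_def
proof (intro ballI impI notI)
  fix u assume u: "u \<in> M" "connects G v u" "\<exists>c. awalk u c u \<and> c \<noteq> []"
  then obtain c where c: "awalk u c u" "c \<noteq> []" "distinct (map (tail G) c)"
    using shortest_closed_walk by metis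
  have "cycle_in G M c"
    using closed_simple_path_cycleI(2)[OF c] connects_path_vert(2)[OF c(1)] u(1)
      hereditary_complement[OF M] by (auto simp: cycle_in_def)
  moreover have "u \<in> path_verts G c"
    using awalk_tail_hd[OF c(1,2)] c(2) by (auto simp: path_verts_def)
  ultimately show False
    using assms(2) u(2) by (auto simp: connects_to_cycle_def)
qed

text \<open>
  A path inside \<open>M\<close> that starts at \<open>v\<close> cannot repeat an edge.
\<close>

lemma finite_paths_acyclic_in:
  assumes M: "hereditary G (verts G - M)" and ac: "acyclic_in M v" and F: "finite F"
  shows "finite {p. set p \<subseteq> F \<and> (\<exists>w\<in>M. awalk v p w)}"
proof (rule finite_subset)
  show "{p. set p \<subseteq> F \<and> (\<exists>w\<in>M. awalk v p w)} \<subseteq> {p. set p \<subseteq> F \<and> distinct p}"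
  proof safe
    fix p w assume p: "w \<in> M" "awalk v p w"
    show "distinct p"
    proof (rule ccontr)
      assume "\<not> distinct p"
      then obtain q e r s where eq: "p = q @ [e] @ r @ [e] @ s"
        by (metis not_distinct_decomp)
      then have "awalk v (q @ [e] @ r @ [e] @ s) w"
        using p by simp
      then have *: "awalk v q (tail G e)" "awalk (tail G e) ([e] @ r) (tail G e)" "awalk (tail G e) (e # s) w"
        by (auto simp: awalk_Cons_iff)
      then have "tail G e \<in> M"
        using hereditary_complement[OF M _ p(1)] by (auto simp: connects_def)
      then show False
        using ac * unfolding acyclic_in_def connects_def by blast
    qed
  qed
  show "finite {p. set p \<subseteq> F \<and> distinct p}"
    using F by (rule finite_subset_distinct)
qed

end

section \<open>Leavitt families\<close>

text \<open>
  The part of the structure of a Leavitt path algebra that the arguments below use. The element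
  \<open>scal c v\<close> stands for the multiple \<open>c v\<close> of the vertex \<open>v\<close>; together with these elements the
  ring structure determines the scalar action, which a ring record does not carry. The last assumption
  says that the elements \<open>c v\<close>, \<open>c e\<close> and \<open>c e\<^sup>*\<close> generate the ring.
\<close>

locale leavitt_family = nonunital_ring R + wf_digraph G
  for R :: "('r, 'm) ring_scheme" (structure) and G :: "('v, 'e) pre_digraph" +
  fixes scal :: "'k::field \<Rightarrow> 'v \<Rightarrow> 'r" and E Gh :: "'e \<Rightarrow> 'r"
  assumes row_finite: "row_finite G"
    and scal_closed [simp]: "v \<in> verts G \<Longrightarrow> scal c v \<in> carrier R"
    and E_closed [simp]: "e \<in> arcs G \<Longrightarrow> E e \<in> carrier R"
    and Gh_closed [simp]: "e \<in> arcs G \<Longrightarrow> Gh e \<in> carrier R"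
    and scal_add: "v \<in> verts G \<Longrightarrow> scal (c + d) v = scal c v \<oplus> scal d v"
    and scal_mult: "\<lbrakk>v \<in> verts G; w \<in> verts G\<rbrakk> \<Longrightarrow>
      scal c v \<otimes> scal d w = (if v = w then scal (c * d) v else \<zero>)"
    and scal_E: "\<lbrakk>v \<in> verts G; e \<in> arcs G\<rbrakk> \<Longrightarrow>
      scal c v \<otimes> E e = (if v = tail G e then E e \<otimes> scal c (head G e) else \<zero>)"
    and E_range: "e \<in> arcs G \<Longrightarrow> E e \<otimes> scal 1 (head G e) = E e"
    and Gh_scal: "\<lbrakk>v \<in> verts G; e \<in> arcs G\<rbrakk> \<Longrightarrow>
      Gh e \<otimes> scal c v = (if v = tail G e then scal c (head G e) \<otimes> Gh e else \<zero>)"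
    and Gh_range: "e \<in> arcs G \<Longrightarrow> scal 1 (head G e) \<otimes> Gh e = Gh e"
    and Gh_E: "\<lbrakk>e \<in> arcs G; f \<in> arcs G\<rbrakk> \<Longrightarrow>
      Gh e \<otimes> E f = (if e = f then scal 1 (head G e) else \<zero>)"
    and vertex_sum: "\<lbrakk>v \<in> verts G; out_arcs G v \<noteq> {}\<rbrakk> \<Longrightarrow>
      scal 1 v = (\<Oplus>e\<in>out_arcs G v. E e \<otimes> Gh e)"
    and carrier_induct [consumes 1, case_names zero add scal E Gh mult_scal mult_E mult_Gh]:
      "\<lbrakk>x \<in> carrier R; Q \<zero>; \<And>x y. \<lbrakk>x \<in> carrier R; y \<in> carrier R; Q x; Q y\<rbrakk> \<Longrightarrow> Q (x \<oplus> y);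
        \<And>c v. v \<in> verts G \<Longrightarrow> Q (scal c v); \<And>c e. e \<in> arcs G \<Longrightarrow> Q (E e \<otimes> scal c (head G e));
        \<And>c e. e \<in> arcs G \<Longrightarrow> Q (scal c (head G e) \<otimes> Gh e);
        \<And>v x. \<lbrakk>v \<in> verts G; x \<in> carrier R; Q x\<rbrakk> \<Longrightarrow> Q (scal 1 v \<otimes> x);
        \<And>e x. \<lbrakk>e \<in> arcs G; x \<in> carrier R; Q x\<rbrakk> \<Longrightarrow> Q (E e \<otimes> x);
        \<And>e x. \<lbrakk>e \<in> arcs G; x \<in> carrier R; Q x\<rbrakk> \<Longrightarrow> Q (Gh e \<otimes> x)\<rbrakk> \<Longrightarrow> Q x"
begin

abbreviation V :: "'v \<Rightarrow> 'r" where
  "V \<equiv> scal 1"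

lemma finite_out_arcs: "v \<in> verts G \<Longrightarrow> finite (out_arcs G v)"
  using row_finite by (simp add: row_finite_def)

lemma V_idem: "v \<in> verts G \<Longrightarrow> V v \<otimes> V v = V v"
  by (simp add: scal_mult)

text \<open>
  The monomial \<open>c \<mu> w \<nu>\<^sup>*\<close> for paths \<open>\<mu>\<close> and \<open>\<nu>\<close> that end in \<open>w\<close>; the ghost path \<open>\<nu>\<^sup>*\<close> is read in
  reverse order.
\<close>

definition lmon :: "'k \<Rightarrow> 'e list \<Rightarrow> 'v \<Rightarrow> 'e list \<Rightarrow> 'r" where
  "lmon c \<mu> w \<nu> = foldr (\<lambda>e x. E e \<otimes> x) \<mu> (foldr (\<lambda>e x. x \<otimes> Gh e) \<nu> (scal c w))"

lemma lmon_Nil: "lmon c [] w [] = scal c w"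
  by (simp add: lmon_def)

lemma lmon_Cons: "lmon c (e # \<mu>) w \<nu> = E e \<otimes> lmon c \<mu> w \<nu>"
  by (simp add: lmon_def)

lemma lmon_ghost_Cons: "lmon c [] w (e # \<nu>) = lmon c [] w \<nu> \<otimes> Gh e"
  by (simp add: lmon_def)

lemma lmon_closed [simp]:
  assumes "awalk u \<mu> w" "awalk x \<nu> w"
  shows "lmon c \<mu> w \<nu> \<in> carrier R"
proof -
  have "lmon c [] w \<nu> \<in> carrier R"
    using assms(2) by (induction \<nu> arbitrary: x) (auto simp: lmon_Nil lmon_ghost_Cons awalk_simps)
  then show ?thesis
    using assms(1) by (induction \<mu> arbitrary: u) (auto simp: lmon_Cons awalk_simps)
qed

lemma scal_lmon:
  assumes "y \<in> verts G" "awalk u \<mu> w" "awalk x \<nu> w"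
  shows "scal d y \<otimes> lmon c \<mu> w \<nu> = (if y = u then lmon (d * c) \<mu> w \<nu> else \<zero>)"
  using assms(1,2)
proof (induction \<mu> arbitrary: u y)
  case Nil
  from assms(3) show ?case
  proof (induction \<nu> arbitrary: x)
    case Nil
    then show ?case
      using \<open>awalk u [] w\<close> \<open>y \<in> verts G\<close> by (auto simp: lmon_Nil awalk_simps scal_mult)
  next
    case (Cons e \<nu>)
    then have c: "e \<in> arcs G" "awalk (head G e) \<nu> w" "awalk w [] w"
      using \<open>awalk u [] w\<close> by (auto simp: awalk_simps)
    have "scal d y \<otimes> lmon c [] w (e # \<nu>) = (scal d y \<otimes> lmon c [] w \<nu>) \<otimes> Gh e"
      using c lmon_closed[OF c(3,2)] \<open>y \<in> verts G\<close> by (simp add: lmon_ghost_Cons m_assoc)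
    then show ?case
      using Cons.IH[OF c(2)] c by (simp add: lmon_ghost_Cons)
  qed
next
  case (Cons e \<mu>)
  then have c: "e \<in> arcs G" "tail G e = u" "awalk (head G e) \<mu> w"
    by (auto simp: awalk_simps)
  have "scal d y \<otimes> lmon c (e # \<mu>) w \<nu> = (scal d y \<otimes> E e) \<otimes> lmon c \<mu> w \<nu>"
    using c lmon_closed[OF c(3) assms(3)] Cons.prems by (simp add: lmon_Cons m_assoc)
  also have "\<dots> = (if y = u then E e \<otimes> (scal d (head G e) \<otimes> lmon c \<mu> w \<nu>) else \<zero>)"
    using c lmon_closed[OF c(3) assms(3)] Cons.prems by (simp add: scal_E m_assoc)
  finally show ?case
    using Cons.IH[OF _ c(3), of "head G e"] c by (simp add: lmon_Cons)
qed

lemma E_lmon: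
  assumes "e \<in> arcs G" "awalk u \<mu> w" "awalk x \<nu> w"
  shows "E e \<otimes> lmon c \<mu> w \<nu> = (if head G e = u then lmon c (e # \<mu>) w \<nu> else \<zero>)"
proof (cases "head G e = u")
  case False
  have "E e \<otimes> lmon c \<mu> w \<nu> = E e \<otimes> (V (head G e) \<otimes> lmon c \<mu> w \<nu>)"
    using assms by (simp add: E_range flip: m_assoc)
  then show ?thesis
    using False assms by (simp add: scal_lmon)
qed (simp add: lmon_Cons)

lemma Gh_lmon_Cons:
  assumes "e \<in> arcs G" "awalk u (f # \<mu>) w" "awalk x \<nu> w"
  shows "Gh e \<otimes> lmon c (f # \<mu>) w \<nu> = (if e = f then lmon c \<mu> w \<nu> else \<zero>)"
proof -
  have c: "f \<in> arcs G" "awalk (head G f) \<mu> w"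
    using assms by (auto simp: awalk_simps)
  have "Gh e \<otimes> lmon c (f # \<mu>) w \<nu> = (Gh e \<otimes> E f) \<otimes> lmon c \<mu> w \<nu>"
    using assms(1) c lmon_closed[OF c(2) assms(3)] by (simp add: lmon_Cons m_assoc)
  then show ?thesis
    using assms c by (simp add: Gh_E scal_lmon)
qed

lemma Gh_lmon_Nil:
  assumes "e \<in> arcs G" "awalk x \<nu> w"
  shows "Gh e \<otimes> lmon c [] w \<nu> = (if w = tail G e then lmon c [] (head G e) (\<nu> @ [e]) else \<zero>)"
  using assms(2)
proof (induction \<nu> arbitrary: x)
  case Nil
  then show ?case
    using assms(1) by (auto simp: lmon_Nil lmon_ghost_Cons Gh_scal awalk_simps)
next
  case (Cons f \<nu>)
  then have c: "f \<in> arcs G" "awalk (head G f) \<nu> w" "awalk w [] w"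
    by (auto simp: awalk_simps)
  have "Gh e \<otimes> lmon c [] w (f # \<nu>) = (Gh e \<otimes> lmon c [] w \<nu>) \<otimes> Gh f"
    using assms(1) c lmon_closed[OF c(3,2)] by (simp add: lmon_ghost_Cons m_assoc)
  then show ?case
    using Cons.IH[OF c(2)] c by (simp add: lmon_ghost_Cons)
qed

lemma lmon_assoc_right:
  assumes "awalk u \<mu> w" "awalk x \<nu> w" "r \<in> carrier R"
  shows "lmon c \<mu> w \<nu> \<otimes> r = foldr (\<lambda>e x. E e \<otimes> x) \<mu> (lmon c [] w \<nu> \<otimes> r)"
  using assms(1)
proof (induction \<mu> arbitrary: u)
  case (Cons e \<mu>)
  then have c: "e \<in> arcs G" "awalk (head G e) \<mu> w"
    by (auto simp: awalk_simps)
  then show ?case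
    using Cons.IH[OF c(2)] assms(3) lmon_closed[OF c(2) assms(2)] by (simp add: lmon_Cons m_assoc)
qed simp

lemma foldr_E_zero: "set \<mu> \<subseteq> arcs G \<Longrightarrow> foldr (\<lambda>e x. E e \<otimes> x) \<mu> \<zero> = \<zero>"
  by (induction \<mu>) auto

lemma foldr_E_lmon: "foldr (\<lambda>e x. E e \<otimes> x) \<mu> (lmon c \<nu> w \<nu>') = lmon c (\<mu> @ \<nu>) w \<nu>'"
  by (simp add: lmon_def)

lemma lmon_scal:
  assumes "y \<in> verts G" "awalk u \<mu> w" "awalk x \<nu> w"
  shows "lmon c \<mu> w \<nu> \<otimes> scal d y = (if y = x then lmon (c * d) \<mu> w \<nu> else \<zero>)"
proof -
  have "lmon c [] w \<nu> \<otimes> scal d y = (if y = x then lmon (c * d) [] w \<nu> else \<zero>)"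
    using assms(1,3)
  proof (induction \<nu> arbitrary: x y)
    case Nil
    then show ?case
      by (auto simp: lmon_Nil awalk_simps scal_mult)
  next
    case (Cons e \<nu>)
    then have c: "e \<in> arcs G" "tail G e = x" "awalk (head G e) \<nu> w" "awalk w [] w"
      by (auto simp: awalk_simps)
    note lc = lmon_closed[OF c(4,3)]
    have "lmon c [] w (e # \<nu>) \<otimes> scal d y = lmon c [] w \<nu> \<otimes> (Gh e \<otimes> scal d y)"
      using c lc Cons.prems by (simp add: lmon_ghost_Cons m_assoc)
    also have "\<dots> = (if y = x then (lmon c [] w \<nu> \<otimes> scal d (head G e)) \<otimes> Gh e else \<zero>)"
      using c lc Cons.prems by (simp add: Gh_scal m_assoc)
    finally show ?case
      using Cons.IH[OF _ c(3), of "head G e"] c by (simp add: lmon_ghost_Cons)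
  qed
  moreover have "set \<mu> \<subseteq> arcs G"
    using assms(2) by auto
  ultimately show ?thesis
    using assms by (simp add: lmon_assoc_right[OF assms(2,3)] foldr_E_zero foldr_E_lmon)
qed

lemma lmon_Gh:
  assumes "e \<in> arcs G" "awalk u \<mu> w" "awalk x \<nu> w" "x = head G e"
  shows "lmon c \<mu> w \<nu> \<otimes> Gh e = lmon c \<mu> w (e # \<nu>)"
  using assms by (simp add: lmon_assoc_right[OF assms(2,3)] foldr_E_lmon flip: lmon_ghost_Cons)

lemma lmon_E_Cons:
  assumes "e \<in> arcs G" "awalk u \<mu> w" "awalk x (f # \<nu>) w"
  shows "lmon c \<mu> w (f # \<nu>) \<otimes> E e = (if e = f then lmon c \<mu> w \<nu> else \<zero>)"
proof -
  have c: "f \<in> arcs G" "awalk (head G f) \<nu> w"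
    using assms by (auto simp: awalk_simps)
  have "lmon c \<mu> w (f # \<nu>) \<otimes> E e = lmon c \<mu> w \<nu> \<otimes> (Gh f \<otimes> E e)"
    using assms(1,2) c lmon_closed[OF assms(2) c(2)] by (simp add: m_assoc flip: lmon_Gh[OF c(1) assms(2) c(2) refl])
  then show ?thesis
    using assms c by (simp add: Gh_E lmon_scal)
qed

lemma lmon_E_Nil:
  assumes "e \<in> arcs G" "awalk u \<mu> w"
  shows "lmon c \<mu> w [] \<otimes> E e = (if w = tail G e then lmon c (\<mu> @ [e]) (head G e) [] else \<zero>)"
proof -
  have c: "awalk w [] w" "w \<in> verts G" "set \<mu> \<subseteq> arcs G"
    using assms by (auto simp: awalk_simps)
  have "lmon c [] w [] \<otimes> E e = (if w = tail G e then lmon c [e] (head G e) [] else \<zero>)"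
    using assms(1) c by (simp add: lmon_Nil lmon_Cons scal_E)
  then show ?thesis
    using assms(1) c by (simp add: lmon_assoc_right[OF assms(2) c(1)] foldr_E_zero foldr_E_lmon)
qed

lemma lmon_mult_path:
  assumes "awalk u \<mu> w" "awalk w \<nu> w'" 
  shows "lmon c \<mu> w [] \<otimes> lmon d \<nu> w' [] = lmon (c * d) (\<mu> @ \<nu>) w' []"
proof -
  have c: "awalk w [] w" "w \<in> verts G" "awalk w' [] w'"
    using assms by (auto simp: awalk_simps)
  show ?thesis
    using c lmon_closed[OF assms(2) c(3)]
    by (simp add: lmon_assoc_right[OF assms(1) c(1)] lmon_Nil scal_lmon[OF c(2) assms(2) c(3)] foldr_E_lmon)
qed

lemma ghost_mult_path:
  assumes "awalk x \<nu> w" "awalk w \<delta> w'"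
  shows "lmon c [] w \<nu> \<otimes> lmon d (\<nu> @ \<delta>) w' [] = lmon (c * d) \<delta> w' []"
  using assms(1)
proof (induction \<nu> arbitrary: x)
  case Nil
  then show ?case
    using scal_lmon[OF _ assms(2), of w w' "[]"] assms(2) by (auto simp: lmon_Nil awalk_simps)
next
  case (Cons e \<nu>)
  have c: "e \<in> arcs G" "awalk (head G e) \<nu> w" "awalk w [] w" "awalk w' [] w'"
      "awalk x ((e # \<nu>) @ \<delta>) w'" "awalk (head G e) (\<nu> @ \<delta>) w'"
    using Cons.prems assms(2) by (auto simp: awalk_simps)
  have "lmon c [] w (e # \<nu>) \<otimes> lmon d ((e # \<nu>) @ \<delta>) w' []
      = lmon c [] w \<nu> \<otimes> (Gh e \<otimes> lmon d (e # \<nu> @ \<delta>) w' [])"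
    using c(1) lmon_closed[OF c(3,2)] lmon_closed[OF c(5,4)] by (simp add: lmon_ghost_Cons m_assoc)
  then show ?case
    using Cons.IH[OF c(2)] Gh_lmon_Cons[OF c(1) _ c(4), of x e "\<nu> @ \<delta>"] c(5) by simp
qed

lemma ghost_mult_path_incomparable:
  assumes "awalk x \<nu> w" "awalk y \<mu> w'" "\<not> prefix \<nu> \<mu>" "\<not> prefix \<mu> \<nu>"
  shows "lmon c [] w \<nu> \<otimes> lmon d \<mu> w' [] = \<zero>"
  using assms
proof (induction \<nu> arbitrary: x y \<mu>)
  case (Cons e \<nu>)
  then obtain f \<mu>' where \<mu>: "\<mu> = f # \<mu>'"
    by (cases \<mu>) auto
  have c: "e \<in> arcs G" "awalk (head G e) \<nu> w" "awalk w [] w" "awalk w' [] w'"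
      "awalk (head G f) \<mu>' w'"
    using Cons.prems \<mu> by (auto simp: awalk_simps)
  have "lmon c [] w (e # \<nu>) \<otimes> lmon d \<mu> w' [] = lmon c [] w \<nu> \<otimes> (Gh e \<otimes> lmon d (f # \<mu>') w' [])"
    using c(1) lmon_closed[OF c(3,2)] lmon_closed[OF Cons.prems(2) c(4)] \<mu> by (simp add: lmon_ghost_Cons m_assoc)
  also have "\<dots> = (if e = f then lmon c [] w \<nu> \<otimes> lmon d \<mu>' w' [] else \<zero>)"
    using Gh_lmon_Cons[OF c(1) _ c(4), of y f \<mu>'] Cons.prems(2) \<mu> lmon_closed[OF c(3,2)] by simp
  finally show ?case
    using Cons.IH[OF c(2,5)] Cons.prems(3,4) \<mu> by (cases "e = f") auto
qed simp

lemma ghost_mult_path_source: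
  assumes "awalk x \<nu> w" "awalk y \<mu> w'" "x \<noteq> y"
  shows "lmon c [] w \<nu> \<otimes> lmon d \<mu> w' [] = \<zero>"
proof -
  have c: "awalk w [] w" "awalk w' [] w'" "x \<in> verts G"
    using assms by (auto simp: awalk_simps)
  have "lmon c [] w \<nu> \<otimes> lmon d \<mu> w' [] = (lmon c [] w \<nu> \<otimes> V x) \<otimes> lmon d \<mu> w' []"
    using c(3) by (simp add: lmon_scal[OF c(3,1) assms(1)])
  also have "\<dots> = lmon c [] w \<nu> \<otimes> (V x \<otimes> lmon d \<mu> w' [])"
    using c(3) lmon_closed[OF c(1) assms(1)] lmon_closed[OF assms(2) c(2)] by (simp add: m_assoc)
  also have "\<dots> = \<zero>"
    using assms(3) lmon_closed[OF c(1) assms(1)] by (simp add: scal_lmon[OF c(3) assms(2) c(2)])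
  finally show ?thesis .
qed

lemma lmon_add:
  assumes "awalk u \<mu> w" "awalk x \<nu> w"
  shows "lmon (c + d) \<mu> w \<nu> = lmon c \<mu> w \<nu> \<oplus> lmon d \<mu> w \<nu>"
proof -
  have w: "w \<in> verts G" "awalk w [] w"
    using assms by (auto simp: awalk_simps)
  have "lmon (c + d) [] w \<nu> = lmon c [] w \<nu> \<oplus> lmon d [] w \<nu>"
    using assms(2)
  proof (induction \<nu> arbitrary: x)
    case (Cons e \<nu>)
    then have c: "e \<in> arcs G" "awalk (head G e) \<nu> w"
      by (auto simp: awalk_simps)
    then show ?case
      using Cons.IH[OF c(2)] lmon_closed[OF w(2) c(2)] by (simp add: lmon_ghost_Cons l_distr)
  qed (use w in \<open>simp add: lmon_Nil scal_add\<close>)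
  then show ?thesis
    using assms(1)
  proof (induction \<mu> arbitrary: u)
    case (Cons e \<mu>)
    then have c: "e \<in> arcs G" "awalk (head G e) \<mu> w"
      by (auto simp: awalk_simps)
    then show ?case
      using Cons.IH[OF Cons.prems(1) c(2)] lmon_closed[OF c(2) assms(2)] by (simp add: lmon_Cons r_distr)
  qed simp
qed

lemma lmon_zero:
  assumes "awalk u \<mu> w" "awalk x \<nu> w"
  shows "lmon 0 \<mu> w \<nu> = \<zero>"
  using lmon_add[OF assms, of 0 0] lmon_closed[OF assms] by (metis add.l_cancel_one' add_0)

subsection \<open>Spanning by monomials\<close>

text \<open>
  The sums of monomials whose paths satisfy \<open>P\<close>.
\<close>

inductive_set lspan :: "('e list \<Rightarrow> 'v \<Rightarrow> 'e list \<Rightarrow> bool) \<Rightarrow> 'r set"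
  for P :: "'e list \<Rightarrow> 'v \<Rightarrow> 'e list \<Rightarrow> bool" where
  zero: "\<zero> \<in> lspan P"
| add: "\<lbrakk>x \<in> lspan P; awalk u \<mu> w; awalk y \<nu> w; P \<mu> w \<nu>\<rbrakk> \<Longrightarrow> x \<oplus> lmon c \<mu> w \<nu> \<in> lspan P"

abbreviation ghost_span :: "nat \<Rightarrow> 'r set" where
  "ghost_span n \<equiv> lspan (\<lambda>_ _ \<nu>. length \<nu> \<le> n)"

abbreviation path_span :: "'v \<Rightarrow> 'r set" where
  "path_span w \<equiv> lspan (\<lambda>_ w' \<nu>. \<nu> = [] \<and> w' = w)"

abbreviation corner_span :: "'v \<Rightarrow> 'r set" where
  "corner_span v \<equiv> lspan (\<lambda>\<mu> w \<nu>. awalk v \<mu> w \<and> awalk v \<nu> w)"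

abbreviation corner_span_over :: "'v \<Rightarrow> 'e set \<Rightarrow> 'r set" where
  "corner_span_over v F \<equiv>
    lspan (\<lambda>\<mu> w \<nu>. awalk v \<mu> w \<and> awalk v \<nu> w \<and> set \<mu> \<union> set \<nu> \<subseteq> F)"

lemma lspan_closed: "x \<in> lspan P \<Longrightarrow> x \<in> carrier R"
  by (induction rule: lspan.induct) auto

lemma lspan_lmon: "\<lbrakk>awalk u \<mu> w; awalk y \<nu> w; P \<mu> w \<nu>\<rbrakk> \<Longrightarrow> lmon c \<mu> w \<nu> \<in> lspan P"
  using lspan.add[OF lspan.zero, of u \<mu> w y \<nu> P c] by simp

lemma lspan_add:
  assumes "x \<in> lspan P" "y \<in> lspan P"
  shows "x \<oplus> y \<in> lspan P"
  using assms(2,1)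
proof (induction y rule: lspan.induct)
  case zero
  then show ?case
    by (simp add: lspan_closed)
next
  case (add y u \<mu> w z \<nu> c)
  then have "x \<oplus> y \<oplus> lmon c \<mu> w \<nu> \<in> lspan P"
    by (intro lspan.add) auto
  then show ?case
    using add by (simp add: lspan_closed a_assoc)
qed

lemma lspan_map:
  assumes "x \<in> lspan P" "f \<zero> = \<zero>"
    and "\<And>x y. \<lbrakk>x \<in> carrier R; y \<in> carrier R\<rbrakk> \<Longrightarrow> f (x \<oplus> y) = f x \<oplus> f y"
    and "\<And>u \<mu> w y \<nu> c. \<lbrakk>awalk u \<mu> w; awalk y \<nu> w; P \<mu> w \<nu>\<rbrakk> \<Longrightarrow> f (lmon c \<mu> w \<nu>) \<in> lspan Q"
  shows "f x \<in> lspan Q"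
  using assms(1)
proof (induction rule: lspan.induct)
  case zero
  then show ?case
    using assms(2) by (simp add: lspan.zero)
next
  case (add x u \<mu> w y \<nu> c)
  then show ?case
    using assms(3)[of x "lmon c \<mu> w \<nu>"] assms(4) by (simp add: lspan_closed lspan_add)
qed

lemma carrier_lspan:
  assumes "x \<in> carrier R"
  shows "x \<in> lspan (\<lambda>_ _ _. True)" (is "x \<in> lspan ?P")
  using assms
proof (induction rule: carrier_induct)
  case zero
  show ?case
    by (rule lspan.zero)
next
  case (add x y)
  show ?case
    using add(3,4) by (rule lspan_add)
next
  case (scal c v)
  then show ?case
    using lspan_lmon[of v "[]" v v "[]" ?P c] by (simp add: lmon_Nil awalk_simps)
next
  case (E c e)
  then show ?case
    using lspan_lmon[of "tail G e" "[e]" "head G e" "head G e" "[]" ?P c]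
    by (simp add: lmon_Nil lmon_Cons awalk_simps)
next
  case (Gh c e)
  then show ?case
    using lspan_lmon[of "head G e" "[]" "head G e" "tail G e" "[e]" ?P c]
    by (simp add: lmon_Nil lmon_ghost_Cons awalk_simps)
next
  case (mult_scal v x)
  show ?case
    by (rule lspan_map[OF mult_scal(3)])
      (use mult_scal in \<open>auto simp: r_distr scal_lmon lspan.zero intro: lspan_lmon\<close>)
next
  case (mult_E e x)
  show ?case
  proof (rule lspan_map[OF mult_E(3)])
    fix u \<mu> w y \<nu> c assume *: "awalk u \<mu> w" "awalk y \<nu> w"
    show "E e \<otimes> lmon c \<mu> w \<nu> \<in> lspan ?P"
    proof (cases "head G e = u")
      case True
      then have "awalk (tail G e) (e # \<mu>) w"
        using * mult_E by (simp add: awalk_simps)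
      then show ?thesis
        using * mult_E True by (simp add: E_lmon lspan_lmon)
    qed (use * mult_E in \<open>simp add: E_lmon lspan.zero\<close>)
  qed (use mult_E in \<open>auto simp: r_distr\<close>)
next
  case (mult_Gh e x)
  show ?case
  proof (rule lspan_map[OF mult_Gh(3)])
    fix u \<mu> w y \<nu> c assume *: "awalk u \<mu> w" "awalk y \<nu> w"
    show "Gh e \<otimes> lmon c \<mu> w \<nu> \<in> lspan ?P"
    proof (cases \<mu>)
      case Nil
      show ?thesis
      proof (cases "w = tail G e")
        case True
        then have "awalk (head G e) [] (head G e)" "awalk y (\<nu> @ [e]) (head G e)"
          using * mult_Gh by (auto simp: awalk_simps)
        then show ?thesis
          using Gh_lmon_Nil[OF mult_Gh(1) *(2)] True Nil by (simp add: lspan_lmon)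
      qed (use * mult_Gh Nil in \<open>simp add: Gh_lmon_Nil lspan.zero\<close>)
    next
      case (Cons f \<mu>')
      then have "awalk (head G f) \<mu>' w"
        using * by (simp add: awalk_simps)
      then show ?thesis
        using * mult_Gh Cons by (auto simp: Gh_lmon_Cons lspan.zero intro: lspan_lmon)
    qed
  qed (use mult_Gh in \<open>auto simp: r_distr\<close>)
qed

lemma orthogonal_vertices: "orthogonal_idempotents (V ` verts G)"
proof -
  have "V s \<otimes> V t = (if V s = V t then V s else \<zero>)" if "s \<in> verts G" "t \<in> verts G" for s t
    using that scal_mult[of s t 1 1] V_idem[of t] by (cases "s = t") auto
  then show ?thesis
    unfolding orthogonal_idempotents_def by auto
qed

lemma orthogonal_vertices_subset: "U \<subseteq> verts G \<Longrightarrow> orthogonal_idempotents (V ` U)"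
  using orthogonal_vertices unfolding orthogonal_idempotents_def by (meson image_mono subset_iff)

text \<open>
  Sums of vertices are approximate units: the ring need not have a unit, but every element is fixed by
  a finite sum of vertices.
\<close>

lemma right_local_unit:
  assumes "a \<in> carrier R"
  obtains F where "finite F" "F \<subseteq> V ` verts G" "a \<otimes> idem_sum F = a"
proof -
  note orth = orthogonal_vertices
  have Sc: "V ` verts G \<subseteq> carrier R"
    by auto
  have "a \<in> lspan (\<lambda>_ _ _. True)"
    using assms by (rule carrier_lspan)
  then have "\<exists>F. finite F \<and> F \<subseteq> V ` verts G \<and> a \<otimes> idem_sum F = a"
  proof (induction rule: lspan.induct)
    case zero
    then show ?case
      by (intro exI[of _ "{}"]) simp
  next
    case (add x u \<mu> w y \<nu> c)
    then obtain F where F: "finite F" "F \<subseteq> V ` verts G" "x \<otimes> idem_sum F = x"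
      by blast
    have y: "y \<in> verts G"
      using add by auto
    define F' where "F' = insert (V y) F"
    have F': "finite F'" "F' \<subseteq> V ` verts G" "F \<subseteq> F'" "V y \<in> F'"
      using F y by (auto simp: F'_def)
    have Fc: "F \<subseteq> carrier R" "F' \<subseteq> carrier R"
      using F F' Sc by blast+
    note ic = idem_sum_closed[OF Fc(1)] idem_sum_closed[OF Fc(2)]
    note lc = lspan_closed[OF add(1)] lmon_closed[OF add(2,3)]
    have "x \<otimes> idem_sum F' = (x \<otimes> idem_sum F) \<otimes> idem_sum F'"
      using F by simp
    also have "\<dots> = x"
      using idem_sum_mult_subset(1)[OF orth F(1) F'(3,1,2)] F(3) m_assoc[OF lc(1) ic] by simp
    finally have "x \<otimes> idem_sum F' = x" .
    moreover have "lmon c \<mu> w \<nu> \<otimes> idem_sum F' = lmon c \<mu> w \<nu>"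
    proof -
      have "lmon c \<mu> w \<nu> \<otimes> idem_sum F' = (lmon c \<mu> w \<nu> \<otimes> V y) \<otimes> idem_sum F'"
        using add y by (simp add: lmon_scal)
      also have "\<dots> = lmon c \<mu> w \<nu> \<otimes> (V y \<otimes> idem_sum F')"
        using ic lc y by (simp add: m_assoc)
      also have "\<dots> = lmon c \<mu> w \<nu>"
        using idem_sum_mult_left[OF orth F'(1,2), of "V y"] y F' add by (simp add: lmon_scal)
      finally show ?thesis .
    qed
    ultimately have "(x \<oplus> lmon c \<mu> w \<nu>) \<otimes> idem_sum F' = x \<oplus> lmon c \<mu> w \<nu>"
      using ic lc by (simp add: l_distr)
    then show ?case
      using F' by blast
  qed
  then show thesis
    using that by blast
qed

end

section \<open>Reduction to a vertex\<close>

context leavitt_family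
begin

lemma lspan_mono:
  assumes "x \<in> lspan P" "\<And>\<mu> w \<nu>. P \<mu> w \<nu> \<Longrightarrow> Q \<mu> w \<nu>"
  shows "x \<in> lspan Q"
  using assms(1) by induction (auto intro: lspan.intros assms(2))

lemma carrier_lspan_bounded:
  assumes "x \<in> carrier R"
  obtains n where "x \<in> ghost_span n"
proof -
  have "\<exists>n. x \<in> ghost_span n"
    using carrier_lspan[OF assms]
  proof (induction rule: lspan.induct)
    case (add x u \<mu> w y \<nu> c)
    then obtain n where "x \<in> ghost_span n"
      by blast
    then have "x \<in> ghost_span (max n (length \<nu>))"
      by (rule lspan_mono) auto
    then have "x \<oplus> lmon c \<mu> w \<nu> \<in> ghost_span (max n (length \<nu>))"
      using add by (intro lspan.add) auto
    then show ?case ..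
  qed (auto intro: lspan.zero)
  then show thesis
    using that by blast
qed

lemma nonzero_corner_vertex:
  assumes I: "two_sided_ideal I R" and a: "a \<in> carrier R" "a \<notin> I"
  obtains u where "u \<in> verts G" "a \<otimes> V u \<notin> I"
proof -
  interpret nonunital_ring_ideal R I
    by unfold_locales (rule I)
  obtain F where F: "finite F" "F \<subseteq> V ` verts G" "a \<otimes> idem_sum F = a"
    using a(1) by (rule right_local_unit)
  have "a = (\<Oplus>s\<in>F. a \<otimes> s)"
    using F(2) a(1) by (subst F(3)[symmetric], intro finsum_mult_left) auto
  then have "\<exists>s\<in>F. a \<otimes> s \<notin> I"
    using a(2) finsum_mem_ideal[of F "\<lambda>s. a \<otimes> s"] by metis
  then show thesis
    using F(2) that by auto
qed

text \<open>
  If \<open>a \<notin> I\<close> then \<open>a u \<notin> I\<close> for some vertex \<open>u\<close>. If \<open>u\<close> is a sink, no ghost path starts at \<open>u\<close> and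
  \<open>a u\<close> is a sum of real paths. Otherwise \<open>u = \<Sum> e e\<^sup>*\<close>, so \<open>a e \<notin> I\<close> for one of the edges \<open>e\<close>, and
  multiplication by \<open>e\<close> shortens every nontrivial ghost path by one.
\<close>

lemma remove_ghosts:
  assumes I: "two_sided_ideal I R" and "a \<in> ghost_span n" "a \<notin> I"
  shows "\<exists>y\<in>carrier R. \<exists>w\<in>verts G. a \<otimes> y \<notin> I \<and> a \<otimes> y \<in> path_span w"
  using assms(2,3)
proof (induction n arbitrary: a)
  case (0 a)
  have a: "a \<in> carrier R"
    using 0(1) by (rule lspan_closed)
  obtain u where u: "u \<in> verts G" "a \<otimes> V u \<notin> I"
    using I a 0(2) by (rule nonzero_corner_vertex)
  have "a \<otimes> V u \<in> path_span u"
  proof (rule lspan_map[OF 0(1)])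
    fix x \<mu> w y \<nu> c assume "awalk x \<mu> w" "awalk y \<nu> w" "length \<nu> \<le> 0"
    then show "lmon c \<mu> w \<nu> \<otimes> V u \<in> path_span u"
      using u(1) by (auto simp: lmon_scal lspan.zero awalk_simps intro!: lspan_lmon)
  qed (use u in \<open>auto simp: l_distr\<close>)
  then show ?case
    using u by (intro bexI[of _ "V u"] bexI[of _ u]) auto
next
  case (Suc n a)
  interpret nonunital_ring_ideal R I
    by unfold_locales (rule I)
  have a: "a \<in> carrier R"
    using Suc.prems(1) by (rule lspan_closed)
  obtain u where u: "u \<in> verts G" "a \<otimes> V u \<notin> I"
    using I a Suc.prems(2) by (rule nonzero_corner_vertex)
  show ?case
  proof (cases "out_arcs G u = {}")
    case True
    have "a \<otimes> V u \<in> path_span u"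
    proof (rule lspan_map[OF Suc.prems(1)])
      fix x \<mu> w y \<nu> c assume *: "awalk x \<mu> w" "awalk y \<nu> w"
      show "lmon c \<mu> w \<nu> \<otimes> V u \<in> path_span u"
      proof (cases "u = y")
        case uy: True
        then have "\<nu> = []"
          using True * by (cases \<nu>) (auto simp: awalk_simps out_arcs_def)
        then show ?thesis
          using u(1) * uy by (auto simp: lmon_scal awalk_simps intro!: lspan_lmon)
      qed (use u(1) * in \<open>simp add: lmon_scal lspan.zero\<close>)
    qed (use u in \<open>auto simp: l_distr\<close>)
    then show ?thesis
      using u by (intro bexI[of _ "V u"] bexI[of _ u]) auto
  next
    case False
    have arcs: "e \<in> arcs G" if "e \<in> out_arcs G u" for e
      using that by (simp add: out_arcs_def)
    have "a \<otimes> V u = (\<Oplus>e\<in>out_arcs G u. a \<otimes> (E e \<otimes> Gh e))"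
      unfolding vertex_sum[OF u(1) False] using a arcs by (intro finsum_mult_left) auto
    then have "\<exists>e\<in>out_arcs G u. a \<otimes> (E e \<otimes> Gh e) \<notin> I"
      using u(2) finsum_mem_ideal[of "out_arcs G u" "\<lambda>e. a \<otimes> (E e \<otimes> Gh e)"] by metis
    then obtain e where e: "e \<in> arcs G" "a \<otimes> (E e \<otimes> Gh e) \<notin> I"
      using arcs by blast
    then have nz: "a \<otimes> E e \<notin> I"
      using a ideal_mult_right[of "a \<otimes> E e" "Gh e"] by (auto simp: m_assoc)
    have "a \<otimes> E e \<in> ghost_span n"
    proof (rule lspan_map[OF Suc.prems(1)])
      fix x \<mu> w y \<nu> c assume *: "awalk x \<mu> w" "awalk y \<nu> w" "length \<nu> \<le> Suc n"
      show "lmon c \<mu> w \<nu> \<otimes> E e \<in> ghost_span n"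
      proof (cases \<nu>)
        case Nil
        show ?thesis
        proof (cases "w = tail G e")
          case True
          then have "awalk x (\<mu> @ [e]) (head G e)" "awalk (head G e) [] (head G e)"
            using * e by (auto simp: awalk_simps)
          then show ?thesis
            using lmon_E_Nil[OF e(1) *(1)] Nil True by (simp add: lspan_lmon)
        qed (use lmon_E_Nil[OF e(1) *(1)] Nil in \<open>simp add: lspan.zero\<close>)
      next
        case (Cons f \<nu>')
        then have "awalk (head G f) \<nu>' w" "length \<nu>' \<le> n"
          using * by (auto simp: awalk_simps)
        then show ?thesis
          using lmon_E_Cons[OF e(1) *(1), of y f \<nu>' c] * Cons lspan_lmon[OF *(1), of "head G f" \<nu>' "\<lambda>_ _ \<nu>. length \<nu> \<le> n"]
          by (auto simp: lspan.zero)
      qed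
    qed (use e in \<open>auto simp: l_distr\<close>)
    then obtain y w where "y \<in> carrier R" "w \<in> verts G" "a \<otimes> E e \<otimes> y \<notin> I"
        "a \<otimes> E e \<otimes> y \<in> path_span w"
      using Suc.IH[OF _ nz] by blast
    then show ?thesis
      using a e by (intro bexI[of _ "E e \<otimes> y"] bexI[of _ w]) (auto simp: m_assoc)
  qed
qed

lemma path_sum_representation:
  assumes "b \<in> path_span w"
  shows "\<exists>A c. finite A \<and> (\<forall>\<mu>\<in>A. \<exists>u. awalk u \<mu> w) \<and> b = (\<Oplus>\<mu>\<in>A. lmon (c \<mu>) \<mu> w [])"
  using assms
proof (induction rule: lspan.induct)
  case zero
  then show ?case
    by (intro exI[of _ "{}"]) simp
next
  case (add x u \<mu> w' y \<nu> d)
  then obtain A c where A: "finite A" "\<forall>\<mu>\<in>A. \<exists>u. awalk u \<mu> w" "x = (\<Oplus>\<mu>\<in>A. lmon (c \<mu>) \<mu> w [])"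
    by blast
  have eq: "w' = w" "\<nu> = []" "awalk u \<mu> w"
    using add by auto
  have w: "awalk w [] w"
    using eq(3) by (auto simp: awalk_simps)
  define B where "B = A - {\<mu>}"
  define c' where "c' = c(\<mu> := if \<mu> \<in> A then c \<mu> + d else d)"
  have B: "finite B" "\<mu> \<notin> B" "\<forall>\<mu>\<in>B. \<exists>u. awalk u \<mu> w"
    using A by (auto simp: B_def)
  have fc: "lmon k \<rho> w [] \<in> carrier R" if "\<rho> \<in> B \<or> \<rho> = \<mu>" for k \<rho>
    using that B(3) eq(3) w by (meson lmon_closed)
  define s where "s = (\<Oplus>\<mu>\<in>B. lmon (c \<mu>) \<mu> w [])"
  have s: "s \<in> carrier R"
    unfolding s_def using fc by (intro finsum_closed) auto
  have c'B: "(\<Oplus>\<mu>\<in>B. lmon (c' \<mu>) \<mu> w []) = s"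
    unfolding s_def using B(2) fc by (intro finsum_cong') (auto simp: c'_def)
  have "(\<Oplus>\<rho>\<in>insert \<mu> B. lmon (c' \<rho>) \<rho> w []) = lmon (c' \<mu>) \<mu> w [] \<oplus> s"
    using B fc by (subst finsum_insert) (auto simp: c'B)
  also have "\<dots> = x \<oplus> lmon d \<mu> w []"
  proof (cases "\<mu> \<in> A")
    case True
    then have "A = insert \<mu> B"
      by (auto simp: B_def)
    then have "x = lmon (c \<mu>) \<mu> w [] \<oplus> s"
      using A(3) B fc by (auto simp: s_def)
    moreover have "lmon (c' \<mu>) \<mu> w [] = lmon (c \<mu>) \<mu> w [] \<oplus> lmon d \<mu> w []"
      using True lmon_add[OF eq(3) w] by (simp add: c'_def)
    ultimately show ?thesis
      using fc s by (simp add: a_ac)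
  next
    case False
    then have "A = B"
      by (auto simp: B_def)
    then show ?thesis
      using A(3) False s fc by (simp add: c'_def s_def a_comm)
  qed
  finally have "x \<oplus> lmon d \<mu> w [] = (\<Oplus>\<rho>\<in>insert \<mu> B. lmon (c' \<rho>) \<rho> w [])"
    by simp
  then show ?case
    using B eq by (intro exI[of _ "insert \<mu> B"] exI[of _ c']) auto
qed

lemma nonzero_path_sum_representation:
  assumes "b \<in> path_span w" "b \<noteq> \<zero>"
  shows "\<exists>A c. finite A \<and> A \<noteq> {} \<and> (\<forall>\<mu>\<in>A. (\<exists>u. awalk u \<mu> w) \<and> c \<mu> \<noteq> 0) \<and>
    b = (\<Oplus>\<mu>\<in>A. lmon (c \<mu>) \<mu> w [])"
proof -
  obtain A c where A: "finite A" "\<forall>\<mu>\<in>A. \<exists>u. awalk u \<mu> w" "b = (\<Oplus>\<mu>\<in>A. lmon (c \<mu>) \<mu> w [])"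
    using path_sum_representation[OF assms(1)] by blast
  have w: "awalk w [] w" if "awalk u \<mu> w" for u \<mu>
    using that by (auto simp: awalk_simps)
  have cl: "lmon k \<mu> w [] \<in> carrier R" if "\<mu> \<in> A" for k \<mu>
    using that A(2) w by (meson lmon_closed)
  define A' where "A' = {\<mu> \<in> A. c \<mu> \<noteq> 0}"
  have "(\<Oplus>\<mu>\<in>A'. lmon (c \<mu>) \<mu> w []) = (\<Oplus>\<mu>\<in>A. lmon (c \<mu>) \<mu> w [])"
  proof (rule add.finprod_mono_neutral_cong_left)
    fix \<mu> assume "\<mu> \<in> A - A'"
    then obtain u where "awalk u \<mu> w" "c \<mu> = 0"
      using A(2) by (auto simp: A'_def)
    then show "lmon (c \<mu>) \<mu> w [] = \<zero>"
      using lmon_zero[OF _ w] by simp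
  qed (use A cl in \<open>auto simp: A'_def\<close>)
  moreover from this have "A' \<noteq> {}"
    using A(3) assms(2) by auto
  ultimately show ?thesis
    using A by (intro exI[of _ A'] exI[of _ c]) (auto simp: A'_def)
qed

text \<open>
  Sums of multiples of nontrivial closed paths at \<open>w\<close>. The index counts the summands and serves as
  induction measure; paths may repeat.
\<close>

inductive closed_path_sum :: "'v \<Rightarrow> nat \<Rightarrow> 'r \<Rightarrow> bool" for w :: 'v where
  zero: "closed_path_sum w 0 \<zero>"
| add: "\<lbrakk>closed_path_sum w n x; awalk w \<gamma> w; \<gamma> \<noteq> []\<rbrakk> \<Longrightarrow>
    closed_path_sum w (Suc n) (x \<oplus> lmon c \<gamma> w [])"

lemma closed_path_sum_closed: "closed_path_sum w n x \<Longrightarrow> x \<in> carrier R"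
proof (induction rule: closed_path_sum.induct)
  case (add n x \<gamma> c)
  have "awalk w [] w"
    using add by (auto simp: awalk_simps)
  then show ?case
    using add by auto
qed simp

lemma conjugate_closed_path:
  assumes \<alpha>: "awalk w \<alpha> w" and \<gamma>: "awalk w \<gamma> w" "\<gamma> \<noteq> []"
  shows "lmon 1 [] w \<alpha> \<otimes> lmon c \<gamma> w [] \<otimes> lmon 1 \<alpha> w [] = \<zero> \<or>
    (\<exists>\<delta>. \<gamma> @ \<alpha> = \<alpha> @ \<delta> \<and> \<delta> \<noteq> [] \<and> awalk w \<delta> w \<and>
      lmon 1 [] w \<alpha> \<otimes> lmon c \<gamma> w [] \<otimes> lmon 1 \<alpha> w [] = lmon c \<delta> w [])"
proof -
  have w: "awalk w [] w"
    using \<alpha> by (auto simp: awalk_simps)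
  have ga: "awalk w (\<gamma> @ \<alpha>) w"
    using \<alpha> \<gamma> by (auto intro: awalk_appendI)
  have eq: "lmon 1 [] w \<alpha> \<otimes> lmon c \<gamma> w [] \<otimes> lmon 1 \<alpha> w [] = lmon 1 [] w \<alpha> \<otimes> lmon c (\<gamma> @ \<alpha>) w []"
    using lmon_mult_path[OF \<gamma>(1) \<alpha>, of c 1] lmon_closed[OF w \<alpha>] lmon_closed[OF \<gamma>(1) w]
      lmon_closed[OF \<alpha> w] by (simp add: m_assoc)
  show ?thesis
  proof (cases "prefix \<alpha> (\<gamma> @ \<alpha>)")
    case True
    then obtain \<delta> where \<delta>: "\<gamma> @ \<alpha> = \<alpha> @ \<delta>"
      by (auto simp: prefix_def)
    have "length (\<gamma> @ \<alpha>) = length (\<alpha> @ \<delta>)"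
      by (simp only: \<delta>)
    then have "\<delta> \<noteq> []"
      using \<gamma>(2) by auto
    moreover have "awalk w \<delta> w"
    proof -
      have "awalk w (\<alpha> @ \<delta>) w"
        using ga \<delta> by metis
      then show ?thesis
        using awlast_of_awalk[OF \<alpha>] by simp
    qed
    ultimately show ?thesis
      unfolding eq \<delta> using ghost_mult_path[OF \<alpha> \<open>awalk w \<delta> w\<close>, of 1 c] by auto
  next
    case False
    moreover have "\<not> prefix (\<gamma> @ \<alpha>) \<alpha>"
      using \<gamma>(2) by (auto dest: prefix_length_le)
    ultimately show ?thesis
      unfolding eq using ghost_mult_path_incomparable[OF \<alpha> ga] by blast
  qed
qed

lemma conjugate_closed_path_sum:
  assumes "closed_path_sum w n x" "awalk w \<alpha> w"
  shows "\<exists>m\<le>n. closed_path_sum w m (lmon 1 [] w \<alpha> \<otimes> x \<otimes> lmon 1 \<alpha> w [])"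
  using assms(1)
proof (induction rule: closed_path_sum.induct)
  case zero
  have "awalk w [] w"
    using assms by (auto simp: awalk_simps)
  then show ?case
    using assms(2) closed_path_sum.zero by auto
next
  case (add n x \<gamma> c)
  have w: "awalk w [] w"
    using assms by (auto simp: awalk_simps)
  let ?c = "\<lambda>x. lmon 1 [] w \<alpha> \<otimes> x \<otimes> lmon 1 \<alpha> w []"
  obtain m where m: "m \<le> n" "closed_path_sum w m (?c x)"
    using add by blast
  have eq: "?c (x \<oplus> lmon c \<gamma> w []) = ?c x \<oplus> ?c (lmon c \<gamma> w [])"
    using closed_path_sum_closed[OF add(1)] lmon_closed[OF w assms(2)] lmon_closed[OF assms(2) w]
      lmon_closed[OF add(2) w] by (simp add: l_distr r_distr)
  from conjugate_closed_path[OF assms(2) add(2,3), of c] show ?case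
  proof (elim disjE exE conjE)
    assume "?c (lmon c \<gamma> w []) = \<zero>"
    then show ?thesis
      unfolding eq using m closed_path_sum_closed[OF m(2)] by (intro exI[of _ m]) auto
  next
    fix \<delta> assume "\<delta> \<noteq> []" "awalk w \<delta> w" "?c (lmon c \<gamma> w []) = lmon c \<delta> w []"
    then show ?thesis
      unfolding eq using m closed_path_sum.add[OF m(2)] by (intro exI[of _ "Suc m"]) auto
  qed
qed

text \<open>
  Conjugation by a closed path \<open>\<eta>\<close> fixes \<open>w\<close>, since \<open>\<eta>\<^sup>* w \<eta> = w\<close>, and sends each nontrivial closed
  path to another one or to zero. Of the two incomparable closed paths that Condition (K) provides, one
  kills a chosen summand, so the summands disappear one at a time.
\<close>

lemma vertex_below_closed_path_sum:
  assumes K: "condition_K G" and w: "w \<in> verts G" and "closed_path_sum w n x"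
  shows "below R (V w) (V w \<oplus> x)"
  using assms(3)
proof (induction n arbitrary: x rule: less_induct)
  case (less n)
  from less.prems show ?case
  proof cases
    case zero
    then show ?thesis
      using w V_idem by (auto intro: idempotent_below_self)
  next
    case (add m x' \<gamma> c)
    have ww: "awalk w [] w"
      using w by (simp add: awalk_simps)
    obtain \<alpha> \<beta> where \<alpha>\<beta>: "\<alpha> \<noteq> \<beta>" "closed_simple_path G w \<alpha>" "closed_simple_path G w \<beta>"
      using K add(4,5) by (rule condition_K_closed_walk)
    have "\<not> (prefix \<alpha> \<beta> \<or> prefix \<beta> \<alpha>)"
      using closed_simple_path_not_prefix \<alpha>\<beta> by blast
    then have "\<not> ((\<exists>\<delta>. \<gamma> @ \<alpha> = \<alpha> @ \<delta>) \<and> (\<exists>\<delta>. \<gamma> @ \<beta> = \<beta> @ \<delta>))"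
      using prefix_of_conjugation[OF add(5)] by blast
    then obtain \<eta> where \<eta>: "awalk w \<eta> w" "\<not> (\<exists>\<delta>. \<gamma> @ \<eta> = \<eta> @ \<delta>)"
      using \<alpha>\<beta> unfolding closed_simple_path_def by blast
    let ?c = "\<lambda>x. lmon 1 [] w \<eta> \<otimes> x \<otimes> lmon 1 \<eta> w []"
    note cl = lmon_closed[OF ww \<eta>(1)] lmon_closed[OF \<eta>(1) ww] lmon_closed[OF add(4) ww]
        closed_path_sum_closed[OF add(3)]
    have "?c (lmon c \<gamma> w []) = \<zero>"
      using conjugate_closed_path[OF \<eta>(1) add(4,5), of c] \<eta>(2) by blast
    moreover have "?c (V w) = V w"
      using ghost_mult_path[OF \<eta>(1) ww, of 1 1] w \<eta> ww
      by (simp add: lmon_scal lmon_Nil)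
    ultimately have "?c (V w \<oplus> x) = V w \<oplus> ?c x'"
      using add(2) cl w by (simp add: l_distr r_distr)
    then have 1: "below R (V w \<oplus> ?c x') (V w \<oplus> x)"
      using cl by (metis belowI)
    obtain k where "k \<le> m" "closed_path_sum w k (?c x')"
      using conjugate_closed_path_sum[OF add(3) \<eta>(1)] by blast
    then have "below R (V w) (V w \<oplus> ?c x')"
      using less.IH[of k] add(1) by simp
    then show ?thesis
      using 1 by (rule below_trans) (use add w cl in auto)
  qed
qed

lemma ghost_mult_longer_path:
  assumes "awalk x \<mu> w" "awalk y \<nu> w" "\<nu> \<noteq> \<mu>" "length \<mu> \<le> length \<nu>"
  shows "lmon c [] w \<mu> \<otimes> lmon d \<nu> w [] = \<zero> \<or>
    (\<exists>\<delta>. \<delta> \<noteq> [] \<and> awalk w \<delta> w \<and> lmon c [] w \<mu> \<otimes> lmon d \<nu> w [] = lmon (c * d) \<delta> w [])"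
proof -
  have "\<not> prefix \<nu> \<mu>"
    using assms(3,4) by (auto simp: prefix_def)
  show ?thesis
  proof (cases "x = y \<and> prefix \<mu> \<nu>")
    case True
    then obtain \<delta> where \<delta>: "\<nu> = \<mu> @ \<delta>" "\<delta> \<noteq> []"
      using assms(3) by (auto simp: prefix_def)
    have "awalk w \<delta> w"
      using assms(2) True \<delta> awlast_of_awalk[OF assms(1)] by simp
    then show ?thesis
      using \<delta> ghost_mult_path[OF assms(1) \<open>awalk w \<delta> w\<close>] by blast
  next
    case False
    then show ?thesis
      using ghost_mult_path_source[OF assms(1,2)]
        ghost_mult_path_incomparable[OF assms(1,2) _ \<open>\<not> prefix \<nu> \<mu>\<close>] by blast
  qed
qed

text \<open>
  After the ghost paths are removed, a sum of distinct paths that end in a common vertex \<open>w\<close> remains.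
  Multiplying it by the inverse of the coefficient and by the ghost of a shortest of these paths turns it
  into \<open>w\<close> plus closed paths at \<open>w\<close>. The conclusion is an equation in the ring itself and not merely
  modulo \<open>I\<close>; the ideal only serves to choose \<open>w\<close>.
\<close>

theorem reduction_to_vertex:
  assumes K: "condition_K G" and I: "two_sided_ideal I R" and a: "a \<in> carrier R" "a \<notin> I"
  obtains w where "w \<in> verts G" "V w \<notin> I" "below R (V w) a"
proof -
  interpret nonunital_ring_ideal R I
    by unfold_locales (rule I)
  obtain n where "a \<in> ghost_span n"
    using a(1) by (rule carrier_lspan_bounded)
  then obtain y w where y: "y \<in> carrier R" "w \<in> verts G" "a \<otimes> y \<notin> I"
      "a \<otimes> y \<in> path_span w"
    using remove_ghosts[OF I _ a(2)] by blast
  define b where "b = a \<otimes> y"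
  have b: "b \<in> carrier R" "b \<noteq> \<zero>"
    using y a by (auto simp: b_def)
  have w: "awalk w [] w"
    using y by (simp add: awalk_simps)
  obtain A c where A: "finite A" "A \<noteq> {}" "\<And>\<mu>. \<mu> \<in> A \<Longrightarrow> \<exists>u. awalk u \<mu> w"
    "\<And>\<mu>. \<mu> \<in> A \<Longrightarrow> c \<mu> \<noteq> 0" "b = (\<Oplus>\<mu>\<in>A. lmon (c \<mu>) \<mu> w [])"
    using nonzero_path_sum_representation[OF y(4)[folded b_def] b(2)] by blast
  have lc: "lmon k \<mu> w [] \<in> carrier R" if "\<mu> \<in> A" for k \<mu>
    using A(3)[OF that] w by auto
  have "b \<otimes> V w = (\<Oplus>\<mu>\<in>A. lmon (c \<mu>) \<mu> w [] \<otimes> V w)"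
    unfolding A(5) using lc y(2) by (intro finsum_mult_right) auto
  also have "\<dots> = b"
    unfolding A(5)
  proof (intro finsum_cong')
    fix \<mu> assume "\<mu> \<in> A"
    then obtain u where "awalk u \<mu> w"
      using A(3) by blast
    then show "lmon (c \<mu>) \<mu> w [] \<otimes> V w = lmon (c \<mu>) \<mu> w []"
      using lmon_scal[OF y(2) _ w, of u \<mu> "c \<mu>" 1] by simp
  qed (use lc in auto)
  finally have "V w \<notin> I"
    using y(3) b ideal_mult_left[of "V w" b] by (auto simp: b_def)
  obtain \<mu>0 where \<mu>0: "\<mu>0 \<in> A" "\<And>\<mu>. \<mu> \<in> A \<Longrightarrow> length \<mu>0 \<le> length \<mu>"
  proof -
    obtain \<mu> where "\<mu> \<in> A"
      using A(2) by blast
    from arg_min_nat_lemma[of "\<lambda>\<mu>. \<mu> \<in> A", OF this, of length] show thesis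
      using that by blast
  qed
  obtain x0 where x0: "awalk x0 \<mu>0 w"
    using A(3) \<mu>0 by blast
  define z where "z = lmon (inverse (c \<mu>0)) [] w \<mu>0"
  have z: "z \<in> carrier R"
    using x0 w by (auto simp: z_def)
  have "\<exists>n. closed_path_sum w n (\<Oplus>\<mu>\<in>B. z \<otimes> lmon (c \<mu>) \<mu> w [])" if "finite B" "B \<subseteq> A - {\<mu>0}" for B
    using that
  proof (induction B rule: finite_induct)
    case empty
    show ?case
      by (auto intro: closed_path_sum.zero)
  next
    case (insert \<mu> B)
    then obtain n where n: "closed_path_sum w n (\<Oplus>\<mu>\<in>B. z \<otimes> lmon (c \<mu>) \<mu> w [])"
      by blast
    have cl: "z \<otimes> lmon (c \<rho>) \<rho> w [] \<in> carrier R" if "\<rho> \<in> insert \<mu> B" for \<rho>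
      using that insert.prems lc z by auto
    have eq: "(\<Oplus>\<mu>\<in>insert \<mu> B. z \<otimes> lmon (c \<mu>) \<mu> w [])
        = (\<Oplus>\<mu>\<in>B. z \<otimes> lmon (c \<mu>) \<mu> w []) \<oplus> z \<otimes> lmon (c \<mu>) \<mu> w []"
      using insert.hyps cl by (subst finsum_insert) (auto simp: a_comm)
    obtain u where u: "awalk u \<mu> w"
      using A(3) insert.prems by blast
    have "\<mu> \<noteq> \<mu>0" "length \<mu>0 \<le> length \<mu>"
      using insert.prems \<mu>0(2) by auto
    from ghost_mult_longer_path[OF x0 u this, of "inverse (c \<mu>0)" "c \<mu>", folded z_def]
    show ?case
    proof (elim disjE exE conjE)
      assume "z \<otimes> lmon (c \<mu>) \<mu> w [] = \<zero>"
      then show ?thesis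
        using n closed_path_sum_closed[OF n] eq by auto
    next
      fix \<delta> assume "\<delta> \<noteq> []" "awalk w \<delta> w" "z \<otimes> lmon (c \<mu>) \<mu> w [] = lmon (inverse (c \<mu>0) * c \<mu>) \<delta> w []"
      then show ?thesis
        unfolding eq using closed_path_sum.add[OF n] by auto
    qed
  qed
  then obtain n where n: "closed_path_sum w n (\<Oplus>\<mu>\<in>A - {\<mu>0}. z \<otimes> lmon (c \<mu>) \<mu> w [])"
    using A(1) by blast
  have "z \<otimes> b = (\<Oplus>\<mu>\<in>A. z \<otimes> lmon (c \<mu>) \<mu> w [])"
    unfolding A(5) using z lc by (intro finsum_mult_left) auto
  also have "\<dots> = (\<Oplus>\<mu>\<in>insert \<mu>0 (A - {\<mu>0}). z \<otimes> lmon (c \<mu>) \<mu> w [])"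
    using \<mu>0(1) by (simp add: insert_absorb)
  also have "\<dots> = z \<otimes> lmon (c \<mu>0) \<mu>0 w [] \<oplus> (\<Oplus>\<mu>\<in>A - {\<mu>0}. z \<otimes> lmon (c \<mu>) \<mu> w [])"
    using A(1) z lc \<mu>0(1) by (intro finsum_insert) auto
  also have "z \<otimes> lmon (c \<mu>0) \<mu>0 w [] = V w"
    using ghost_mult_path[OF x0 w, of "inverse (c \<mu>0)" "c \<mu>0"] A(4)[OF \<mu>0(1)] by (simp add: z_def lmon_Nil)
  finally have "below R (V w) (z \<otimes> b)"
    using vertex_below_closed_path_sum[OF K y(2) n] by simp
  then obtain p r where "p \<in> carrier R" "r \<in> carrier R" "V w = p \<otimes> (z \<otimes> b) \<otimes> r"
    by (rule belowE)
  then have "below R (V w) a"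
    using z y a by (intro belowI[of "p \<otimes> z" "y \<otimes> r"]) (auto simp: b_def m_assoc)
  with y(2) \<open>V w \<notin> I\<close> show thesis
    by (rule that)
qed

section \<open>Properly infinite vertices\<close>

text \<open>
  The reduction theorem, applied to the ideal generated by the vertices below \<open>a\<close>, shows that this
  ideal contains \<open>a\<close>: a vertex outside the ideal cannot be below \<open>a\<close>.
\<close>

lemma properly_purely_infinite_of_vertices:
  assumes K: "condition_K G" and pi: "\<And>v. v \<in> verts G \<Longrightarrow> properly_infinite R (V v)"
  shows "properly_purely_infinite R"
  unfolding properly_purely_infinite_def
proof (intro ballI impI)
  fix a assume a: "a \<in> carrier R" "a \<noteq> \<zero>"
  define S where "S = V ` {v \<in> verts G. below R (V v) a}"
  have S: "orthogonal_idempotents S" "\<And>s. s \<in> S \<Longrightarrow> properly_infinite R s"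
      "\<And>s. s \<in> S \<Longrightarrow> below R s a"
    using pi orthogonal_vertices_subset[of "{v \<in> verts G. below R (V v) a}"] by (auto simp: S_def)
  have "a \<in> idempotents_ideal S"
  proof (rule ccontr)
    assume "a \<notin> idempotents_ideal S"
    then obtain w where "w \<in> verts G" "V w \<notin> idempotents_ideal S" "below R (V w) a"
      using reduction_to_vertex[OF K two_sided_idempotents_ideal[OF S(1,2)] a(1)] by metis
    then show False
      using idempotents_ideal_superset[OF S(1)] by (auto simp: S_def)
  qed
  then show "properly_infinite R a"
    using properly_infinite_of_mem_idempotents_ideal[of S a] S a by blast
qed

lemma infinite_idempotent_below_quotient:
  assumes K: "condition_K G" and pi: "\<And>v. v \<in> verts G \<Longrightarrow> properly_infinite R (V v)"
    and I: "two_sided_ideal I R" and X: "X \<in> carrier (R Quot I)" "X \<noteq> \<zero>\<^bsub>R Quot I\<^esub>"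
  shows "\<exists>w. infinite_idempotent (R Quot I) w \<and> below (R Quot I) w X"
proof -
  interpret nonunital_ring_ideal R I
    by unfold_locales (rule I)
  interpret Q: nonunital_ring "R Quot I"
    by (rule nonunital_ring_quotient)
  obtain a where a: "a \<in> carrier R" "X = q a"
    using X(1) by (rule quotientE)
  then have "a \<notin> I"
    using X(2) by (simp add: q_eq_zero_iff)
  then obtain w where w: "w \<in> verts G" "V w \<notin> I" "below R (V w) a"
    using reduction_to_vertex[OF K I a(1)] by metis
  have "infinite_idempotent (R Quot I) (q (V w))"
    using w pi by (intro Q.infinite_of_properly_infinite properly_infinite_quotient)
      (auto simp: q_mult V_idem)
  then show ?thesis
    using below_quotient[OF w(3) a(1)] a(2) by blast
qed

lemma properly_infinite_of_closed_walks:
  assumes \<alpha>\<beta>: "awalk v \<alpha> v" "awalk v \<beta> v" "\<not> prefix \<alpha> \<beta>" "\<not> prefix \<beta> \<alpha>"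
    and nz: "V v \<noteq> \<zero>"
  shows "properly_infinite R (V v)"
proof -
  have v: "awalk v [] v" "v \<in> verts G"
    using assms by (auto simp: awalk_simps)
  show ?thesis
    by (rule properly_infiniteI[of "lmon 1 [] v \<alpha>" "lmon 1 [] v \<beta>" "lmon 1 \<alpha> v []" "lmon 1 \<beta> v []"])
      (use assms v ghost_mult_path[OF \<alpha>\<beta>(1) v(1), of 1 1] ghost_mult_path[OF \<alpha>\<beta>(2) v(1), of 1 1]
        ghost_mult_path_incomparable[OF \<alpha>\<beta>(1,2)] ghost_mult_path_incomparable[OF \<alpha>\<beta>(2,1)]
        in \<open>simp_all add: scal_lmon lmon_Nil\<close>)
qed

text \<open>
  If \<open>\<mu>\<close> is a path from \<open>v\<close> to \<open>w\<close> then \<open>w = \<mu>\<^sup>* v \<mu>\<close>.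
\<close>

lemma below_connects:
  assumes "connects G v w"
  shows "below R (V w) (V v)"
proof -
  obtain \<mu> where \<mu>: "awalk v \<mu> w"
    using assms by (auto simp: connects_def)
  have w: "awalk w [] w" "w \<in> verts G" "v \<in> verts G"
    using \<mu> by (auto simp: awalk_simps)
  show ?thesis
    using \<mu> w ghost_mult_path[OF \<mu> w(1), of 1 1]
    by (intro belowI[of "lmon 1 [] w \<mu>" "lmon 1 \<mu> w []"]) (simp_all add: lmon_scal lmon_Nil)
qed

lemma vertex_mem_ideal_of_heads:
  assumes I: "two_sided_ideal I R" and v: "v \<in> verts G" "out_arcs G v \<noteq> {}"
    and heads: "\<And>e. e \<in> out_arcs G v \<Longrightarrow> V (head G e) \<in> I"
  shows "V v \<in> I"
proof -
  interpret nonunital_ring_ideal R I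
    by unfold_locales (rule I)
  have "E e \<otimes> Gh e \<in> I" if e: "e \<in> out_arcs G v" for e
  proof -
    have "e \<in> arcs G"
      using e by (simp add: out_arcs_def)
    then have "E e \<otimes> V (head G e) \<otimes> Gh e \<in> I"
      using heads[OF e] by (intro ideal_mult_right ideal_mult_left) auto
    then show ?thesis
      using \<open>e \<in> arcs G\<close> by (simp add: E_range)
  qed
  then show ?thesis
    unfolding vertex_sum[OF v] by (rule finsum_mem_ideal)
qed

text \<open>
  Let \<open>S\<close> be the set of the vertices on closed walks that \<open>v\<close> reaches. If \<open>v\<close> were outside the
  ideal generated by \<open>S\<close>, a maximal tail containing \<open>v\<close> would avoid all vertices of this ideal,
  although \<open>v\<close> reaches a cycle in the tail, whose vertices belong to \<open>S\<close>.
\<close>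

lemma properly_infinite_vertex_of_condition_K:
  assumes K: "condition_K G"
    and cycles: "\<And>M v. \<lbrakk>maximal_tail G M; v \<in> M\<rbrakk> \<Longrightarrow> \<exists>p. cycle_in G M p \<and> connects_to_cycle G v p"
    and nz: "\<And>v. v \<in> verts G \<Longrightarrow> V v \<noteq> \<zero>" and v: "v \<in> verts G"
  shows "properly_infinite R (V v)"
proof -
  define W where "W = {w. connects G v w \<and> (\<exists>c. awalk w c w \<and> c \<noteq> [])}"
  define S where "S = V ` W"
  have W: "W \<subseteq> verts G"
    using connects_verts by (auto simp: W_def)
  have S: "orthogonal_idempotents S"
    using W unfolding S_def by (rule orthogonal_vertices_subset)
  have pi: "properly_infinite R s" if "s \<in> S" for s
  proof -
    obtain w c where w: "awalk w c w" "c \<noteq> []" "s = V w"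
      using \<open>s \<in> S\<close> by (auto simp: S_def W_def)
    obtain \<alpha> \<beta> where "\<alpha> \<noteq> \<beta>" "closed_simple_path G w \<alpha>" "closed_simple_path G w \<beta>"
      using K w(1,2) by (rule condition_K_closed_walk)
    then show ?thesis
      unfolding w(3) using closed_simple_path_not_prefix[of w \<alpha> \<beta>] closed_simple_path_not_prefix[of w \<beta> \<alpha>]
      by (intro properly_infinite_of_closed_walks[of w \<alpha> \<beta>] nz) (auto simp: closed_simple_path_def)
  qed
  have bel: "below R s (V v)" if "s \<in> S" for s
    using that by (auto simp: S_def W_def below_connects)
  let ?I = "idempotents_ideal S"
  have I: "two_sided_ideal ?I R"
    by (rule two_sided_idempotents_ideal[OF S pi])
  interpret nonunital_ring_ideal R ?I
    by unfold_locales (rule I)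
  have "V v \<in> ?I"
  proof (rule ccontr)
    assume "V v \<notin> ?I"
    define H where "H = {u \<in> verts G. V u \<in> ?I}"
    have "hereditary G H"
      unfolding hereditary_def
    proof (intro conjI allI impI)
      fix u w assume uw: "connects G u w \<and> u \<in> H"
      then obtain x y where xy: "x \<in> carrier R" "y \<in> carrier R" "V w = x \<otimes> V u \<otimes> y"
        using below_connects unfolding below_def by blast
      have "V w \<in> ?I"
        unfolding xy(3) using uw xy(1,2) by (intro ideal_mult_right[OF ideal_mult_left]) (auto simp: H_def)
      then show "w \<in> H"
        using uw connects_verts by (auto simp: H_def)
    qed (auto simp: H_def)
    moreover have "saturated G H"
      unfolding saturated_def
    proof (intro ballI impI)
      fix u assume u: "u \<in> verts G" "out_arcs G u \<noteq> {} \<and> head G ` out_arcs G u \<subseteq> H"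
      then have "V u \<in> ?I"
        by (rule_tac vertex_mem_ideal_of_heads[OF I]) (unfold H_def, blast+)
      then show "u \<in> H"
        using u by (simp add: H_def)
    qed
    ultimately obtain M where M: "maximal_tail G M" "v \<in> M" "M \<inter> H = {}"
      using maximal_tail_avoiding[of H v] v \<open>V v \<notin> ?I\<close> by (auto simp: H_def)
    then obtain p w where p: "cycle_in G M p" "w \<in> path_verts G p" "connects G v w"
      using cycles[OF M(1,2)] unfolding connects_to_cycle_def by blast
    then have "w \<in> W" "w \<in> M"
      using cycle_closed_walk by (auto simp: W_def cycle_in_def)
    then have "w \<in> H"
      using W idempotents_ideal_superset[OF S] by (auto simp: H_def S_def)
    then show False
      using M(3) \<open>w \<in> M\<close> by blast
  qed
  then show ?thesis
    using properly_infinite_of_mem_idempotents_ideal[of S "V v"] S pi bel nz[OF v] scal_closed[OF v]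
    by blast
qed

subsection \<open>Purely infinite Leavitt families\<close>

text \<open>
  With \<open>y\<close> the head of \<open>e\<close>, the idempotent \<open>b = y + e e\<^sup>*\<close> is the sum of two orthogonal copies of
  \<open>y\<close>. From \<open>b = x y z\<close> one reads off witnesses for \<open>y\<close>: multiply by \<open>y\<close> or by \<open>e\<^sup>*\<close> on the left and
  by \<open>y\<close> or by \<open>e\<close> on the right.
\<close>

lemma properly_infinite_of_incoming_edge:
  assumes R: "purely_infinite R" and e: "e \<in> arcs G" "tail G e \<noteq> head G e"
    and nz: "V (head G e) \<noteq> \<zero>"
  shows "properly_infinite R (V (head G e))"
proof -
  define y where "y = head G e"
  have y: "y \<in> verts G" "V y \<noteq> \<zero>" "V y \<otimes> V y = V y"
    using e nz by (auto simp: y_def V_idem)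
  have E: "E e \<otimes> V y = E e" "V y \<otimes> Gh e = Gh e" "Gh e \<otimes> E e = V y" "V y \<otimes> E e = \<zero>" "Gh e \<otimes> V y = \<zero>"
    using e by (auto simp: y_def E_range Gh_range Gh_E scal_E Gh_scal)
  have c: "E e \<in> carrier R" "Gh e \<in> carrier R" "V y \<in> carrier R"
    using e y by auto
  define b where "b = V y \<oplus> E e \<otimes> Gh e"
  have "b = (\<Oplus>i\<in>{..<2::nat}. (if i = 0 then V y else E e) \<otimes> V y \<otimes> (if i = 0 then V y else Gh e))"
    using c E y by (simp add: b_def numeral_2_eq_2 lessThan_Suc a_comm)
  then have "b \<in> sandwich_sums R (V y)"
    unfolding sandwich_sums_def using c
    by (intro CollectI exI[of _ "2::nat"] exI[of _ "\<lambda>i. if i = 0 then V y else E e"]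
        exI[of _ "\<lambda>i. if i = 0 then V y else Gh e"]) auto
  then obtain x z where xz: "x \<in> carrier R" "z \<in> carrier R" "b = x \<otimes> V y \<otimes> z"
    using R c unfolding purely_infinite_def by blast
  then have "x \<otimes> (V y \<otimes> z) = b"
    using c by (simp add: m_assoc)
  note h = mult_cancel_assoc3[OF this xz(1) c(3) xz(2)]
  note Ea = E y(3) mult_cancel_assoc[OF E(1) c(1,3)] mult_cancel_assoc[OF E(2) c(3,2)]
    mult_cancel_assoc[OF E(3) c(2,1)] mult_cancel_assoc[OF E(4) c(3,1)] mult_cancel_assoc[OF E(5) c(2,3)]
    mult_cancel_assoc[OF y(3) c(3,3)]
  have bc: "b \<otimes> V y = V y" "b \<otimes> E e = E e"
    using c by (simp_all add: b_def l_distr m_assoc Ea)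
  have "properly_infinite R (V y)"
    by (rule properly_infiniteI[of "V y \<otimes> x" "Gh e \<otimes> x" "z \<otimes> V y" "z \<otimes> E e"])
      (use c xz(1,2) y(2) in \<open>simp_all add: m_assoc h bc Ea\<close>)
  then show ?thesis
    by (simp add: y_def)
qed

lemma properly_infinite_of_outgoing_edges:
  assumes R: "purely_infinite R" and nz: "\<And>v. v \<in> verts G \<Longrightarrow> V v \<noteq> \<zero>"
    and y: "y \<in> verts G" "out_arcs G y \<noteq> {}" "\<And>e. e \<in> out_arcs G y \<Longrightarrow> head G e \<noteq> y"
  shows "properly_infinite R (V y)"
proof -
  define S where "S = V ` head G ` out_arcs G y"
  have arcs: "e \<in> arcs G" "tail G e = y" if "e \<in> out_arcs G y" for e
    using that by (auto simp: out_arcs_def)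
  have S: "orthogonal_idempotents S"
    unfolding S_def by (rule orthogonal_vertices_subset) (auto dest: arcs)
  have pi: "properly_infinite R s" if "s \<in> S" for s
  proof -
    obtain e where e: "e \<in> out_arcs G y" "s = V (head G e)"
      using \<open>s \<in> S\<close> unfolding S_def by blast
    show ?thesis
      unfolding e(2) by (rule properly_infinite_of_incoming_edge[OF R])
        (use arcs[OF e(1)] y(3)[OF e(1)] nz in auto)
  qed
  have bel: "below R s (V y)" if "s \<in> S" for s
  proof -
    obtain e where e: "e \<in> out_arcs G y" "s = V (head G e)"
      using \<open>s \<in> S\<close> unfolding S_def by blast
    then show ?thesis
      using below_connects[OF connects_arc] arcs[OF e(1)] by auto
  qed
  have "V y \<in> idempotents_ideal S"
  proof (rule vertex_mem_ideal_of_heads[OF _ y(1,2)])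
    show "two_sided_ideal (idempotents_ideal S) R"
      by (rule two_sided_idempotents_ideal[OF S pi])
    show "V (head G e) \<in> idempotents_ideal S" if "e \<in> out_arcs G y" for e
      using idempotents_ideal_superset[OF S] that unfolding S_def by blast
  qed
  then show ?thesis
    using properly_infinite_of_mem_idempotents_ideal[of S "V y"] S pi bel nz[OF y(1)] scal_closed[OF y(1)]
    by blast
qed

lemma properly_infinite_of_two_loops:
  assumes e: "e \<in> arcs G" "f \<in> arcs G" "e \<noteq> f" "tail G e = y" "head G e = y" "tail G f = y" "head G f = y"
    and nz: "V y \<noteq> \<zero>"
  shows "properly_infinite R (V y)"
  by (rule properly_infinite_of_closed_walks[of y "[e]" "[f]"]) (use assms in \<open>auto simp: awalk_simps\<close>)

end

section \<open>Representations without infinite idempotents\<close>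

context vector_space
begin

text \<open>
  Applying a power of \<open>X\<close> to a linear relation among the \<open>u n\<close> isolates its last term. So if \<open>u 0\<close>
  were nonzero, the \<open>u n\<close> would be infinitely many independent vectors in a finite-dimensional space.
\<close>

lemma shift_vanishes:
  assumes T: "finite T" "\<And>n. u n \<in> span T"
    and add: "\<And>a b. X (a + b) = X a + X b" and scale: "\<And>k a. X (scale k a) = scale k (X a)"
    and X: "\<And>n. X (u (Suc n)) = u n" "X (u 0) = 0"
  shows "u 0 = 0"
proof (rule ccontr)
  assume nz: "u 0 \<noteq> 0"
  have X0: "X 0 = 0"
    using scale[of 0 0] by simp
  have pow: "(X ^^ k) (a + b) = (X ^^ k) a + (X ^^ k) b" "(X ^^ k) (scale c a) = scale c ((X ^^ k) a)"
      "(X ^^ k) 0 = 0" for k a b c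
    by (induction k) (simp_all add: add scale X0)
  have down: "(X ^^ k) (u (k + n)) = u n" for k n
    by (induction k) (simp_all add: X(1) funpow_Suc_right del: funpow.simps(2))
  have kill: "(X ^^ n) (u k) = 0" if "k < n" for k n
  proof -
    have "X ^^ n = (X ^^ (n - Suc k)) \<circ> X \<circ> (X ^^ k)"
      using that funpow_add[of "n - Suc k" "Suc k" X] by (simp add: o_assoc)
    then show ?thesis
      using down[of k 0] by (simp add: X(2) pow)
  qed
  have notin: "u n \<notin> span (u ` {..<n})" for n
  proof
    assume "u n \<in> span (u ` {..<n})"
    moreover have "span (u ` {..<n}) \<subseteq> {z. (X ^^ n) z = 0}"
      by (rule span_minimal) (auto simp: kill subspace_def pow)
    ultimately show False
      using down[of n 0] nz by auto
  qed
  have "independent (u ` {..<n}) \<and> card (u ` {..<n}) = n" for n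
  proof (induction n)
    case (Suc n)
    then show ?case
      using notin[of n] span_superset[of "u ` {..<n}"]
      by (auto simp: lessThan_Suc independent_insert)
  qed (simp add: independent_empty)
  then show False
    using independent_span_bound[OF T(1), of "u ` {..<Suc (card T)}"] T(2) by auto
qed

end

interpretation fun_space: vector_space "\<lambda>k f x. (k::'k::field) * f x"
  by unfold_locales (auto simp: fun_eq_iff algebra_simps)

abbreviation fun_span :: "('x \<Rightarrow> 'k::field) set \<Rightarrow> ('x \<Rightarrow> 'k) set" where
  "fun_span \<equiv> fun_space.span"

lemma fun_span_zero: "(\<lambda>_. 0) \<in> fun_span T"
  using fun_space.span_zero[of T] by (simp add: zero_fun_def)

context leavitt_family
begin

lemma lmon_split:
  assumes "awalk u \<mu> w" "awalk x \<nu> w"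
  shows "lmon c \<mu> w \<nu> = lmon c \<mu> w [] \<otimes> lmon 1 [] w \<nu>"
proof -
  have w: "awalk w [] w" "w \<in> verts G"
    using assms by (auto simp: awalk_simps)
  have "lmon c [] w [] \<otimes> lmon 1 [] w \<nu> = lmon c [] w \<nu>"
    using scal_lmon[OF w(2,1) assms(2), of c 1] by (simp add: lmon_Nil)
  then show ?thesis
    using lmon_assoc_right[OF assms(1) w(1) lmon_closed[OF w(1) assms(2)]] by (simp add: foldr_E_lmon)
qed

lemma lmon_ghost_append:
  assumes "awalk x \<nu>' w'" "awalk w' \<nu> w"
  shows "lmon c [] w \<nu> \<otimes> lmon 1 [] w' \<nu>' = lmon c [] w (\<nu>' @ \<nu>)"
  using assms(1)
proof (induction \<nu>' arbitrary: x)
  case Nil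
  have "awalk w [] w" "w' \<in> verts G"
    using assms by (auto simp: awalk_simps)
  then show ?case
    using lmon_scal[OF _ \<open>awalk w [] w\<close> assms(2), of w' c 1] by (simp add: lmon_Nil)
next
  case (Cons e \<nu>')
  have c: "e \<in> arcs G" "awalk (head G e) \<nu>' w'" "awalk w' [] w'" "awalk w [] w"
    using Cons.prems assms(2) by (auto simp: awalk_simps)
  have "lmon c [] w \<nu> \<otimes> lmon 1 [] w' (e # \<nu>') = (lmon c [] w \<nu> \<otimes> lmon 1 [] w' \<nu>') \<otimes> Gh e"
    using c(1) lmon_closed[OF c(3,2)] lmon_closed[OF c(4) assms(2)] by (simp add: lmon_ghost_Cons m_assoc)
  then show ?case
    using Cons.IH[OF c(2)] by (simp add: lmon_ghost_Cons)
qed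

text \<open>
  The product \<open>\<nu>\<^sup>* \<mu>'\<close> in the middle is a path, a ghost path or zero.
\<close>

lemma lmon_mult_cases:
  assumes "awalk v \<mu> w" "awalk v \<nu> w" "awalk v \<mu>' w'" "awalk v \<nu>' w'"
  shows "lmon 1 \<mu> w \<nu> \<otimes> lmon 1 \<mu>' w' \<nu>' = \<zero> \<or>
    (\<exists>\<delta>. \<mu>' = \<nu> @ \<delta> \<and> awalk w \<delta> w' \<and> lmon 1 \<mu> w \<nu> \<otimes> lmon 1 \<mu>' w' \<nu>' = lmon 1 (\<mu> @ \<delta>) w' \<nu>') \<or>
    (\<exists>\<delta>. \<nu> = \<mu>' @ \<delta> \<and> awalk w' \<delta> w \<and> lmon 1 \<mu> w \<nu> \<otimes> lmon 1 \<mu>' w' \<nu>' = lmon 1 \<mu> w (\<nu>' @ \<delta>))"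
proof -
  have w: "awalk w [] w" "awalk w' [] w'" "w \<in> verts G" "w' \<in> verts G"
    using assms by (auto simp: awalk_simps)
  note cl = lmon_closed[OF assms(1) w(1)] lmon_closed[OF w(1) assms(2)] lmon_closed[OF assms(3) w(2)]
    lmon_closed[OF w(2) assms(4)]
  have eq: "lmon 1 \<mu> w \<nu> \<otimes> lmon 1 \<mu>' w' \<nu>'
      = lmon 1 \<mu> w [] \<otimes> ((lmon 1 [] w \<nu> \<otimes> lmon 1 \<mu>' w' []) \<otimes> lmon 1 [] w' \<nu>')"
    unfolding lmon_split[OF assms(1,2)] lmon_split[OF assms(3,4)] using cl by (simp add: m_assoc)
  consider "prefix \<nu> \<mu>'" | "prefix \<mu>' \<nu>" | "\<not> prefix \<nu> \<mu>'" "\<not> prefix \<mu>' \<nu>"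
    by blast
  then show ?thesis
  proof cases
    case 1
    then obtain \<delta> where \<delta>: "\<mu>' = \<nu> @ \<delta>"
      by (auto simp: prefix_def)
    have d: "awalk w \<delta> w'"
      using assms(3) \<delta> awlast_of_awalk[OF assms(2)] by simp
    have "lmon 1 [] w \<nu> \<otimes> lmon 1 \<mu>' w' [] = lmon 1 \<delta> w' []"
      unfolding \<delta> using ghost_mult_path[OF assms(2) d, of 1 1] by simp
    then have "lmon 1 \<mu> w \<nu> \<otimes> lmon 1 \<mu>' w' \<nu>' = (lmon 1 \<mu> w [] \<otimes> lmon 1 \<delta> w' []) \<otimes> lmon 1 [] w' \<nu>'"
      unfolding eq using cl lmon_closed[OF d w(2)] by (simp add: m_assoc)
    also have "\<dots> = lmon 1 (\<mu> @ \<delta>) w' \<nu>'"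
      using lmon_mult_path[OF assms(1) d, of 1 1] lmon_split[of v "\<mu> @ \<delta>" w' v \<nu>' 1] assms(1,4) d
        awalk_appendI[OF assms(1) d] by simp
    finally show ?thesis
      using \<delta> d by blast
  next
    case 2
    then obtain \<delta> where \<delta>: "\<nu> = \<mu>' @ \<delta>"
      by (auto simp: prefix_def)
    have d: "awalk w' \<delta> w"
      using assms(2) \<delta> awlast_of_awalk[OF assms(3)] by simp
    have "lmon 1 [] w \<nu> \<otimes> lmon 1 \<mu>' w' [] = lmon 1 [] w \<delta> \<otimes> (lmon 1 [] w' \<mu>' \<otimes> lmon 1 \<mu>' w' [])"
      using lmon_ghost_append[OF assms(3) d, of 1] \<delta> lmon_closed[OF w(1) d] lmon_closed[OF w(2) assms(3)] cl
      by (simp flip: m_assoc)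
    also have "\<dots> = lmon 1 [] w \<delta>"
      using ghost_mult_path[OF assms(3) w(2), of 1 1] lmon_scal[OF w(4,1) d, of 1 1] by (simp add: lmon_Nil)
    finally have "lmon 1 \<mu> w \<nu> \<otimes> lmon 1 \<mu>' w' \<nu>' = lmon 1 \<mu> w [] \<otimes> lmon 1 [] w (\<nu>' @ \<delta>)"
      unfolding eq using lmon_ghost_append[OF assms(4) d, of 1] by simp
    also have "\<dots> = lmon 1 \<mu> w (\<nu>' @ \<delta>)"
      using lmon_split[OF assms(1) awalk_appendI[OF assms(4) d], of 1] by simp
    finally show ?thesis
      using \<delta> d by blast
  next
    case 3
    then show ?thesis
      unfolding eq using ghost_mult_path_incomparable[OF assms(2,3) 3] cl by simp
  qed
qed

end

text \<open>
  The algebra acts from the right on functions on \<open>M \<times> \<nat>\<close>, where \<open>M\<close> is the complement of a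
  hereditary set. With \<open>m\<close> the number of edges from \<open>u\<close> into \<open>M\<close>, which are numbered by \<open>idx\<close>, the
  edge \<open>e\<close> from \<open>u\<close> to \<open>w\<close> identifies the fibre \<open>{w} \<times> \<nat>\<close> with the residue class
  of \<open>idx e\<close> modulo \<open>m\<close> in the fibre \<open>{u} \<times> \<nat>\<close>; so the fibre over \<open>u\<close> is the disjoint union
  of the images of its edges, as the relation \<open>u = \<Sum> e e\<^sup>*\<close> demands. Elements act contravariantly on
  functions, which is why \<open>\<psi>\<close> reverses products. Vertices outside \<open>M\<close> act as zero.
\<close>

locale leavitt_rep = leavitt_family R G scal E Gh
  for R :: "('r, 'm) ring_scheme" (structure) and G :: "('v, 'e) pre_digraph"
    and scal :: "'k::field \<Rightarrow> 'v \<Rightarrow> 'r" and E Gh +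
  fixes M :: "'v set" and idx :: "'e \<Rightarrow> nat"
    and \<psi> :: "'r \<Rightarrow> ('v \<times> nat \<Rightarrow> 'k) \<Rightarrow> ('v \<times> nat \<Rightarrow> 'k)"
  assumes hereditary_M: "hereditary G (verts G - M)"
    and \<psi>_add: "\<lbrakk>x \<in> carrier R; y \<in> carrier R\<rbrakk> \<Longrightarrow> \<psi> (x \<oplus> y) g = \<psi> x g + \<psi> y g"
    and \<psi>_mult: "\<lbrakk>x \<in> carrier R; y \<in> carrier R\<rbrakk> \<Longrightarrow> \<psi> (x \<otimes> y) g = \<psi> y (\<psi> x g)"
    and \<psi>_linear_add: "x \<in> carrier R \<Longrightarrow> \<psi> x (g + h) = \<psi> x g + \<psi> x h"
    and \<psi>_linear_scale: "x \<in> carrier R \<Longrightarrow> \<psi> x (\<lambda>z. k * g z) = (\<lambda>z. k * \<psi> x g z)"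
    and \<psi>_scal: "v \<in> verts G \<Longrightarrow>
      \<psi> (scal c v) g (w, n) = (if w = v \<and> v \<in> M then c * g (w, n) else 0)"
    and \<psi>_E: "e \<in> arcs G \<Longrightarrow> \<psi> (E e) g (w, n) =
      (if w = head G e \<and> w \<in> M
       then g (tail G e, card {f \<in> out_arcs G (tail G e). head G f \<in> M} * n + idx e) else 0)"
    and \<psi>_Gh: "e \<in> arcs G \<Longrightarrow> \<psi> (Gh e) g (w, n) =
      (if w = tail G e \<and> head G e \<in> M \<and> n mod card {f \<in> out_arcs G w. head G f \<in> M} = idx e
       then g (head G e, n div card {f \<in> out_arcs G w. head G f \<in> M}) else 0)"
    and idx_less: "\<lbrakk>e \<in> arcs G; head G e \<in> M\<rbrakk> \<Longrightarrow> idx e < card {f \<in> out_arcs G (tail G e). head G f \<in> M}"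
begin

lemma \<psi>_zero [simp]: "\<psi> \<zero> g = 0"
  using \<psi>_add[of \<zero> \<zero> g] by simp

lemma \<psi>_uminus: "x \<in> carrier R \<Longrightarrow> \<psi> (\<ominus> x) g = - \<psi> x g"
  using \<psi>_add[of x "\<ominus> x" g] by (simp add: r_neg eq_neg_iff_add_eq_0 add.commute)

lemma \<psi>_minus: "\<lbrakk>x \<in> carrier R; y \<in> carrier R\<rbrakk> \<Longrightarrow> \<psi> (x \<ominus> y) g = \<psi> x g - \<psi> y g"
  by (simp add: minus_eq \<psi>_add \<psi>_uminus)

lemma \<psi>_apply_zero [simp]: "x \<in> carrier R \<Longrightarrow> \<psi> x 0 = 0"
  using \<psi>_linear_add[of x 0 0] by simp

lemma \<psi>_apply_zero_fun: "x \<in> carrier R \<Longrightarrow> \<psi> x (\<lambda>_. 0) = (\<lambda>_. 0)"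
  using \<psi>_apply_zero[of x] by (simp add: zero_fun_def)

definition ker :: "'r set" where
  "ker = {x \<in> carrier R. \<forall>g. \<psi> x g = 0}"

lemma two_sided_ker: "two_sided_ideal ker R"
  by (rule two_sided_idealI) (auto simp: ker_def \<psi>_add \<psi>_uminus \<psi>_mult)

lemma kerI: "\<lbrakk>x \<in> carrier R; \<And>g. \<psi> x g = 0\<rbrakk> \<Longrightarrow> x \<in> ker"
  by (simp add: ker_def)

lemma kerD: "x \<in> ker \<Longrightarrow> \<psi> x g = 0"
  by (simp add: ker_def)

sublocale ker: nonunital_ring_ideal R ker
  by unfold_locales (rule two_sided_ker)

lemma coset_ker_eq_iff:
  "\<lbrakk>x \<in> carrier R; y \<in> carrier R\<rbrakk> \<Longrightarrow> ker.q x = ker.q y \<longleftrightarrow> \<psi> x = \<psi> y"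
proof -
  assume c: "x \<in> carrier R" "y \<in> carrier R"
  have "x \<ominus> y \<in> ker \<longleftrightarrow> (\<forall>g. \<psi> x g - \<psi> y g = 0)"
    using \<psi>_minus[OF c] kerI[OF minus_closed[OF c]] kerD[of "x \<ominus> y"] by metis
  also have "\<dots> \<longleftrightarrow> \<psi> x = \<psi> y"
    by (metis eq_iff_diff_eq_0 ext)
  finally show ?thesis
    using ker.coset_eq_iff[OF c] by simp
qed

lemma \<psi>_scal_eq: "v \<in> verts G \<Longrightarrow> \<psi> (scal c v) g = (\<lambda>z. c * \<psi> (V v) g z)"
  by (auto simp: \<psi>_scal)

lemma \<psi>_lmon_scale:
  assumes "awalk u \<mu> w" "awalk x \<nu> w"
  shows "\<psi> (lmon c \<mu> w \<nu>) g = (\<lambda>z. c * \<psi> (lmon 1 \<mu> w \<nu>) g z)"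
proof -
  have x: "x \<in> verts G" "lmon 1 \<mu> w \<nu> \<in> carrier R"
    using assms by auto
  have eq: "lmon c \<mu> w \<nu> = lmon 1 \<mu> w \<nu> \<otimes> scal c x" "lmon 1 \<mu> w \<nu> = lmon 1 \<mu> w \<nu> \<otimes> V x"
    using lmon_scal[OF x(1) assms, of 1] by simp_all
  have "\<psi> (lmon c \<mu> w \<nu>) g = (\<lambda>z. c * \<psi> (V x) (\<psi> (lmon 1 \<mu> w \<nu>) g) z)"
    using x by (simp add: eq(1) \<psi>_mult \<psi>_scal_eq[of x c])
  also have "\<psi> (V x) (\<psi> (lmon 1 \<mu> w \<nu>) g) = \<psi> (lmon 1 \<mu> w \<nu>) g"
    using x by (subst (2) eq(2)) (simp add: \<psi>_mult)
  finally show ?thesis .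
qed

lemma \<psi>_lmon_outside:
  assumes "awalk u \<mu> w" "awalk x \<nu> w" "w \<notin> M"
  shows "\<psi> (lmon c \<mu> w \<nu>) g = 0"
proof -
  have w: "awalk w [] w" "w \<in> verts G"
    using assms by (auto simp: awalk_simps)
  have "lmon c \<mu> w \<nu> = lmon c \<mu> w [] \<otimes> (V w \<otimes> lmon 1 [] w \<nu>)"
    using lmon_split[OF assms(1,2)] scal_lmon[OF w(2,1) assms(2), of 1 1] by simp
  moreover have "\<psi> (V w) g' = 0" for g'
    using w assms(3) by (auto simp: \<psi>_scal)
  ultimately show ?thesis
    using lmon_closed[OF assms(1) w(1)] lmon_closed[OF w(1) assms(2)] w by (simp add: \<psi>_mult)
qed

text \<open>
  If \<open>e = x y\<close>, \<open>f = y x \<le> e\<close> and \<open>(e - f) h \<noteq> 0\<close>, the vectors \<open>x\<^sup>n (e - f) h\<close>, on which \<open>y\<close> acts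
  as a backward shift, would be independent. They stay in the span of the finite set \<open>{b h | b \<in> B}\<close>,
  because \<open>B\<close> is closed under multiplication. Here elements stand for the operators by which they
  act.
\<close>

lemma no_shift_in_finite_span:
  assumes B: "finite B" "B \<subseteq> carrier R"
      "\<And>b b'. \<lbrakk>b \<in> B; b' \<in> B\<rbrakk> \<Longrightarrow> b \<otimes> b' \<in> B \<or> b \<otimes> b' = \<zero>"
    and c: "e \<in> carrier R" "f \<in> carrier R" "x \<in> carrier R" "y \<in> carrier R"
    and sp: "\<And>a g. a \<in> {e, f, x} \<Longrightarrow> \<psi> a g \<in> fun_span ((\<lambda>b. \<psi> b g) ` B)"
    and rel: "\<psi> (x \<otimes> y) = \<psi> e" "\<psi> (e \<otimes> y) = \<psi> y" "\<psi> (f \<otimes> y) = \<psi> y" "\<psi> (x \<otimes> e) = \<psi> x"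
      "\<psi> (e \<otimes> e) = \<psi> e" "\<psi> (f \<otimes> e) = \<psi> f"
  shows "\<psi> e = \<psi> f"
proof
  fix h
  let ?T = "(\<lambda>b. \<psi> b h) ` B"
  define u where "u n = (\<psi> x ^^ n) (\<psi> e h - \<psi> f h)" for n
  have minus: "\<psi> a (g - g') = \<psi> a g - \<psi> a g'" if "a \<in> carrier R" for a g g'
    using \<psi>_linear_add[OF that, of "g - g'" g'] by simp
  have rel': "\<psi> y (\<psi> x g) = \<psi> e g" "\<psi> y (\<psi> e g) = \<psi> y g" "\<psi> y (\<psi> f g) = \<psi> y g" "\<psi> e (\<psi> x g) = \<psi> x g"
      "\<psi> e (\<psi> e g) = \<psi> e g" "\<psi> e (\<psi> f g) = \<psi> f g" for g
    using rel c by (simp_all flip: \<psi>_mult)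
  have inv: "\<psi> x z \<in> fun_span ?T" if "z \<in> fun_span ?T" for z
    using that
  proof (induction rule: fun_space.span_induct_alt)
    case base
    show ?case
      using c by (simp add: \<psi>_apply_zero_fun fun_span_zero)
  next
    case (step k z' z)
    then obtain b where b: "b \<in> B" "z' = \<psi> b h"
      by blast
    have "(\<lambda>b'. \<psi> b' (\<psi> b h)) ` B \<subseteq> fun_span ?T"
    proof safe
      fix b' assume b': "b' \<in> B"
      have "\<psi> b' (\<psi> b h) = \<psi> (b \<otimes> b') h"
        using b b' B(2) by (simp add: \<psi>_mult subset_iff)
      then show "\<psi> b' (\<psi> b h) \<in> fun_span ?T"
        using B(3)[OF b(1) b'] by (auto intro: fun_space.span_base fun_space.span_zero)
    qed
    then have "fun_span ((\<lambda>b'. \<psi> b' (\<psi> b h)) ` B) \<subseteq> fun_span ?T"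
      by (intro fun_space.span_minimal fun_space.subspace_span)
    then have "\<psi> x z' \<in> fun_span ?T"
      using sp[of x "\<psi> b h"] b(2) by auto
    moreover have "\<psi> x ((\<lambda>t. k * z' t) + z) = (\<lambda>t. k * \<psi> x z' t) + \<psi> x z"
      using c(3) by (simp only: \<psi>_linear_add \<psi>_linear_scale)
    ultimately show ?case
      using step by (simp only: fun_space.span_add fun_space.span_scale)
  qed
  have "u n \<in> fun_span ?T" for n
  proof (induction n)
    case 0
    have "\<psi> e h - \<psi> f h \<in> fun_span ?T"
      using sp[of e h] sp[of f h] by (intro fun_space.span_diff) auto
    moreover have "u 0 = \<psi> e h - \<psi> f h"
      by (simp add: u_def)
    ultimately show ?case
      by (simp only:)
  next
    case (Suc n)
    have "u (Suc n) = \<psi> x (u n)"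
      by (simp add: u_def)
    then show ?case
      using inv[OF Suc] by (simp only:)
  qed
  moreover have "\<psi> e (u n) = u n" for n
    by (cases n) (simp_all add: u_def rel' minus c)
  then have "\<psi> y (u (Suc n)) = u n" for n
    by (simp add: u_def rel')
  moreover have "\<psi> y (u 0) = 0"
    by (simp add: u_def rel' minus c)
  ultimately have "u 0 = 0"
    using B(1) c(4) by (intro fun_space.shift_vanishes[of ?T u "\<psi> y"]) (auto simp: \<psi>_linear_add \<psi>_linear_scale)
  then show "\<psi> e h = \<psi> f h"
    by (simp add: u_def)
qed

lemma corner_lspan:
  assumes "a \<in> carrier R" "v \<in> verts G"
  shows "V v \<otimes> a \<otimes> V v \<in> corner_span v" (is "_ \<in> lspan ?P")
proof (rule lspan_map[OF carrier_lspan[OF assms(1)]])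
  fix u \<mu> w y \<nu> c assume *: "awalk u \<mu> w" "awalk y \<nu> w"
  show "V v \<otimes> lmon c \<mu> w \<nu> \<otimes> V v \<in> lspan ?P"
    using scal_lmon[OF assms(2) *, of 1 c] lmon_scal[OF assms(2) *, of c 1] * lspan_lmon[OF *, of ?P c] assms(2)
    by (auto simp: lspan.zero)
qed (use assms in \<open>auto simp: l_distr r_distr\<close>)

text \<open>
  Where \<open>M\<close> does not branch there is one edge to follow and the numbering is trivial, so a path only
  moves from one fibre to the other without changing the second coordinate.
\<close>

lemma \<psi>_lmon_unbranched:
  assumes "awalk u \<mu> w" "awalk x \<nu> w" "w \<in> M" "unbranched_in M u" "unbranched_in M x"
  shows "\<psi> (lmon c \<mu> w \<nu>) g (y, n) = (if y = x then c * g (u, n) else 0)"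
proof -
  have w: "awalk w [] w" "w \<in> verts G"
    using assms by (auto simp: awalk_simps)
  have one: "{f \<in> out_arcs G (tail G e). head G f \<in> M} = {e}" "idx e = 0" "head G e \<in> M"
      "unbranched_in M (head G e)"
    if e: "e \<in> arcs G" "awalk (head G e) \<rho> w" "unbranched_in M (tail G e)" for e \<rho>
  proof -
    show h: "head G e \<in> M"
      using hereditary_complement[OF hereditary_M _ assms(3)] e(2) by (auto simp: connects_def)
    have t: "tail G e \<in> M"
      using hereditary_complement[OF hereditary_M connects_arc[OF e(1)] h] .
    show s: "{f \<in> out_arcs G (tail G e). head G f \<in> M} = {e}"
      using e(1,3) h t connects_refl[of "tail G e"] unfolding unbranched_in_def by (auto simp: out_arcs_def)
    show "idx e = 0"
      using idx_less[OF e(1) h] s by simp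
    show "unbranched_in M (head G e)"
      using e(3) connects_trans[OF connects_arc[OF e(1)]] unfolding unbranched_in_def by blast
  qed
  have ghost: "\<psi> (lmon c [] w \<nu>) g (y, n) = (if y = x then c * g (w, n) else 0)" for g y
    using assms(2,5)
  proof (induction \<nu> arbitrary: x y g)
    case Nil
    then show ?case
      using w assms(3) by (auto simp: lmon_Nil \<psi>_scal awalk_simps)
  next
    case (Cons e \<nu>)
    then have e: "e \<in> arcs G" "tail G e = x" "awalk (head G e) \<nu> w"
      by (auto simp: awalk_simps)
    note o = one[OF e(1,3)]
    have "\<psi> (lmon c [] w (e # \<nu>)) g (y, n) = \<psi> (Gh e) (\<psi> (lmon c [] w \<nu>) g) (y, n)"
      using e lmon_closed[OF w(1) e(3)] by (simp add: lmon_ghost_Cons \<psi>_mult)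
    then show ?case
      using Cons.IH[OF e(3)] o Cons.prems e by (auto simp: \<psi>_Gh)
  qed
  show ?thesis
    using assms(1,4)
  proof (induction \<mu> arbitrary: u g)
    case Nil
    then show ?case
      using ghost by (auto simp: awalk_simps)
  next
    case (Cons e \<mu>)
    then have e: "e \<in> arcs G" "tail G e = u" "awalk (head G e) \<mu> w"
      by (auto simp: awalk_simps)
    note o = one[OF e(1,3)]
    have "\<psi> (lmon c (e # \<mu>) w \<nu>) g (y, n) = \<psi> (lmon c \<mu> w \<nu>) (\<psi> (E e) g) (y, n)"
      using e lmon_closed[OF e(3) assms(2)] by (simp add: lmon_Cons \<psi>_mult)
    then show ?case
      using Cons.IH[OF e(3)] o Cons.prems e by (auto simp: \<psi>_E)
  qed
qed

text \<open>
  If \<open>M\<close> does not branch below \<open>v\<close>, the corner at \<open>v\<close> acts by scalars. For a cycle without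
  exits this amounts to specialising the Laurent polynomial ring at \<open>1\<close>.
\<close>

lemma scalar_corner_of_unbranched:
  assumes "x \<in> corner_span v" "v \<in> M" "v \<in> verts G" "unbranched_in M v"
  shows "\<exists>k. \<forall>g. \<psi> x g = (\<lambda>z. k * \<psi> (V v) g z)"
  using assms(1)
proof (induction rule: lspan.induct)
  case zero
  show ?case
    by (intro exI[of _ 0]) (simp add: fun_eq_iff)
next
  case (add x u \<mu> w y \<nu> c)
  then obtain k where k: "\<And>g. \<psi> x g = (\<lambda>z. k * \<psi> (V v) g z)"
    by blast
  have cl: "x \<in> carrier R" "lmon c \<mu> w \<nu> \<in> carrier R"
    using add lspan_closed by auto
  have vv: "awalk v \<mu> w" "awalk v \<nu> w"
    using add by auto
  have "\<exists>d. \<forall>g. \<psi> (lmon c \<mu> w \<nu>) g = (\<lambda>z. d * \<psi> (V v) g z)"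
  proof (cases "w \<in> M")
    case True
    have "\<psi> (lmon c \<mu> w \<nu>) g = (\<lambda>z. c * \<psi> (V v) g z)" for g
      using \<psi>_lmon_unbranched[OF vv True assms(4,4)] assms(2,3) by (auto simp: \<psi>_scal)
    then show ?thesis
      by blast
  next
    case False
    then show ?thesis
      using \<psi>_lmon_outside[OF vv] by (intro exI[of _ 0]) (simp add: fun_eq_iff)
  qed
  then obtain d where "\<And>g. \<psi> (lmon c \<mu> w \<nu>) g = (\<lambda>z. d * \<psi> (V v) g z)"
    by blast
  then have "\<psi> (x \<oplus> lmon c \<mu> w \<nu>) g = (\<lambda>z. (k + d) * \<psi> (V v) g z)" for g
    using k cl by (auto simp: \<psi>_add algebra_simps)
  then show ?case
    by blast
qed

lemma lspan_finite_edges: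
  assumes "x \<in> corner_span v"
  shows "\<exists>F. finite F \<and> x \<in> corner_span_over v F"
  using assms
proof (induction rule: lspan.induct)
  case (add x u \<mu> w y \<nu> c)
  then obtain F where F: "finite F"
      "x \<in> corner_span_over v F"
    by blast
  let ?F = "F \<union> set \<mu> \<union> set \<nu>"
  have "x \<in> corner_span_over v ?F"
    using F(2) by (rule lspan_mono) auto
  then have "x \<oplus> lmon c \<mu> w \<nu> \<in> corner_span_over v ?F"
    using add by (intro lspan.add) auto
  then show ?case
    using F(1) by (intro exI[of _ ?F]) auto
qed (auto intro: lspan.zero)

definition edge_monomials :: "'v \<Rightarrow> 'e set \<Rightarrow> 'r set" where
  "edge_monomials v F = {lmon 1 \<mu> w \<nu> | \<mu> w \<nu>. w \<in> M \<and> awalk v \<mu> w \<and> awalk v \<nu> w \<and> set \<mu> \<union> set \<nu> \<subseteq> F}"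

lemma edge_monomials_mult:
  assumes "b \<in> edge_monomials v F" "b' \<in> edge_monomials v F"
  shows "b \<otimes> b' \<in> edge_monomials v F \<or> b \<otimes> b' = \<zero>"
proof -
  obtain \<mu> w \<nu> \<mu>' w' \<nu>' where *: "b = lmon 1 \<mu> w \<nu>" "w \<in> M" "awalk v \<mu> w" "awalk v \<nu> w" "set \<mu> \<union> set \<nu> \<subseteq> F"
    "b' = lmon 1 \<mu>' w' \<nu>'" "w' \<in> M" "awalk v \<mu>' w'" "awalk v \<nu>' w'" "set \<mu>' \<union> set \<nu>' \<subseteq> F"
    using assms unfolding edge_monomials_def by blast
  from lmon_mult_cases[OF *(3,4,8,9)] show ?thesis
  proof (elim disjE exE conjE)
    assume "lmon 1 \<mu> w \<nu> \<otimes> lmon 1 \<mu>' w' \<nu>' = \<zero>"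
    then show ?thesis
      using * by simp
  next
    fix \<delta> assume d: "\<mu>' = \<nu> @ \<delta>" "awalk w \<delta> w'"
      "lmon 1 \<mu> w \<nu> \<otimes> lmon 1 \<mu>' w' \<nu>' = lmon 1 (\<mu> @ \<delta>) w' \<nu>'"
    have "awalk v (\<mu> @ \<delta>) w'" "set (\<mu> @ \<delta>) \<union> set \<nu>' \<subseteq> F"
      using * d awalk_appendI[OF *(3) d(2)] by auto
    then show ?thesis
      using * d unfolding edge_monomials_def by blast
  next
    fix \<delta> assume d: "\<nu> = \<mu>' @ \<delta>" "awalk w' \<delta> w"
      "lmon 1 \<mu> w \<nu> \<otimes> lmon 1 \<mu>' w' \<nu>' = lmon 1 \<mu> w (\<nu>' @ \<delta>)"
    have "awalk v (\<nu>' @ \<delta>) w" "set \<mu> \<union> set (\<nu>' @ \<delta>) \<subseteq> F"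
      using * d awalk_appendI[OF *(9) d(2)] by auto
    then show ?thesis
      using * d unfolding edge_monomials_def by blast
  qed
qed

lemma finite_edge_monomials:
  assumes "acyclic_in M v" "finite F"
  shows "finite (edge_monomials v F)"
proof -
  let ?P = "{p. set p \<subseteq> F \<and> (\<exists>w\<in>M. awalk v p w)}"
  have "edge_monomials v F \<subseteq> (\<lambda>(\<mu>, \<nu>). lmon 1 \<mu> (awlast v \<mu>) \<nu>) ` (?P \<times> ?P)"
  proof
    fix b assume "b \<in> edge_monomials v F"
    then obtain \<mu> w \<nu> where *: "b = lmon 1 \<mu> w \<nu>" "w \<in> M" "awalk v \<mu> w" "awalk v \<nu> w"
        "set \<mu> \<union> set \<nu> \<subseteq> F"
      unfolding edge_monomials_def by blast
    then have "(\<mu>, \<nu>) \<in> ?P \<times> ?P" "b = lmon 1 \<mu> (awlast v \<mu>) \<nu>"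
      using awlast_of_awalk[OF *(3)] by auto
    then show "b \<in> (\<lambda>(\<mu>, \<nu>). lmon 1 \<mu> (awlast v \<mu>) \<nu>) ` (?P \<times> ?P)"
      by (intro image_eqI[of _ _ "(\<mu>, \<nu>)"]) simp_all
  qed
  moreover have "finite (?P \<times> ?P)"
    using finite_paths_acyclic_in[OF hereditary_M assms] by blast
  ultimately show ?thesis
    by (meson finite_imageI finite_subset)
qed

lemma \<psi>_span_edge_monomials:
  assumes "x \<in> corner_span_over v F"
  shows "\<psi> x g \<in> fun_span ((\<lambda>b. \<psi> b g) ` edge_monomials v F)"
  using assms
proof (induction rule: lspan.induct)
  case zero
  show ?case
    by (simp add: fun_span_zero)
next
  case (add x u \<mu> w y \<nu> c)
  have cl: "x \<in> carrier R" "lmon c \<mu> w \<nu> \<in> carrier R"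
    using add lspan_closed by auto
  have vv: "awalk v \<mu> w" "awalk v \<nu> w" "set \<mu> \<union> set \<nu> \<subseteq> F"
    using add by auto
  have "\<psi> (lmon c \<mu> w \<nu>) g \<in> fun_span ((\<lambda>b. \<psi> b g) ` edge_monomials v F)"
  proof (cases "w \<in> M")
    case True
    then have "lmon 1 \<mu> w \<nu> \<in> edge_monomials v F"
      using vv unfolding edge_monomials_def by blast
    then show ?thesis
      unfolding \<psi>_lmon_scale[OF vv(1,2), of c]
      by (intro fun_space.span_scale fun_space.span_base) blast
  next
    case False
    then show ?thesis
      using \<psi>_lmon_outside[OF vv(1,2)] by (simp add: fun_space.span_zero)
  qed
  then show ?case
    unfolding \<psi>_add[OF cl] using add.IH by (rule fun_space.span_add[rotated])
qed

text \<open>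
  An infinite idempotent of the corner involves finitely many elements. In the unbranched case these act
  as multiples of \<open>v\<close>; in the acyclic case they are combinations of the finitely many monomials
  \<open>\<mu> w \<nu>\<^sup>*\<close> over a finite set of edges. Either way \<open>no_shift_in_finite_span\<close> applies.
\<close>

theorem no_infinite_idempotent_in_corner:
  assumes v: "v \<in> M" "v \<in> verts G" and cases: "unbranched_in M v \<or> acyclic_in M v"
    and e: "infinite_idempotent (R Quot ker) e0" "ker.q (V v) \<otimes>\<^bsub>R Quot ker\<^esub> e0 = e0"
      "e0 \<otimes>\<^bsub>R Quot ker\<^esub> ker.q (V v) = e0"
  shows False
proof -
  interpret Q: nonunital_ring "R Quot ker"
    by (rule ker.nonunital_ring_quotient)
  let ?Q = "R Quot ker"
  let ?v = "ker.q (V v)"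
  obtain f0 x0 y0 where *: "e0 \<in> carrier ?Q" "f0 \<in> carrier ?Q" "x0 \<in> carrier ?Q" "y0 \<in> carrier ?Q"
    "e0 \<otimes>\<^bsub>?Q\<^esub> e0 = e0" "f0 \<otimes>\<^bsub>?Q\<^esub> f0 = f0" "f0 \<otimes>\<^bsub>?Q\<^esub> e0 = f0" "e0 \<otimes>\<^bsub>?Q\<^esub> f0 = f0" "f0 \<noteq> e0"
    "x0 \<otimes>\<^bsub>?Q\<^esub> y0 = e0" "y0 \<otimes>\<^bsub>?Q\<^esub> x0 = f0"
    "e0 \<otimes>\<^bsub>?Q\<^esub> x0 = x0" "x0 \<otimes>\<^bsub>?Q\<^esub> f0 = x0" "f0 \<otimes>\<^bsub>?Q\<^esub> y0 = y0" "y0 \<otimes>\<^bsub>?Q\<^esub> e0 = y0"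
    using e(1) by (rule Q.infinite_idempotentE)
  have vc: "?v \<in> carrier ?Q"
    using v by simp
  have ex: "e0 \<otimes>\<^bsub>?Q\<^esub> y0 = y0" "x0 \<otimes>\<^bsub>?Q\<^esub> e0 = x0"
    using * by (metis Q.m_assoc)+
  have lift: "\<exists>a\<in>carrier R. ker.q a = a0 \<and> a \<in> corner_span v"
    if a0: "a0 \<in> carrier ?Q" "e0 \<otimes>\<^bsub>?Q\<^esub> a0 = a0" "a0 \<otimes>\<^bsub>?Q\<^esub> e0 = a0" for a0
  proof -
    obtain a where a: "a \<in> carrier R" "a0 = ker.q a"
      using a0(1) by (rule ker.quotientE)
    have "?v \<otimes>\<^bsub>?Q\<^esub> a0 \<otimes>\<^bsub>?Q\<^esub> ?v = a0"
      using a0 e vc *(1) by (metis Q.m_assoc)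
    then have "ker.q (V v \<otimes> a \<otimes> V v) = a0"
      using a v by (simp add: ker.q_mult)
    then show ?thesis
      using corner_lspan[OF a(1) v(2)] a(1) v by (intro bexI[of _ "V v \<otimes> a \<otimes> V v"]) auto
  qed
  obtain a1 where a1: "a1 \<in> carrier R" "ker.q a1 = e0" "a1 \<in> corner_span v"
    using lift[of e0] * by blast
  obtain a2 where a2: "a2 \<in> carrier R" "ker.q a2 = f0" "a2 \<in> corner_span v"
    using lift[of f0] * by blast
  obtain a3 where a3: "a3 \<in> carrier R" "ker.q a3 = x0" "a3 \<in> corner_span v"
    using lift[of x0] * ex by blast
  obtain a4 where a4: "a4 \<in> carrier R" "ker.q a4 = y0"
    using lift[of y0] * ex by blast
  note ac = a1(1) a2(1) a3(1) a4(1)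
  have rel: "\<psi> (a3 \<otimes> a4) = \<psi> a1" "\<psi> (a1 \<otimes> a4) = \<psi> a4" "\<psi> (a2 \<otimes> a4) = \<psi> a4" "\<psi> (a3 \<otimes> a1) = \<psi> a3"
      "\<psi> (a1 \<otimes> a1) = \<psi> a1" "\<psi> (a2 \<otimes> a1) = \<psi> a2"
    using ac * ex a1(2) a2(2) a3(2) a4(2)
    by (simp_all flip: coset_ker_eq_iff add: ker.q_mult[symmetric])
  have "\<exists>B. finite B \<and> B \<subseteq> carrier R \<and> (\<forall>b\<in>B. \<forall>b'\<in>B. b \<otimes> b' \<in> B \<or> b \<otimes> b' = \<zero>) \<and>
      (\<forall>a\<in>{a1, a2, a3}. \<forall>g. \<psi> a g \<in> fun_span ((\<lambda>b. \<psi> b g) ` B))"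
    using cases
  proof
    assume "unbranched_in M v"
    then have "\<exists>k. \<forall>g. \<psi> a g = (\<lambda>z. k * \<psi> (V v) g z)" if "a \<in> {a1, a2, a3}" for a
      using that a1 a2 a3 v by (auto intro: scalar_corner_of_unbranched)
    then have "\<psi> a g \<in> fun_span ((\<lambda>b. \<psi> b g) ` {V v})" if "a \<in> {a1, a2, a3}" for a g
      using that by (metis fun_space.span_base fun_space.span_scale image_eqI singletonI)
    then show ?thesis
      using v V_idem by (intro exI[of _ "{V v}"]) auto
  next
    assume ac: "acyclic_in M v"
    obtain F1 where F1: "finite F1" "a1 \<in> corner_span_over v F1"
      using lspan_finite_edges[OF a1(3)] by blast
    obtain F2 where F2: "finite F2" "a2 \<in> corner_span_over v F2"
      using lspan_finite_edges[OF a2(3)] by blast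
    obtain F3 where F3: "finite F3" "a3 \<in> corner_span_over v F3"
      using lspan_finite_edges[OF a3(3)] by blast
    define F where "F = F1 \<union> F2 \<union> F3"
    let ?L = "corner_span_over v F"
    have "a1 \<in> ?L" "a2 \<in> ?L" "a3 \<in> ?L"
      by (rule lspan_mono[OF F1(2)], auto simp: F_def, rule lspan_mono[OF F2(2)], auto simp: F_def,
          rule lspan_mono[OF F3(2)], auto simp: F_def)
    then have "\<forall>a\<in>{a1, a2, a3}. \<forall>g. \<psi> a g \<in> fun_span ((\<lambda>b. \<psi> b g) ` edge_monomials v F)"
      using \<psi>_span_edge_monomials by blast
    moreover have "finite (edge_monomials v F)"
      using ac F1 F2 F3 by (intro finite_edge_monomials) (auto simp: F_def)
    moreover have "edge_monomials v F \<subseteq> carrier R"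
      by (auto simp: edge_monomials_def)
    ultimately show ?thesis
      by (intro exI[of _ "edge_monomials v F"] conjI ballI)
        (assumption | rule edge_monomials_mult, assumption+ | blast)+
  qed
  then obtain B where B: "finite B" "B \<subseteq> carrier R" "\<forall>b\<in>B. \<forall>b'\<in>B. b \<otimes> b' \<in> B \<or> b \<otimes> b' = \<zero>"
      "\<forall>a\<in>{a1, a2, a3}. \<forall>g. \<psi> a g \<in> fun_span ((\<lambda>b. \<psi> b g) ` B)"
    by (elim exE conjE)
  have "\<psi> a1 = \<psi> a2"
    by (rule no_shift_in_finite_span[OF B(1,2) B(3)[rule_format] ac B(4)[rule_format] rel])
  then have "e0 = f0"
    using coset_ker_eq_iff[OF ac(1,2)] a1(2) a2(2) by simp
  then show False
    using *(9) by simp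
qed

lemma V_not_in_ker: "\<lbrakk>v \<in> M; v \<in> verts G\<rbrakk> \<Longrightarrow> V v \<notin> ker"
proof
  assume v: "v \<in> M" "v \<in> verts G" and "V v \<in> ker"
  then have "\<psi> (V v) (\<lambda>_. 1) (v, 0) = 0"
    using kerD[of "V v" "\<lambda>_. 1"] by (simp add: zero_fun_def)
  then show False
    using v by (simp add: \<psi>_scal)
qed

text \<open>
  Every element acts as a multiple of the single vertex \<open>y\<close>, so the quotient is a copy of the field.
\<close>

lemma division_ring_quotient:
  assumes M: "M = {y}" and y: "y \<in> verts G" "unbranched_in M y"
  shows "is_division_ring (R Quot ker)"
proof -
  have yM: "y \<in> M"
    using M by simp
  have only: "u = y" if "awalk u \<mu> y" for u \<mu>
    using hereditary_complement[OF hereditary_M, of u y] that M by (auto simp: connects_def)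
  have scalar: "\<exists>k. \<forall>g. \<psi> x g = (\<lambda>z. k * \<psi> (V y) g z)" if "x \<in> carrier R" for x
  proof -
    have "x \<in> lspan (\<lambda>_ _ _. True)"
      using that by (rule carrier_lspan)
    then have "\<exists>x'\<in>corner_span y. \<psi> x = \<psi> x'"
    proof (induction rule: lspan.induct)
      case zero
      show ?case
        by (intro bexI[of _ \<zero>] lspan.zero refl)
    next
      case (add x u \<mu> w z \<nu> c)
      then obtain x' where x': "x' \<in> corner_span y" "\<psi> x = \<psi> x'"
        by blast
      have cl: "x \<in> carrier R" "lmon c \<mu> w \<nu> \<in> carrier R" "x' \<in> carrier R"
        using add x' lspan_closed by auto
      show ?case
      proof (cases "w = y")
        case True
        then have "awalk y \<mu> w" "awalk y \<nu> w"
          using add(2,3) only by blast+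
        then have "x' \<oplus> lmon c \<mu> w \<nu> \<in> corner_span y"
          using x'(1) by (intro lspan.add) auto
        moreover have "\<psi> (x \<oplus> lmon c \<mu> w \<nu>) = \<psi> (x' \<oplus> lmon c \<mu> w \<nu>)"
          using cl x'(2) by (simp add: fun_eq_iff \<psi>_add)
        ultimately show ?thesis
          by blast
      next
        case False
        then have "\<psi> (lmon c \<mu> w \<nu>) g = 0" for g
          using add(2,3) M by (intro \<psi>_lmon_outside) auto
        then have "\<psi> (x \<oplus> lmon c \<mu> w \<nu>) = \<psi> x'"
          using cl x'(2) by (simp add: fun_eq_iff \<psi>_add)
        then show ?thesis
          using x'(1) by blast
      qed
    qed
    then obtain x' where x': "x' \<in> corner_span y" "\<psi> x = \<psi> x'"
      by blast
    show ?thesis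
      unfolding x'(2) by (rule scalar_corner_of_unbranched[OF x'(1) yM y])
  qed
  have V: "\<psi> (V y) (\<psi> (V y) g) = \<psi> (V y) g" for g
    using y V_idem[of y] \<psi>_mult[of "V y" "V y" g] by simp
  let ?u = "ker.q (V y)"
  show ?thesis
    unfolding is_division_ring_def
  proof (rule bexI[of _ ?u], intro conjI ballI impI)
    show "?u \<noteq> \<zero>\<^bsub>R Quot ker\<^esub>"
      using V_not_in_ker[OF yM y(1)] y by (simp add: ker.q_eq_zero_iff)
    fix X assume X: "X \<in> carrier (R Quot ker)"
    then obtain x where x: "x \<in> carrier R" "X = ker.q x"
      by (rule ker.quotientE)
    obtain k where k: "\<And>g. \<psi> x g = (\<lambda>z. k * \<psi> (V y) g z)"
      using scalar[OF x(1)] by blast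
    have "\<psi> (V y \<otimes> x) = \<psi> x" "\<psi> (x \<otimes> V y) = \<psi> x"
      using x y by (simp_all add: fun_eq_iff \<psi>_mult k V \<psi>_linear_scale)
    then show "?u \<otimes>\<^bsub>R Quot ker\<^esub> X = X" "X \<otimes>\<^bsub>R Quot ker\<^esub> ?u = X"
      using x y by (simp_all add: ker.q_mult coset_ker_eq_iff)
    assume "X \<noteq> \<zero>\<^bsub>R Quot ker\<^esub>"
    then have "x \<notin> ker"
      using x by (simp add: ker.q_eq_zero_iff)
    then have "k \<noteq> 0"
      using k kerI[OF x(1)] by (auto simp: zero_fun_def)
    let ?z = "scal (inverse k) y"
    have "\<psi> (x \<otimes> ?z) = \<psi> (V y)" "\<psi> (?z \<otimes> x) = \<psi> (V y)"
      using x y \<open>k \<noteq> 0\<close> by (simp_all add: fun_eq_iff \<psi>_mult k V \<psi>_linear_scale \<psi>_scal_eq[of y "inverse k"])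
    then show "\<exists>Y\<in>carrier (R Quot ker). X \<otimes>\<^bsub>R Quot ker\<^esub> Y = ?u \<and> Y \<otimes>\<^bsub>R Quot ker\<^esub> X = ?u"
      using x y by (intro bexI[of _ "ker.q ?z"]) (simp_all add: ker.q_mult coset_ker_eq_iff)
  qed (use y in simp)
qed

end

section \<open>Words and their actions\<close>

abbreviation word :: "('v, 'e) leavitt_gen list \<Rightarrow> 'k \<Rightarrow> ('v, 'e, 'k::field) leavitt_free" where
  "word ws c \<equiv> Poly_Mapping.single (FM ws) c"

lemma word_mult: "word u c * word v d = word (u @ v) (c * d)"
  by (simp add: mult_single plus_free_mon_def)

lemma scalar_mult_word: "Poly_Mapping.single 0 c * word u d = word u (c * d)"
  by (simp add: mult_single)

lemma sum_monomials:
  fixes p :: "'a \<Rightarrow>\<^sub>0 'b::comm_monoid_add"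
  shows "p = (\<Sum>w\<in>Poly_Mapping.keys p. Poly_Mapping.single w (Poly_Mapping.lookup p w))"
proof (rule poly_mapping_eqI)
  fix k
  have "(\<Sum>w\<in>Poly_Mapping.keys p. Poly_Mapping.lookup p w when w = k)
      = (\<Sum>w\<in>Poly_Mapping.keys p. if w = k then Poly_Mapping.lookup p w else 0)"
    by (intro sum.cong) (auto simp: when_def)
  also have "\<dots> = Poly_Mapping.lookup p k"
    by (simp add: in_keys_iff)
  finally show "Poly_Mapping.lookup p k =
      Poly_Mapping.lookup (\<Sum>w\<in>Poly_Mapping.keys p. Poly_Mapping.single w (Poly_Mapping.lookup p w)) k"
    by (simp add: lookup_sum lookup_single)
qed

lemma monomial_induct [case_names zero add]:
  fixes p :: "'a \<Rightarrow>\<^sub>0 'b::comm_monoid_add"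
  assumes "P 0" "\<And>p w c. P p \<Longrightarrow> P (p + Poly_Mapping.single w c)"
  shows "P p"
proof -
  have "P (\<Sum>w\<in>S. Poly_Mapping.single w (Poly_Mapping.lookup p w))" if "finite S" for S
    using that
  proof (induction S rule: finite_induct)
    case (insert w S)
    then show ?case
      using assms(2)[OF insert.IH, of w "Poly_Mapping.lookup p w"] by (simp add: add.commute)
  qed (simp add: assms)
  then show ?thesis
    using sum_monomials[of p] by (metis finite_keys)
qed

subsection \<open>Actions of words by partial maps\<close>

text \<open>
  Words act from the left on points by partial maps: the last letter is applied first.
\<close>

fun word_act :: "('g \<Rightarrow> 'x \<Rightarrow> 'x option) \<Rightarrow> 'g list \<Rightarrow> 'x \<Rightarrow> 'x option" where
  "word_act \<theta> [] x = Some x"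
| "word_act \<theta> (g # ws) x = Option.bind (word_act \<theta> ws x) (\<theta> g)"

definition pull :: "('x \<Rightarrow> 'k::zero) \<Rightarrow> 'x option \<Rightarrow> 'k" where
  "pull f y = (case y of None \<Rightarrow> 0 | Some x \<Rightarrow> f x)"

lemma pull_simps [simp]: "pull f None = 0" "pull f (Some x) = f x"
  by (simp_all add: pull_def)

definition act :: "(('v, 'e) leavitt_gen \<Rightarrow> 'x \<Rightarrow> 'x option) \<Rightarrow> ('v, 'e, 'k::field) leavitt_free \<Rightarrow>
    ('x \<Rightarrow> 'k) \<Rightarrow> ('x \<Rightarrow> 'k)" where
  "act \<theta> p f x = (\<Sum>w\<in>Poly_Mapping.keys p. Poly_Mapping.lookup p w * pull f (word_act \<theta> (letters w) x))"

lemma act_superset: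
  assumes "finite S" "Poly_Mapping.keys p \<subseteq> S"
  shows "act \<theta> p f x = (\<Sum>w\<in>S. Poly_Mapping.lookup p w * pull f (word_act \<theta> (letters w) x))"
  unfolding act_def using assms by (intro sum.mono_neutral_left) (auto simp: in_keys_iff)

lemma act_add: "act \<theta> (p + r) f = act \<theta> p f + act \<theta> r f"
proof
  fix x
  let ?S = "Poly_Mapping.keys p \<union> Poly_Mapping.keys r"
  have "Poly_Mapping.keys (p + r) \<subseteq> ?S"
    by (rule keys_add)
  then show "act \<theta> (p + r) f x = (act \<theta> p f + act \<theta> r f) x"
    using act_superset[of ?S "p + r" \<theta> f x] act_superset[of ?S p \<theta> f x] act_superset[of ?S r \<theta> f x]
    by (simp add: lookup_add algebra_simps sum.distrib)
qed

lemma act_zero [simp]: "act \<theta> 0 f = 0"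
  by (simp add: fun_eq_iff act_def)

lemma act_uminus: "act \<theta> (- p) f = - act \<theta> p f"
  using act_add[of \<theta> p "- p" f] by (simp add: eq_neg_iff_add_eq_0 add.commute)

lemma act_diff: "act \<theta> (p - r) f = act \<theta> p f - act \<theta> r f"
  using act_add[of \<theta> p "- r" f] by (simp add: act_uminus)

lemma act_sum: "act \<theta> (\<Sum>i\<in>S. p i) f = (\<Sum>i\<in>S. act \<theta> (p i) f)"
  by (induction S rule: infinite_finite_induct) (simp_all only: sum.infinite sum.empty sum.insert act_zero act_add simp_thms)

lemma act_single: "act \<theta> (Poly_Mapping.single w c) f x = c * pull f (word_act \<theta> (letters w) x)"
  by (cases "c = 0") (simp_all add: act_def)

lemma act_fgen: "act \<theta> (fgen g) f x = pull f (\<theta> g x)"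
  by (simp add: fgen_def act_single)

lemma act_linear_add:
  fixes f g :: "'x \<Rightarrow> 'k::field"
  shows "act \<theta> p (f + g) = act \<theta> p f + act \<theta> p g"
proof -
  have "pull (f + g) y = pull f y + pull g y" for y :: "'x option"
    by (cases y) simp_all
  then show ?thesis
    by (simp add: fun_eq_iff act_def algebra_simps sum.distrib)
qed

lemma act_linear_scale:
  fixes f :: "'x \<Rightarrow> 'k::field"
  shows "act \<theta> p (\<lambda>z. k * f z) = (\<lambda>z. k * act \<theta> p f z)"
proof -
  have "pull (\<lambda>z. k * f z) y = k * pull f y" for y :: "'x option"
    by (cases y) simp_all
  then show ?thesis
    by (simp add: fun_eq_iff act_def algebra_simps sum_distrib_left)
qed

lemma word_act_append: "word_act \<theta> (u @ v) x = Option.bind (word_act \<theta> v x) (word_act \<theta> u)"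
proof (induction u)
  case Nil
  show ?case
    by (cases "word_act \<theta> v x") simp_all
next
  case (Cons g u)
  then show ?case
    by (cases "word_act \<theta> v x") simp_all
qed

text \<open>
  The action on functions is dual to the action on points and hence reverses products.
\<close>

lemma act_mult: "act \<theta> (p * r) f = act \<theta> r (act \<theta> p f)"
proof (induction p rule: monomial_induct)
  case zero
  have "act \<theta> r 0 = act \<theta> r (0 + 0)"
    by simp
  also have "\<dots> = act \<theta> r 0 + act \<theta> r 0"
    by (rule act_linear_add)
  finally show ?case
    by (simp only: mult_zero_left act_zero add_cancel_right_right)
next
  case (add p w c)
  have "act \<theta> (Poly_Mapping.single w c * r) f = act \<theta> r (act \<theta> (Poly_Mapping.single w c) f)"
  proof (induction r rule: monomial_induct)
    case zero
    show ?case
      by (simp only: mult_zero_right act_zero)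
  next
    case (add r v d)
    have "act \<theta> (Poly_Mapping.single w c * Poly_Mapping.single v d) f x
        = act \<theta> (Poly_Mapping.single v d) (act \<theta> (Poly_Mapping.single w c) f) x" for x
      by (cases "word_act \<theta> (letters v) x")
        (simp_all add: mult_single act_single plus_free_mon_def word_act_append)
    then have "act \<theta> (Poly_Mapping.single w c * Poly_Mapping.single v d) f
        = act \<theta> (Poly_Mapping.single v d) (act \<theta> (Poly_Mapping.single w c) f)"
      by (rule ext)
    then show ?case
      using add by (simp only: distrib_left act_add)
  qed
  then show ?case
    using add by (simp only: distrib_right act_add act_linear_add)
qed

section \<open>The Leavitt path algebra\<close>

text \<open>
  The parameter \<open>K\<close> fixes the type of coefficients.
\<close>

locale leavitt_graph = wf_digraph G for G :: "('v, 'e) pre_digraph" +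
  fixes K :: "'k::field itself"
  assumes row_finite_G: "row_finite G"
begin

abbreviation F :: "('v, 'e, 'k) leavitt_free ring" where
  "F \<equiv> leavitt_free_alg G"

abbreviation N :: "('v, 'e, 'k) leavitt_free set" where
  "N \<equiv> leavitt_ideal G"

abbreviation rels :: "('v, 'e, 'k) leavitt_free set" where
  "rels \<equiv> leavitt_rels G"

abbreviation L :: "('v, 'e, 'k) leavitt_free set ring" where
  "L \<equiv> leavitt_path_algebra K G"

lemma F_simps [simp]: "mult F = (*)" "add F = (+)" "zero F = 0"
  by (simp_all add: leavitt_free_alg_def)

lemma F_carrier: "p \<in> carrier F \<longleftrightarrow>
    (\<forall>w\<in>Poly_Mapping.keys p. letters w \<noteq> [] \<and> set (letters w) \<subseteq> leavitt_gens G)"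
  by (simp add: leavitt_free_alg_def)

lemma F_add_closed: "\<lbrakk>p \<in> carrier F; r \<in> carrier F\<rbrakk> \<Longrightarrow> p + r \<in> carrier F"
  using keys_add[of p r] unfolding F_carrier by blast

lemma F_zero_closed: "0 \<in> carrier F"
  by (simp add: F_carrier)

lemma F_uminus_closed: "p \<in> carrier F \<Longrightarrow> - p \<in> carrier F"
  by (simp add: F_carrier)

lemma F_diff_closed: "\<lbrakk>p \<in> carrier F; r \<in> carrier F\<rbrakk> \<Longrightarrow> p - r \<in> carrier F"
  using F_add_closed[of p "- r"] F_uminus_closed[of r] by simp

lemma F_mult_closed:
  assumes "p \<in> carrier F" "r \<in> carrier F"
  shows "p * r \<in> carrier F"
  unfolding F_carrier
proof
  fix w assume "w \<in> Poly_Mapping.keys (p * r)"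
  then obtain a b where "w = a + b" "a \<in> Poly_Mapping.keys p" "b \<in> Poly_Mapping.keys r"
    using keys_mult[of p r] by blast
  then show "letters w \<noteq> [] \<and> set (letters w) \<subseteq> leavitt_gens G"
    using assms unfolding F_carrier by (simp add: plus_free_mon_def)
qed

lemma F_word_closed: "\<lbrakk>ws \<noteq> []; set ws \<subseteq> leavitt_gens G\<rbrakk> \<Longrightarrow> word ws c \<in> carrier F"
  unfolding F_carrier by (cases "c = 0") auto

lemma F_fgen_closed: "x \<in> leavitt_gens G \<Longrightarrow> fgen x \<in> carrier F"
  unfolding fgen_def by (rule F_word_closed) auto

lemma F_sum_closed: "(\<And>i. i \<in> S \<Longrightarrow> p i \<in> carrier F) \<Longrightarrow> (\<Sum>i\<in>S. p i) \<in> carrier F"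
  by (induction S rule: infinite_finite_induct) (auto intro: F_add_closed F_zero_closed)

lemma F_scale_closed:
  assumes "p \<in> carrier F"
  shows "Poly_Mapping.single 0 c * p \<in> carrier F"
  unfolding F_carrier
proof
  fix w assume "w \<in> Poly_Mapping.keys (Poly_Mapping.single 0 c * p)"
  then obtain a b where "w = a + b" "a \<in> Poly_Mapping.keys (Poly_Mapping.single 0 c)" "b \<in> Poly_Mapping.keys p"
    using keys_mult[of "Poly_Mapping.single 0 c" p] by blast
  then have "w \<in> Poly_Mapping.keys p"
    by (cases "c = 0") auto
  then show "letters w \<noteq> [] \<and> set (letters w) \<subseteq> leavitt_gens G"
    using assms unfolding F_carrier by blast
qed

lemma gens [simp]: "Vert v \<in> leavitt_gens G \<longleftrightarrow> v \<in> verts G" "Edge e \<in> leavitt_gens G \<longleftrightarrow> e \<in> arcs G"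
    "Ghost e \<in> leavitt_gens G \<longleftrightarrow> e \<in> arcs G"
  by (auto simp: leavitt_gens_def)

lemma nonunital_ring_F: "nonunital_ring F"
proof (intro nonunital_ring.intro nonunital_ring_axioms.intro)
  show "abelian_group F"
  proof (rule abelian_groupI)
    show "\<exists>y\<in>carrier F. y \<oplus>\<^bsub>F\<^esub> x = \<zero>\<^bsub>F\<^esub>" if "x \<in> carrier F" for x
      using F_uminus_closed[OF that] by (intro bexI[of _ "- x"]) simp_all
  qed (auto simp: add_ac intro: F_add_closed F_zero_closed)
qed (auto simp: algebra_simps intro: F_mult_closed)

sublocale free: nonunital_ring F
  by (rule nonunital_ring_F)

lemma free_minus: "\<lbrakk>x \<in> carrier F; y \<in> carrier F\<rbrakk> \<Longrightarrow> x \<ominus>\<^bsub>F\<^esub> y = x - y"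
  using free.minus_equality[of "- y" y] F_uminus_closed[of y] by (simp add: a_minus_def)

lemma leavitt_rels_closed: "a \<in> rels \<Longrightarrow> a \<in> carrier F"
proof (induction rule: leavitt_rels.induct)
  case (vert_sum v)
  have "fgen (Edge e) * fgen (Ghost e) \<in> carrier F" if "e \<in> out_arcs G v" for e
    using that by (intro F_mult_closed F_fgen_closed) auto
  then show ?case
    using vert_sum by (intro F_diff_closed F_sum_closed F_fgen_closed) auto
qed (auto intro!: F_diff_closed F_mult_closed F_fgen_closed F_zero_closed)

lemma N_closed: "a \<in> N \<Longrightarrow> a \<in> carrier F"
  by (induction rule: leavitt_ideal.induct)
    (auto intro: leavitt_rels_closed F_add_closed F_zero_closed F_mult_closed F_scale_closed)

lemma N_uminus: "a \<in> N \<Longrightarrow> - a \<in> N"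
  using leavitt_ideal.scale[of a G "- 1"] by (simp add: single_uminus)

lemma two_sided_N: "two_sided_ideal N F"
proof (rule free.two_sided_idealI)
  show "\<ominus>\<^bsub>F\<^esub> x \<in> N" if "x \<in> N" for x
    using free.minus_equality[of "- x" x] N_uminus[OF that] N_closed that by simp
qed (auto intro: N_closed leavitt_ideal.intros)

sublocale free_ideal: nonunital_ring_ideal F N
  by unfold_locales (rule two_sided_N)

lemma L_eq: "L = F Quot N"
  by (simp add: leavitt_path_algebra_def)

sublocale L: nonunital_ring L
  unfolding L_eq by (rule free_ideal.nonunital_ring_quotient)

abbreviation "q \<equiv> free_ideal.q"

lemmas q_closed = free_ideal.q_closed[folded L_eq]
  and q_mult = free_ideal.q_mult[folded L_eq]
  and q_add = free_ideal.q_add[folded L_eq]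
  and q_zero = free_ideal.q_zero_eq[folded L_eq]
  and LE = free_ideal.quotientE[folded L_eq]

lemma q_eq_iff: "\<lbrakk>x \<in> carrier F; y \<in> carrier F\<rbrakk> \<Longrightarrow> q x = q y \<longleftrightarrow> x - y \<in> N"
  by (simp add: free_ideal.coset_eq_iff free_minus)

lemma q_sum:
  assumes "finite S" "\<And>i. i \<in> S \<Longrightarrow> p i \<in> carrier F"
  shows "q (\<Sum>i\<in>S. p i) = (\<Oplus>\<^bsub>L\<^esub>i\<in>S. q (p i))"
  using assms
proof (induction S rule: finite_induct)
  case empty
  then show ?case
    by (simp add: q_zero)
next
  case (insert i S)
  then have "q (p i + (\<Sum>i\<in>S. p i)) = q (p i) \<oplus>\<^bsub>L\<^esub> q (\<Sum>i\<in>S. p i)"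
    using F_sum_closed[of S p] by (subst q_add) auto
  then show ?case
    using insert by (simp add: q_closed Pi_def)
qed

text \<open>
  Defining relations may be multiplied by scalars, because the ideal is closed under them.
\<close>

lemma q_word_eq:
  assumes "word u 1 - word v 1 \<in> N" "u \<noteq> []" "v \<noteq> []" "set u \<subseteq> leavitt_gens G" "set v \<subseteq> leavitt_gens G"
  shows "q (word u c) = q (word v c)"
proof -
  have "Poly_Mapping.single 0 c * (word u 1 - word v 1) \<in> N"
    using assms(1) by (rule leavitt_ideal.scale)
  then show ?thesis
    using assms by (simp add: q_eq_iff F_word_closed right_diff_distrib scalar_mult_word)
qed

lemma q_word_zero:
  assumes "word u 1 \<in> N" "u \<noteq> []" "set u \<subseteq> leavitt_gens G"
  shows "q (word u c) = \<zero>\<^bsub>L\<^esub>"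
proof -
  have "Poly_Mapping.single 0 c * word u 1 \<in> N"
    using assms(1) by (rule leavitt_ideal.scale)
  then have "q (word u c) = q 0"
    using assms q_eq_iff[OF F_word_closed F_zero_closed] by (simp add: scalar_mult_word)
  then show ?thesis
    by (simp add: q_zero)
qed

lemma rel_words:
  assumes "word u 1 - word v 1 \<in> rels" "u \<noteq> []" "v \<noteq> []" "set u \<subseteq> leavitt_gens G" "set v \<subseteq> leavitt_gens G"
  shows "q (word u c) = q (word v c)"
  using assms by (intro q_word_eq leavitt_ideal.rel)

definition scal :: "'k \<Rightarrow> 'v \<Rightarrow> ('v, 'e, 'k) leavitt_free set" where
  "scal c v = q (word [Vert v] c)"

definition E :: "'e \<Rightarrow> ('v, 'e, 'k) leavitt_free set" where
  "E e = q (word [Edge e] 1)"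

definition Gh :: "'e \<Rightarrow> ('v, 'e, 'k) leavitt_free set" where
  "Gh e = q (word [Ghost e] 1)"

lemma q_words_mult:
  assumes "u \<noteq> []" "v \<noteq> []" "set u \<subseteq> leavitt_gens G" "set v \<subseteq> leavitt_gens G"
  shows "q (word u c) \<otimes>\<^bsub>L\<^esub> q (word v d) = q (word (u @ v) (c * d))"
  using assms q_mult[of "word u c" "word v d"] by (simp add: F_word_closed word_mult)

lemma scal_mult_L:
  assumes "v \<in> verts G" "w \<in> verts G"
  shows "scal c v \<otimes>\<^bsub>L\<^esub> scal d w = (if v = w then scal (c * d) v else \<zero>\<^bsub>L\<^esub>)"
proof -
  have eq: "scal c v \<otimes>\<^bsub>L\<^esub> scal d w = q (word [Vert v, Vert w] (c * d))"
    using assms q_words_mult[of "[Vert v]" "[Vert w]" c d] by (simp add: scal_def)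
  show ?thesis
  proof (cases "v = w")
    case True
    have "word [Vert v, Vert w] 1 - word [Vert v] 1 \<in> rels"
      using leavitt_rels.vert_vert[OF assms] True by (simp add: fgen_def word_mult)
    then show ?thesis
      unfolding eq using True assms rel_words[of "[Vert v, Vert w]" "[Vert v]" "c * d"] by (simp add: scal_def)
  next
    case False
    have "word [Vert v, Vert w] 1 \<in> rels"
      using leavitt_rels.vert_vert[OF assms] False by (simp add: fgen_def word_mult)
    then show ?thesis
      unfolding eq using False assms by (simp add: q_word_zero leavitt_ideal.rel)
  qed
qed

lemma E_words:
  assumes "e \<in> arcs G"
  shows "q (word [Vert (tail G e), Edge e] c) = q (word [Edge e] c)"
    "q (word [Edge e, Vert (head G e)] c) = q (word [Edge e] c)"
    "q (word [Vert (head G e), Ghost e] c) = q (word [Ghost e] c)"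
    "q (word [Ghost e, Vert (tail G e)] c) = q (word [Ghost e] c)"
proof -
  have "word [Vert (tail G e), Edge e] 1 - word [Edge e] 1 \<in> rels"
    "word [Edge e, Vert (head G e)] 1 - word [Edge e] 1 \<in> rels"
    "word [Vert (head G e), Ghost e] 1 - word [Ghost e] 1 \<in> rels"
    "word [Ghost e, Vert (tail G e)] 1 - word [Ghost e] 1 \<in> rels"
    using leavitt_rels.source_edge[OF assms] leavitt_rels.edge_range[OF assms]
      leavitt_rels.range_ghost[OF assms] leavitt_rels.ghost_source[OF assms]
    by (simp_all add: fgen_def word_mult)
  then show "q (word [Vert (tail G e), Edge e] c) = q (word [Edge e] c)"
    "q (word [Edge e, Vert (head G e)] c) = q (word [Edge e] c)"
    "q (word [Vert (head G e), Ghost e] c) = q (word [Ghost e] c)"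
    "q (word [Ghost e, Vert (tail G e)] c) = q (word [Ghost e] c)"
    using assms by (simp_all add: rel_words)
qed

lemma L_closed:
  "v \<in> verts G \<Longrightarrow> scal c v \<in> carrier L" "e \<in> arcs G \<Longrightarrow> E e \<in> carrier L" "e \<in> arcs G \<Longrightarrow> Gh e \<in> carrier L"
  by (auto simp: scal_def E_def Gh_def intro!: q_closed F_word_closed)

lemma L_induct:
  assumes "x \<in> carrier L" and Q0: "Q \<zero>\<^bsub>L\<^esub>"
    and Qadd: "\<And>x y. \<lbrakk>x \<in> carrier L; y \<in> carrier L; Q x; Q y\<rbrakk> \<Longrightarrow> Q (x \<oplus>\<^bsub>L\<^esub> y)"
    and Qs: "\<And>c v. v \<in> verts G \<Longrightarrow> Q (scal c v)"
    and QE: "\<And>c e. e \<in> arcs G \<Longrightarrow> Q (E e \<otimes>\<^bsub>L\<^esub> scal c (head G e))"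
    and QG: "\<And>c e. e \<in> arcs G \<Longrightarrow> Q (scal c (head G e) \<otimes>\<^bsub>L\<^esub> Gh e)"
    and Qms: "\<And>v x. \<lbrakk>v \<in> verts G; x \<in> carrier L; Q x\<rbrakk> \<Longrightarrow> Q (scal 1 v \<otimes>\<^bsub>L\<^esub> x)"
    and QmE: "\<And>e x. \<lbrakk>e \<in> arcs G; x \<in> carrier L; Q x\<rbrakk> \<Longrightarrow> Q (E e \<otimes>\<^bsub>L\<^esub> x)"
    and QmG: "\<And>e x. \<lbrakk>e \<in> arcs G; x \<in> carrier L; Q x\<rbrakk> \<Longrightarrow> Q (Gh e \<otimes>\<^bsub>L\<^esub> x)"
  shows "Q x"
proof -
  obtain p where p: "p \<in> carrier F" "x = q p"
    using assms(1) by (rule LE)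
  have wordQ: "Q (q (word ws c))" if "ws \<noteq> []" "set ws \<subseteq> leavitt_gens G" for ws c
    using that
  proof (induction ws rule: list_nonempty_induct)
    case (single g)
    show ?case
    proof (cases g)
      case (Vert v)
      then show ?thesis
        using single Qs[of v c] by (simp add: scal_def)
    next
      case (Edge e)
      then have e: "e \<in> arcs G"
        using single by simp
      then show ?thesis
        using Edge QE[OF e, of c] q_words_mult[of "[Edge e]" "[Vert (head G e)]" 1 c]
        by (simp add: E_def scal_def E_words(2))
    next
      case (Ghost e)
      then have e: "e \<in> arcs G"
        using single by simp
      then show ?thesis
        using Ghost QG[OF e, of c] q_words_mult[of "[Vert (head G e)]" "[Ghost e]" c 1]
        by (simp add: Gh_def scal_def E_words(3))
    qed
  next
    case (cons g ws)
    have "q (word (g # ws) c) = q (word [g] 1) \<otimes>\<^bsub>L\<^esub> q (word ws c)"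
      using cons q_words_mult[of "[g]" ws 1 c] by simp
    moreover have "q (word ws c) \<in> carrier L" "Q (q (word ws c))"
      using cons by (auto intro: q_closed F_word_closed)
    ultimately show ?case
      using cons.prems Qms QmE QmG by (cases g) (auto simp: scal_def E_def Gh_def)
  qed
  have "Q (q (\<Sum>w\<in>S. Poly_Mapping.single w (Poly_Mapping.lookup p w)))
      \<and> (\<Sum>w\<in>S. Poly_Mapping.single w (Poly_Mapping.lookup p w)) \<in> carrier F"
    if "finite S" "S \<subseteq> Poly_Mapping.keys p" for S
    using that
  proof (induction S rule: finite_induct)
    case empty
    then show ?case
      using Q0 by (simp add: q_zero F_zero_closed)
  next
    case (insert w S)
    let ?m = "Poly_Mapping.single w (Poly_Mapping.lookup p w)"
    let ?s = "\<Sum>w\<in>S. Poly_Mapping.single w (Poly_Mapping.lookup p w)"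
    have w: "letters w \<noteq> []" "set (letters w) \<subseteq> leavitt_gens G"
      using insert.prems p(1) unfolding F_carrier by auto
    have m: "?m \<in> carrier F" "Q (q ?m)"
      using F_word_closed[OF w, of "Poly_Mapping.lookup p w"] wordQ[OF w, of "Poly_Mapping.lookup p w"] by simp_all
    have s: "?s \<in> carrier F" "Q (q ?s)"
      using insert by auto
    have "Q (q (?m + ?s))"
      using Qadd[of "q ?m" "q ?s"] m s by (simp add: q_add q_closed)
    then show ?case
      using insert.hyps m s by (simp add: F_add_closed)
  qed
  then have "Q (q p)"
    using sum_monomials[of p] by (metis finite_keys order_refl)
  then show ?thesis
    by (simp add: p(2))
qed

lemma leavitt_family_L: "leavitt_family L G scal E Gh"
proof unfold_locales
  show "row_finite G"
    by (rule row_finite_G)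
  fix v w :: 'v and e f :: 'e and c d :: 'k
  show "scal c v \<in> carrier L" if "v \<in> verts G"
    using that by (rule L_closed)
  show "E e \<in> carrier L" "Gh e \<in> carrier L" if "e \<in> arcs G"
    using that by (auto intro: L_closed)
  show "scal (c + d) v = scal c v \<oplus>\<^bsub>L\<^esub> scal d v" if "v \<in> verts G"
    using that q_add[of "word [Vert v] c" "word [Vert v] d"] by (simp add: scal_def F_word_closed single_add)
  show sm: "scal c v \<otimes>\<^bsub>L\<^esub> scal d w = (if v = w then scal (c * d) v else \<zero>\<^bsub>L\<^esub>)"
    if "v \<in> verts G" "w \<in> verts G"
    using that by (rule scal_mult_L)
  show "E e \<otimes>\<^bsub>L\<^esub> scal 1 (head G e) = E e" if "e \<in> arcs G"
    using that q_words_mult[of "[Edge e]" "[Vert (head G e)]" 1 1] by (simp add: E_def scal_def E_words)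
  show "scal 1 (head G e) \<otimes>\<^bsub>L\<^esub> Gh e = Gh e" if "e \<in> arcs G"
    using that q_words_mult[of "[Vert (head G e)]" "[Ghost e]" 1 1] by (simp add: Gh_def scal_def E_words)
  show "scal c v \<otimes>\<^bsub>L\<^esub> E e = (if v = tail G e then E e \<otimes>\<^bsub>L\<^esub> scal c (head G e) else \<zero>\<^bsub>L\<^esub>)"
    if "v \<in> verts G" "e \<in> arcs G"
  proof (cases "v = tail G e")
    case True
    then show ?thesis
      using that q_words_mult[of "[Vert (tail G e)]" "[Edge e]" c 1]
        q_words_mult[of "[Edge e]" "[Vert (head G e)]" 1 c]
      by (simp add: E_def scal_def E_words)
  next
    case False
    have "E e = scal 1 (tail G e) \<otimes>\<^bsub>L\<^esub> E e"
      using that q_words_mult[of "[Vert (tail G e)]" "[Edge e]" 1 1] by (simp add: E_def scal_def E_words)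
    then have "scal c v \<otimes>\<^bsub>L\<^esub> E e = scal c v \<otimes>\<^bsub>L\<^esub> scal 1 (tail G e) \<otimes>\<^bsub>L\<^esub> E e"
      using that by (metis L.m_assoc L_closed tail_in_verts)
    then show ?thesis
      using that False by (simp add: scal_mult_L L_closed)
  qed
  show "Gh e \<otimes>\<^bsub>L\<^esub> scal c v = (if v = tail G e then scal c (head G e) \<otimes>\<^bsub>L\<^esub> Gh e else \<zero>\<^bsub>L\<^esub>)"
    if "v \<in> verts G" "e \<in> arcs G"
  proof (cases "v = tail G e")
    case True
    then show ?thesis
      using that q_words_mult[of "[Ghost e]" "[Vert (tail G e)]" 1 c]
        q_words_mult[of "[Vert (head G e)]" "[Ghost e]" c 1]
      by (simp add: Gh_def scal_def E_words)
  next
    case False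
    have "Gh e = Gh e \<otimes>\<^bsub>L\<^esub> scal 1 (tail G e)"
      using that q_words_mult[of "[Ghost e]" "[Vert (tail G e)]" 1 1] by (simp add: Gh_def scal_def E_words)
    then have "Gh e \<otimes>\<^bsub>L\<^esub> scal c v = Gh e \<otimes>\<^bsub>L\<^esub> (scal 1 (tail G e) \<otimes>\<^bsub>L\<^esub> scal c v)"
      using that by (metis L.m_assoc L_closed tail_in_verts)
    then show ?thesis
      using that False by (simp add: scal_mult_L L_closed)
  qed
  show "Gh e \<otimes>\<^bsub>L\<^esub> E f = (if e = f then scal 1 (head G e) else \<zero>\<^bsub>L\<^esub>)" if "e \<in> arcs G" "f \<in> arcs G"
  proof -
    have eq: "Gh e \<otimes>\<^bsub>L\<^esub> E f = q (word [Ghost e, Edge f] 1)"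
      using that q_words_mult[of "[Ghost e]" "[Edge f]" 1 1] by (simp add: E_def Gh_def)
    show ?thesis
    proof (cases "e = f")
      case True
      have "word [Ghost e, Edge f] 1 - word [Vert (head G e)] 1 \<in> rels"
        using leavitt_rels.ghost_edge[OF that] True by (simp add: fgen_def word_mult)
      then show ?thesis
        unfolding eq using True that rel_words[of "[Ghost e, Edge f]" "[Vert (head G e)]" 1] by (simp add: scal_def)
    next
      case False
      have "word [Ghost e, Edge f] 1 \<in> rels"
        using leavitt_rels.ghost_edge[OF that] False by (simp add: fgen_def word_mult)
      then show ?thesis
        unfolding eq using False that by (simp add: q_word_zero leavitt_ideal.rel)
    qed
  qed
  show "scal 1 v = (\<Oplus>\<^bsub>L\<^esub>e\<in>out_arcs G v. E e \<otimes>\<^bsub>L\<^esub> Gh e)" if "v \<in> verts G" "out_arcs G v \<noteq> {}"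
  proof -
    have c: "fgen (Edge e) * fgen (Ghost e) \<in> carrier F" if "e \<in> out_arcs G v" for e
      using that by (intro F_mult_closed F_fgen_closed) auto
    have fin: "finite (out_arcs G v)"
      using row_finite_G \<open>v \<in> verts G\<close> by (simp add: row_finite_def)
    have "scal 1 v = q (\<Sum>e\<in>out_arcs G v. fgen (Edge e) * fgen (Ghost e))"
      unfolding scal_def fgen_def[symmetric]
      using that c leavitt_ideal.rel[OF leavitt_rels.vert_sum[OF that]]
      by (subst q_eq_iff) (simp_all only: F_sum_closed F_fgen_closed gens)
    also have "\<dots> = (\<Oplus>\<^bsub>L\<^esub>e\<in>out_arcs G v. q (fgen (Edge e) * fgen (Ghost e)))"
      using fin c by (rule q_sum)
    also have "\<dots> = (\<Oplus>\<^bsub>L\<^esub>e\<in>out_arcs G v. E e \<otimes>\<^bsub>L\<^esub> Gh e)"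
    proof (rule L.finsum_cong')
      fix e assume "e \<in> out_arcs G v"
      then have "e \<in> arcs G"
        by simp
      then show "q (fgen (Edge e) * fgen (Ghost e)) = E e \<otimes>\<^bsub>L\<^esub> Gh e"
        using q_mult[of "fgen (Edge e)" "fgen (Ghost e)"] by (simp add: E_def Gh_def fgen_def F_word_closed)
    qed (auto intro!: L.m_closed L_closed)
    finally show ?thesis .
  qed
qed (rule L_induct)

sublocale leavitt_family L G scal E Gh
  by (rule leavitt_family_L)

lemma leavitt_vertex_eq: "leavitt_vertex K G v = scal 1 v"
  by (simp add: leavitt_vertex_def scal_def fgen_def)

section \<open>Branching representations\<close>

text \<open>
  The operator of a coset, computed on an arbitrary representative; this is meaningful only if \<open>act \<theta>\<close>
  vanishes on the defining relations.
\<close>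

definition descend :: "(('v, 'e) leavitt_gen \<Rightarrow> 'x \<Rightarrow> 'x option) \<Rightarrow> ('v, 'e, 'k) leavitt_free set \<Rightarrow>
    ('x \<Rightarrow> 'k) \<Rightarrow> ('x \<Rightarrow> 'k)" where
  "descend \<theta> X = act \<theta> (SOME p. p \<in> carrier F \<and> q p = X)"

lemma act_ideal_zero:
  assumes zero_on_rels: "\<And>a f. a \<in> rels \<Longrightarrow> act \<theta> a f = 0" and "a \<in> N"
  shows "act \<theta> a f = (0 :: 'x \<Rightarrow> 'k)"
proof -
  have act0: "act \<theta> p (0 :: 'x \<Rightarrow> 'k) = 0" for p
    using act_linear_add[of \<theta> p "0 :: 'x \<Rightarrow> 'k" 0] by simp
  show ?thesis
    using assms(2)
    by (induction arbitrary: f rule: leavitt_ideal.induct)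
      (simp_all only: zero_on_rels act_zero act_add act_mult act0 add_0)
qed

lemma descend_q:
  assumes zero_on_rels: "\<And>a f. a \<in> rels \<Longrightarrow> act \<theta> a f = (0 :: 'x \<Rightarrow> 'k)" and p: "p \<in> carrier F"
  shows "descend \<theta> (q p) = act \<theta> p"
proof -
  define r where "r = (SOME r. r \<in> carrier F \<and> q r = q p)"
  have "r \<in> carrier F \<and> q r = q p"
    unfolding r_def using p by (intro someI[of "\<lambda>r. r \<in> carrier F \<and> q r = q p" p]) simp
  then have "r - p \<in> N"
    using p q_eq_iff[of r p] by blast
  then have "act \<theta> (r - p) f = 0" for f
    using act_ideal_zero[OF zero_on_rels] by blast
  then have "act \<theta> r f - act \<theta> p f = 0" for f
    by (simp only: act_diff)
  then have "act \<theta> r f = act \<theta> p f" for f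
    by (metis eq_iff_diff_eq_0)
  then show ?thesis
    unfolding descend_def r_def[symmetric] by (rule ext)
qed

text \<open>
  A partial map is attached to every generator so that all defining relations hold on points. Finiteness
  of the sets of outgoing edges allows the numbering \<open>idx\<close>; saturation guarantees that a vertex of \<open>M\<close>
  that emits edges emits one into \<open>M\<close>, so that its fibre is covered.
\<close>

lemma branching_representation:
  assumes M: "M \<subseteq> verts G" "hereditary G (verts G - M)" "saturated G (verts G - M)"
  obtains idx \<psi> where "leavitt_rep L G scal E Gh M idx \<psi>"
proof -
  define S where "S u = {f \<in> out_arcs G u. head G f \<in> M}" for u
  have finS: "finite (S u)" for u
  proof (cases "u \<in> verts G")
    case True
    then show ?thesis
      by (intro finite_subset[OF _ finite_out_arcs[OF True]]) (auto simp: S_def)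
  next
    case False
    then have "S u = {}"
      by (auto simp: S_def out_arcs_def)
    then show ?thesis
      by simp
  qed
  have "\<forall>u. \<exists>h. bij_betw h (S u) {0..<card (S u)}"
    using finS by (blast intro: ex_bij_betw_finite_nat)
  then obtain h where h: "\<And>u. bij_betw (h u) (S u) {0..<card (S u)}"
    by metis
  define idx where "idx e = h (tail G e) e" for e
  have idx_less: "idx e < card (S (tail G e))" if "e \<in> arcs G" "head G e \<in> M" for e
    using bij_betwE[OF h[of "tail G e"]] that by (auto simp: idx_def S_def out_arcs_def)
  have idx_inj: "e = f" if "e \<in> S u" "f \<in> S u" "idx e = idx f" for e f u
    using that bij_betw_imp_inj_on[OF h[of u]] by (auto simp: idx_def S_def out_arcs_def dest: inj_onD)
  have idx_surj: "\<exists>e\<in>S u. idx e = n" if "n < card (S u)" for u n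
  proof -
    have "n \<in> h u ` S u"
      unfolding bij_betw_imp_surj_on[OF h[of u]] using that by simp
    then obtain e where "e \<in> S u" "h u e = n"
      by blast
    then show ?thesis
      by (intro bexI[of _ e]) (auto simp: idx_def S_def out_arcs_def)
  qed
  have tailM: "tail G e \<in> M" if "e \<in> arcs G" "head G e \<in> M" for e
    using hereditary_complement[OF M(2) connects_arc[OF that(1)] that(2)] .
  define \<theta> :: "('v, 'e) leavitt_gen \<Rightarrow> 'v \<times> nat \<Rightarrow> ('v \<times> nat) option" where
    "\<theta> g = (\<lambda>(w, n). case g of
        Vert u \<Rightarrow> if w = u \<and> u \<in> M then Some (w, n) else None
      | Edge e \<Rightarrow> if w = head G e \<and> w \<in> M then Some (tail G e, card (S (tail G e)) * n + idx e) else None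
      | Ghost e \<Rightarrow> if w = tail G e \<and> head G e \<in> M \<and> n mod card (S w) = idx e
          then Some (head G e, n div card (S w)) else None)" for g
  have actV: "act \<theta> (fgen (Vert u)) f (w, n) = (if w = u \<and> u \<in> M then f (w, n) else 0)"
    for u w n and f :: "'v \<times> nat \<Rightarrow> 'k"
    by (simp add: act_fgen \<theta>_def)
  have actE: "act \<theta> (fgen (Edge e)) f (w, n)
      = (if w = head G e \<and> w \<in> M then f (tail G e, card (S (tail G e)) * n + idx e) else 0)"
    for e w n and f :: "'v \<times> nat \<Rightarrow> 'k"
    by (auto simp: act_fgen \<theta>_def)
  have actG: "act \<theta> (fgen (Ghost e)) f (w, n)
      = (if w = tail G e \<and> head G e \<in> M \<and> n mod card (S w) = idx e then f (head G e, n div card (S w)) else 0)"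
    for e w n and f :: "'v \<times> nat \<Rightarrow> 'k"
    by (auto simp: act_fgen \<theta>_def)
  have zero_on_rels: "act \<theta> a f = 0" if "a \<in> rels" for a and f :: "'v \<times> nat \<Rightarrow> 'k"
    using that
  proof (cases rule: leavitt_rels.cases)
    case (vert_vert v w)
    show ?thesis
    proof (cases "v = w")
      case True
      then show ?thesis
        unfolding vert_vert(1) by (auto simp: fun_eq_iff act_diff act_mult actV)
    next
      case False
      then show ?thesis
        unfolding vert_vert(1) by (auto simp: fun_eq_iff act_diff act_mult actV)
    qed
  next
    case (source_edge e)
    then show ?thesis
      unfolding source_edge(1) by (auto simp: fun_eq_iff act_diff act_mult actV actE tailM)
  next
    case (edge_range e)
    then show ?thesis
      unfolding edge_range(1) by (auto simp: fun_eq_iff act_diff act_mult actV actE)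
  next
    case (range_ghost e)
    then show ?thesis
      unfolding range_ghost(1) by (auto simp: fun_eq_iff act_diff act_mult actV actG)
  next
    case (ghost_source e)
    then show ?thesis
      unfolding ghost_source(1) by (auto simp: fun_eq_iff act_diff act_mult actV actG tailM)
  next
    case (ghost_edge e f')
    show ?thesis
    proof (cases "e = f'")
      case True
      then show ?thesis
        using idx_less[of e] ghost_edge unfolding ghost_edge(1)
        by (auto simp: fun_eq_iff act_diff act_mult actV actG actE)
    next
      case False
      have "\<not> (tail G f' = tail G e \<and> head G e \<in> M \<and> head G f' \<in> M \<and> idx f' = idx e)"
        using idx_inj[of e "tail G e" f'] False ghost_edge by (auto simp: S_def out_arcs_def)
      then show ?thesis
        using idx_less[of e] idx_less[of f'] ghost_edge False unfolding ghost_edge(1)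
        by (auto simp: fun_eq_iff act_mult actG actE)
    qed
  next
    case (vert_sum v)
    have "act \<theta> (fgen (Vert v)) f (w, n)
        = (\<Sum>e\<in>out_arcs G v. act \<theta> (fgen (Edge e) * fgen (Ghost e)) f (w, n))" for w n
    proof -
      have edge_ghost: "act \<theta> (fgen (Edge e) * fgen (Ghost e)) f (w, n) =
          (if w = tail G e \<and> head G e \<in> M \<and> n mod card (S w) = idx e then f (w, n) else 0)" for e
        by (auto simp: act_mult actE actG)
          (metis mult_div_mod_eq)
      show ?thesis
      proof (cases "w = v \<and> v \<in> M")
        case True
        then have "S v \<noteq> {}"
          using M(3) vert_sum(2,3) unfolding saturated_def S_def
          by (auto simp: out_arcs_def)
        then have "n mod card (S v) < card (S v)"
          using finS by (simp add: card_gt_0_iff)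
        \<comment> \<open>Exactly one edge has the point in its image; the other summands vanish there.\<close>
        then obtain e0 where e0: "e0 \<in> S v" "idx e0 = n mod card (S v)"
          using idx_surj by metis
        have "(\<Sum>e\<in>out_arcs G v. act \<theta> (fgen (Edge e) * fgen (Ghost e)) f (w, n))
            = (\<Sum>e\<in>out_arcs G v. if e = e0 then f (w, n) else 0)"
        proof (rule sum.cong[OF refl])
          fix e assume e: "e \<in> out_arcs G v"
          show "act \<theta> (fgen (Edge e) * fgen (Ghost e)) f (w, n) = (if e = e0 then f (w, n) else 0)"
          proof -
            have "tail G e = v \<and> (head G e \<in> M \<longleftrightarrow> e \<in> S v)"
              using e by (simp add: S_def)
            moreover have "e \<in> S v \<and> n mod card (S v) = idx e \<longleftrightarrow> e = e0"
              using e0 idx_inj[of e v e0] by metis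
            ultimately have "w = tail G e \<and> head G e \<in> M \<and> n mod card (S w) = idx e \<longleftrightarrow> e = e0"
              using True by blast
            then show ?thesis
              unfolding edge_ghost by presburger
          qed
        qed
        also have "\<dots> = f (w, n)"
          using e0(1) finite_out_arcs[OF vert_sum(2)] by (simp add: S_def)
        finally show ?thesis
          using True by (simp add: actV)
      next
        case False
        then have "act \<theta> (fgen (Edge e) * fgen (Ghost e)) f (w, n) = 0" if "e \<in> out_arcs G v" for e
          unfolding edge_ghost using that tailM by (auto simp: out_arcs_def)
        then have "(\<Sum>e\<in>out_arcs G v. act \<theta> (fgen (Edge e) * fgen (Ghost e)) f (w, n)) = 0"
          by (rule sum.neutral[OF ballI])
        moreover have "act \<theta> (fgen (Vert v)) f (w, n) = 0"
          unfolding actV using False by (rule if_not_P)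
        ultimately show ?thesis
          by (simp only:)
      qed
    qed
    moreover have "(\<Sum>i\<in>T. (g i :: 'v \<times> nat \<Rightarrow> 'k)) z = (\<Sum>i\<in>T. g i z)" for T :: "'e set" and g z
      by (induction T rule: infinite_finite_induct) simp_all
    ultimately show ?thesis
      unfolding vert_sum(1) by (simp add: fun_eq_iff act_diff act_sum)
  qed
  have dq: "descend \<theta> (q p) = act \<theta> p" if "p \<in> carrier F" for p
    using zero_on_rels that by (rule descend_q)
  have "leavitt_rep L G scal E Gh M idx (descend \<theta>)"
  proof unfold_locales
    show "hereditary G (verts G - M)"
      by (rule M(2))
    fix x y g h k
    show "descend \<theta> (x \<oplus>\<^bsub>L\<^esub> y) g = descend \<theta> x g + descend \<theta> y g"
      if "x \<in> carrier L" "y \<in> carrier L"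
      using that by (elim LE) (simp add: q_add dq F_add_closed act_add)
    show "descend \<theta> (x \<otimes>\<^bsub>L\<^esub> y) g = descend \<theta> y (descend \<theta> x g)"
      if "x \<in> carrier L" "y \<in> carrier L"
      using that by (elim LE) (simp add: q_mult dq F_mult_closed act_mult)
    show "descend \<theta> x (g + h) = descend \<theta> x g + descend \<theta> x h" if "x \<in> carrier L"
      using that by (elim LE) (simp only: dq act_linear_add)
    show "descend \<theta> x (\<lambda>z. k * g z) = (\<lambda>z. k * descend \<theta> x g z)" if "x \<in> carrier L"
      using that by (elim LE) (simp only: dq act_linear_scale)
  next
    fix v c g w n assume "v \<in> verts G"
    then show "descend \<theta> (scal c v) g (w, n) = (if w = v \<and> v \<in> M then c * g (w, n) else 0)"
      by (simp add: scal_def dq F_word_closed act_single \<theta>_def)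
  next
    fix e g w n assume e: "e \<in> arcs G"
    then show "descend \<theta> (E e) g (w, n) = (if w = head G e \<and> w \<in> M
       then g (tail G e, card {f \<in> out_arcs G (tail G e). head G f \<in> M} * n + idx e) else 0)"
      using actE[of e g w n] F_fgen_closed[of "Edge e"]
      by (auto simp: E_def dq fgen_def[symmetric] S_def)
    show "descend \<theta> (Gh e) g (w, n) =
      (if w = tail G e \<and> head G e \<in> M \<and> n mod card {f \<in> out_arcs G w. head G f \<in> M} = idx e
       then g (head G e, n div card {f \<in> out_arcs G w. head G f \<in> M}) else 0)"
      using e actG[of e g w n] F_fgen_closed[of "Ghost e"]
      by (auto simp: Gh_def dq fgen_def[symmetric] S_def)
    show "idx e < card {f \<in> out_arcs G (tail G e). head G f \<in> M}" if "head G e \<in> M"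
      using idx_less[OF e that] by (simp add: S_def)
  qed
  then show thesis
    by (rule that)
qed

text \<open>
  In the representation for \<open>M = verts G\<close> every vertex acts as a nonzero projection.
\<close>

lemma V_nonzero:
  assumes "v \<in> verts G"
  shows "V v \<noteq> \<zero>\<^bsub>L\<^esub>"
proof -
  obtain idx \<psi> where "leavitt_rep L G scal E Gh (verts G) idx \<psi>"
    by (rule branching_representation[of "verts G"]) (auto simp: hereditary_def saturated_def)
  then interpret rep: leavitt_rep L G scal E Gh "verts G" idx \<psi> .
  show ?thesis
    using rep.V_not_in_ker[OF assms assms] rep.ker.zero_closed by metis
qed

section \<open>The graph conditions are necessary\<close>

text \<open>
  If one of the two conclusions fails, some vertex of \<open>M\<close> is unbranched or acyclic in \<open>M\<close>, and the
  kernel of the branching representation for \<open>M\<close> is an ideal that contradicts the assumption.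
\<close>

lemma maximal_tail_conditions_of_infinite_corners:
  assumes corner: "\<And>I v. \<lbrakk>two_sided_ideal I L; v \<in> verts G; V v \<notin> I\<rbrakk> \<Longrightarrow>
      \<exists>e. infinite_idempotent (L Quot I) e \<and> (I +>\<^bsub>L\<^esub> V v) \<otimes>\<^bsub>L Quot I\<^esub> e = e \<and>
        e \<otimes>\<^bsub>L Quot I\<^esub> (I +>\<^bsub>L\<^esub> V v) = e"
    and M: "maximal_tail G M"
  shows "cycle_in G M p \<Longrightarrow> has_exit_in G M p"
    and "v \<in> M \<Longrightarrow> \<exists>p. cycle_in G M p \<and> connects_to_cycle G v p"
proof -
  have M': "M \<subseteq> verts G" "hereditary G (verts G - M)" "saturated G (verts G - M)"
    using M by (auto simp: maximal_tail_def)
  obtain idx \<psi> where "leavitt_rep L G scal E Gh M idx \<psi>"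
    using M' by (rule branching_representation)
  then interpret rep: leavitt_rep L G scal E Gh M idx \<psi> .
  have no: "\<not> (unbranched_in M v \<or> acyclic_in M v)" if v: "v \<in> M" for v
  proof
    assume *: "unbranched_in M v \<or> acyclic_in M v"
    have "v \<in> verts G"
      using v M' by auto
    then show False
      using corner[OF rep.two_sided_ker _ rep.V_not_in_ker[OF v]] rep.no_infinite_idempotent_in_corner[OF v _ *]
      by blast
  qed
  show "has_exit_in G M p" if "cycle_in G M p"
    using unbranched_in_cycle[OF M'(2) that] no by metis
  show "\<exists>p. cycle_in G M p \<and> connects_to_cycle G v p" if "v \<in> M"
    using acyclic_in_of_no_cycle[OF M'(2)] no[OF that] by blast
qed

text \<open>
  If \<open>y\<close> is not properly infinite, only a single loop can enter \<open>y\<close>, and \<open>y\<close> is a sink or has this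
  loop. Then \<open>{y}\<close> is the complement of a hereditary saturated set without branching, and the associated
  quotient is a division ring.
\<close>

lemma properly_infinite_vertex_of_purely_infinite:
  assumes L: "purely_infinite L" and y: "y \<in> verts G"
  shows "properly_infinite L (V y)"
proof (rule ccontr)
  assume no: "\<not> properly_infinite L (V y)"
  have loops: "tail G e = y" if "e \<in> arcs G" "head G e = y" for e
    using properly_infinite_of_incoming_edge[OF L that(1)] that V_nonzero[OF y] no by metis
  have unique: "e = f" if "e \<in> arcs G" "f \<in> arcs G" "head G e = y" "head G f = y" for e f
    using properly_infinite_of_two_loops[OF that(1,2) _ _ that(3) _ that(4)] loops that V_nonzero[OF y] no
    by metis
  have loop: "\<exists>e\<in>out_arcs G y. head G e = y" if "out_arcs G y \<noteq> {}"
    using properly_infinite_of_outgoing_edges[OF L V_nonzero y that] no by blast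
  have only: "u = y" if "awalk u p y" for u p
    using that
  proof (induction p arbitrary: u)
    case (Cons e p)
    then have "e \<in> arcs G" "tail G e = u" "awalk (head G e) p y"
      by (auto simp: awalk_simps)
    then show ?case
      using Cons.IH[of "head G e"] loops[of e] by simp
  qed (simp add: awalk_simps)
  have her: "hereditary G (verts G - {y})"
    unfolding hereditary_def
  proof (intro conjI allI impI)
    fix u w assume uw: "connects G u w \<and> u \<in> verts G - {y}"
    then have "w \<in> verts G"
      using connects_verts by blast
    moreover have "w \<noteq> y"
      using uw only by (auto simp: connects_def)
    ultimately show "w \<in> verts G - {y}"
      by simp
  qed auto
  have sat: "saturated G (verts G - {y})"
    unfolding saturated_def
  proof (intro ballI impI)
    fix u assume u: "u \<in> verts G" "out_arcs G u \<noteq> {} \<and> head G ` out_arcs G u \<subseteq> verts G - {y}"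
    have "u \<noteq> y"
      using loop u(2) by blast
    then show "u \<in> verts G - {y}"
      using u(1) by simp
  qed
  obtain idx \<psi> where "leavitt_rep L G scal E Gh {y} idx \<psi>"
    by (rule branching_representation[OF _ her sat]) (use y in simp)
  then interpret rep: leavitt_rep L G scal E Gh "{y}" idx \<psi> .
  have "unbranched_in {y} y"
    unfolding unbranched_in_def using unique by (auto simp: out_arcs_def)
  then have "is_division_ring (L Quot rep.ker)"
    using y by (intro rep.division_ring_quotient) auto
  then show False
    using L rep.two_sided_ker unfolding purely_infinite_def by blast
qed

end

section \<open>The equivalence of the seven conditions\<close>

theorem theorem7p4:
  fixes G :: "('v, 'e) pre_digraph"
    and L :: "('v, 'e, 'k::field) leavitt_free set ring"
  assumes graph: "wf_digraph G" "countable (verts G)" "countable (arcs G)"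
    and row_finite: "row_finite G"
    and L: "L = leavitt_path_algebra TYPE('k) G"
  defines "cond_i \<equiv> (\<forall>I J. two_sided_ideal I L \<and> right_ideal J (L Quot I) \<and> J \<noteq> {\<zero>\<^bsub>L Quot I\<^esub>} \<longrightarrow>
             (\<exists>e\<in>J. infinite_idempotent (L Quot I) e))"
    and "cond_ii \<equiv> (\<forall>I J. two_sided_ideal I L \<and> left_ideal J (L Quot I) \<and> J \<noteq> {\<zero>\<^bsub>L Quot I\<^esub>} \<longrightarrow>
             (\<exists>e\<in>J. infinite_idempotent (L Quot I) e))"
    and "cond_iii \<equiv> properly_purely_infinite L"
    and "cond_iv \<equiv> purely_infinite L"
    and "cond_v \<equiv> (\<forall>v\<in>verts G. properly_infinite L (leavitt_vertex TYPE('k) G v))"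
    and "cond_vi \<equiv> (\<forall>M. maximal_tail G M \<longrightarrow>
             (\<forall>p. cycle_in G M p \<longrightarrow> has_exit_in G M p) \<and>
             (\<forall>v\<in>M. \<exists>p. cycle_in G M p \<and> connects_to_cycle G v p))"
    and "cond_vii \<equiv> condition_K G \<and> (\<forall>M. maximal_tail G M \<longrightarrow>
             (\<forall>v\<in>M. \<exists>p. cycle_in G M p \<and> connects_to_cycle G v p))"
  shows "(cond_i \<longleftrightarrow> cond_ii) \<and> (cond_ii \<longleftrightarrow> cond_iii) \<and> (cond_iii \<longleftrightarrow> cond_iv) \<and>
         (cond_iv \<longleftrightarrow> cond_v) \<and> (cond_v \<longleftrightarrow> cond_vi) \<and> (cond_vi \<longleftrightarrow> cond_vii)"
proof -
  interpret A: leavitt_graph G "TYPE('k)"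
    using graph(1) row_finite by (simp add: leavitt_graph_def leavitt_graph_axioms_def)
  \<comment> \<open>(i), (ii) and (v) all lead to (vi) by way of infinite idempotents in the corners of quotients.\<close>
  have corner_vi: cond_vi
    if "\<And>I v. \<lbrakk>two_sided_ideal I A.L; v \<in> verts G; A.V v \<notin> I\<rbrakk> \<Longrightarrow>
      \<exists>e. infinite_idempotent (A.L Quot I) e \<and> (I +>\<^bsub>A.L\<^esub> A.V v) \<otimes>\<^bsub>A.L Quot I\<^esub> e = e \<and>
        e \<otimes>\<^bsub>A.L Quot I\<^esub> (I +>\<^bsub>A.L\<^esub> A.V v) = e"
    unfolding cond_vi_def using A.maximal_tail_conditions_of_infinite_corners[OF that] by blast
  have iii_iv: "cond_iii \<Longrightarrow> cond_iv"
    unfolding cond_iii_def cond_iv_def L by (rule A.L.purely_infinite_of_properly_purely_infinite)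
  have iv_v: "cond_iv \<Longrightarrow> cond_v"
    unfolding cond_iv_def cond_v_def L A.leavitt_vertex_eq
    by (intro ballI A.properly_infinite_vertex_of_purely_infinite)
  have v_vi: "cond_vi" if cond_v
  proof (rule corner_vi)
    fix I v assume I: "two_sided_ideal I A.L" and v: "v \<in> verts G" "A.V v \<notin> I"
    interpret Q: nonunital_ring_ideal A.L I
      by unfold_locales (rule I)
    interpret R: nonunital_ring "A.L Quot I"
      by (rule Q.nonunital_ring_quotient)
    have "properly_infinite A.L (A.V v)"
      using that v unfolding cond_v_def L A.leavitt_vertex_eq by blast
    then have "properly_infinite (A.L Quot I) (Q.q (A.V v))"
      using v(2) by (rule Q.properly_infinite_quotient)
    moreover have "Q.q (A.V v) \<otimes>\<^bsub>A.L Quot I\<^esub> Q.q (A.V v) = Q.q (A.V v)"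
      using v(1) by (simp add: Q.q_mult A.V_idem A.L_closed)
    ultimately show "\<exists>e. infinite_idempotent (A.L Quot I) e \<and> Q.q (A.V v) \<otimes>\<^bsub>A.L Quot I\<^esub> e = e \<and>
        e \<otimes>\<^bsub>A.L Quot I\<^esub> Q.q (A.V v) = e"
      using R.infinite_of_properly_infinite by blast
  qed
  have vertex_quotient: "(I +>\<^bsub>A.L\<^esub> A.V v) \<in> carrier (A.L Quot I)"
      "(I +>\<^bsub>A.L\<^esub> A.V v) \<otimes>\<^bsub>A.L Quot I\<^esub> (I +>\<^bsub>A.L\<^esub> A.V v) = (I +>\<^bsub>A.L\<^esub> A.V v)" "(I +>\<^bsub>A.L\<^esub> A.V v) \<noteq> \<zero>\<^bsub>A.L Quot I\<^esub>"
    if "v \<in> verts G" "A.V v \<notin> I" "nonunital_ring_ideal A.L I" for v I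
  proof -
    interpret Q: nonunital_ring_ideal A.L I
      by (rule that)
    have "A.V v \<in> carrier A.L"
      using that by (simp add: A.L_closed)
    then show "(I +>\<^bsub>A.L\<^esub> A.V v) \<in> carrier (A.L Quot I)"
      "(I +>\<^bsub>A.L\<^esub> A.V v) \<otimes>\<^bsub>A.L Quot I\<^esub> (I +>\<^bsub>A.L\<^esub> A.V v) = (I +>\<^bsub>A.L\<^esub> A.V v)" "(I +>\<^bsub>A.L\<^esub> A.V v) \<noteq> \<zero>\<^bsub>A.L Quot I\<^esub>"
      using that by (simp_all add: Q.q_mult A.V_idem Q.q_eq_zero_iff)
  qed
  have i_vi: "cond_vi" if cond_i
  proof (rule corner_vi)
    fix I v assume I: "two_sided_ideal I A.L" and v: "v \<in> verts G" "A.V v \<notin> I"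
    interpret Q: nonunital_ring_ideal A.L I
      by unfold_locales (rule I)
    interpret R: nonunital_ring "A.L Quot I"
      by (rule Q.nonunital_ring_quotient)
    have "\<exists>e\<in>J. infinite_idempotent (A.L Quot I) e"
      if "right_ideal J (A.L Quot I)" "J \<noteq> {\<zero>\<^bsub>A.L Quot I\<^esub>}" for J
      using \<open>cond_i\<close> I that unfolding cond_i_def L by blast
    then show "\<exists>e. infinite_idempotent (A.L Quot I) e \<and> Q.q (A.V v) \<otimes>\<^bsub>A.L Quot I\<^esub> e = e \<and>
        e \<otimes>\<^bsub>A.L Quot I\<^esub> Q.q (A.V v) = e"
      using R.infinite_idempotent_in_corner[OF _ vertex_quotient[OF v Q.nonunital_ring_ideal_axioms]]
      by metis
  qed
  have ii_vi: "cond_vi" if cond_ii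
  proof (rule corner_vi)
    fix I v assume I: "two_sided_ideal I A.L" and v: "v \<in> verts G" "A.V v \<notin> I"
    interpret Q: nonunital_ring_ideal A.L I
      by unfold_locales (rule I)
    interpret R: nonunital_ring "A.L Quot I"
      by (rule Q.nonunital_ring_quotient)
    have "\<exists>e\<in>J. infinite_idempotent (A.L Quot I) e"
      if "left_ideal J (A.L Quot I)" "J \<noteq> {\<zero>\<^bsub>A.L Quot I\<^esub>}" for J
      using \<open>cond_ii\<close> I that unfolding cond_ii_def L by blast
    then show "\<exists>e. infinite_idempotent (A.L Quot I) e \<and> Q.q (A.V v) \<otimes>\<^bsub>A.L Quot I\<^esub> e = e \<and>
        e \<otimes>\<^bsub>A.L Quot I\<^esub> Q.q (A.V v) = e"
      using R.infinite_idempotent_in_corner_left[OF _ vertex_quotient[OF v Q.nonunital_ring_ideal_axioms]]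
      by metis
  qed
  have vi_vii: "cond_vi \<Longrightarrow> cond_vii"
    unfolding cond_vi_def cond_vii_def using A.exits_imp_condition_K by blast
  have vii_vi: "cond_vi" if cond_vii
    unfolding cond_vi_def
  proof (intro allI impI conjI)
    fix M assume M: "maximal_tail G M"
    show "has_exit_in G M p" if "cycle_in G M p" for p
      using A.condition_K_imp_exit[OF _ _ that] \<open>cond_vii\<close> M
      unfolding cond_vii_def maximal_tail_def by blast
    show "\<forall>v\<in>M. \<exists>p. cycle_in G M p \<and> connects_to_cycle G v p"
      using \<open>cond_vii\<close> M unfolding cond_vii_def by blast
  qed
  have vii_pi: "properly_infinite A.L (A.V v)" if cond_vii "v \<in> verts G" for v
    using that unfolding cond_vii_def
    by (intro A.properly_infinite_vertex_of_condition_K A.V_nonzero) blast+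
  have vii_iii: "cond_iii" if cond_vii
    unfolding cond_iii_def L
    using that vii_pi by (intro A.properly_purely_infinite_of_vertices) (auto simp: cond_vii_def)
  have nonzero_elem: "\<exists>X\<in>J. X \<in> carrier R \<and> X \<noteq> \<zero>\<^bsub>R\<^esub>"
    if "additive_subgroup J R" "J \<noteq> {\<zero>\<^bsub>R\<^esub>}" for J and R :: "('v, 'e, 'k) leavitt_free set set ring"
    using that additive_subgroup.zero_closed[OF that(1)] additive_subgroup.a_subset[OF that(1)] by blast
  have vii_i: "cond_i" if cond_vii
    unfolding cond_i_def L
  proof (intro allI impI, elim conjE)
    fix I J assume *: "two_sided_ideal I A.L" "right_ideal J (A.L Quot I)" "J \<noteq> {\<zero>\<^bsub>A.L Quot I\<^esub>}"
    from *(2) have "additive_subgroup J (A.L Quot I)"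
      by (simp add: right_ideal_def)
    then obtain X where X: "X \<in> carrier (A.L Quot I)" "X \<in> J" "X \<noteq> \<zero>\<^bsub>A.L Quot I\<^esub>"
      using nonzero_elem *(3) by metis
    interpret Q: nonunital_ring_ideal A.L I
      by unfold_locales (rule *(1))
    interpret R: nonunital_ring "A.L Quot I"
      by (rule Q.nonunital_ring_quotient)
    obtain w where "infinite_idempotent (A.L Quot I) w" "below (A.L Quot I) w X"
      using A.infinite_idempotent_below_quotient[OF _ vii_pi[OF \<open>cond_vii\<close>] *(1) X(1,3)] \<open>cond_vii\<close>
      unfolding cond_vii_def by blast
    then show "\<exists>e\<in>J. infinite_idempotent (A.L Quot I) e"
      using R.infinite_idempotent_in_right_ideal[OF *(2) X(2)] by blast
  qed
  have vii_ii: "cond_ii" if cond_vii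
    unfolding cond_ii_def L
  proof (intro allI impI, elim conjE)
    fix I J assume *: "two_sided_ideal I A.L" "left_ideal J (A.L Quot I)" "J \<noteq> {\<zero>\<^bsub>A.L Quot I\<^esub>}"
    from *(2) have "additive_subgroup J (A.L Quot I)"
      by (simp add: left_ideal_def)
    then obtain X where X: "X \<in> carrier (A.L Quot I)" "X \<in> J" "X \<noteq> \<zero>\<^bsub>A.L Quot I\<^esub>"
      using nonzero_elem *(3) by metis
    interpret Q: nonunital_ring_ideal A.L I
      by unfold_locales (rule *(1))
    interpret R: nonunital_ring "A.L Quot I"
      by (rule Q.nonunital_ring_quotient)
    obtain w where "infinite_idempotent (A.L Quot I) w" "below (A.L Quot I) w X"
      using A.infinite_idempotent_below_quotient[OF _ vii_pi[OF \<open>cond_vii\<close>] *(1) X(1,3)] \<open>cond_vii\<close>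
      unfolding cond_vii_def by blast
    then show "\<exists>e\<in>J. infinite_idempotent (A.L Quot I) e"
      using R.infinite_idempotent_in_left_ideal[OF *(2) X(2)] by blast
  qed
  show ?thesis
    using iii_iv iv_v v_vi i_vi ii_vi vi_vii vii_vi vii_iii vii_i vii_ii by blast
qed

end
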